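(* Fix $n\ge\lambda_0$ and let $\mathcal{J}$ and $\mathcal{J}^{(n)}$ be the processes constructed in the context on $(\Omega,\mathcal{F},\mathbb{P})$. Then the following hold. (a) Conditional on $\mathcal{N}^{(n)}$, the sequence $\{J(\chi^{(n)}_\ell)\}_{\ell\ge 0}$ is a (possibly terminating) time-inhomogeneous discrete-time Markov chain on $\mathcal{E}$ with initial distribution $\boldsymbol{\alpha}$ and transition probability matrix at the $\ell$-th step ($\ell\ge 1$, i.e. from index $\ell-1$ to index $\ell$) given by $$\boldsymbol{Q}^{(n)}_\ell=\boldsymbol{I}+\frac{\boldsymbol{\Lambda}(\chi^{(n)}_\ell)}{n}.$$ (b) The bivariate process $\{(L^{(n)}(t),J^{(n)}(t))\}_{t\ge0}$ given by $$(L^{(n)}(t),J^{(n)}(t))=(\ell,J(\chi^{(n)}_\ell))\quad\text{for } t\in[\theta^{(n)}_\ell,\theta^{(n)}_{\ell+1}),\ \ell\ge 0,$$ is, conditional on $\mathcal{N}^{(n)}$, a (possibly terminating) time-homogeneous Markov jump process on $\mathbb{N}_0\times\mathcal{E}$ (ordered lexicographically) with initial distribution $(\boldsymbol{\alpha},\boldsymbol{0},\boldsymbol{0},\dots)$ and intensity matrix $$\begin{pmatrix}-n\boldsymbol{I}&n\boldsymbol{Q}^{(n)}_1& &&\\ &-n\boldsymbol{I}&n\boldsymbol{Q}^{(n)}_2& &\\ &&-n\boldsymbol{I}&n\boldsymbol{Q}^{(n)}_3&\\ &&&\ddots&\ddots\end{pmatrix},$$ where the unspecified blocks are zero.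
   Context: Let $p\ge1$, $\mathcal{E}=\{1,\dots,p\}$, and let $\boldsymbol{\Lambda}(t)=\{\Lambda_{ij}(t)\}_{i,j\in\mathcal{E}}$, $t\ge0$, be an intensity matrix function: Borel measurable, integrable over compact intervals, with $\Lambda_{ii}(t)\le0$, $\Lambda_{ij}(t)\ge0$ for $i\ne j$, and $\sum_j\Lambda_{ij}(t)\le0$. Standing assumption: $\sup_{i\in\mathcal{E},t\ge0}|\Lambda_{ii}(t)|<\infty$. Let $\boldsymbol{\alpha}=(\alpha_i)_{i\in\mathcal{E}}$ be a probability vector and $\lambda_0=\lceil\sup_{i,t}|\Lambda_{ii}(t)|\rceil$ (positive, as it is a Poisson intensity). The probability space $(\Omega,\mathcal{F},\mathbb{P})$ supports the following independent components: two independent Poisson processes $\mathcal{N},\mathcal{M}$ of intensity $\lambda_0$; two independent sequences of independent Poisson processes $\{\widehat{\mathcal{N}}^{(k)}\}_{k\ge\lambda_0+1}$ and $\{\widehat{\mathcal{M}}^{(k)}\}_{k\ge\lambda_0+1}$ of intensity $1$; and i.i.d. $\mathrm{U}(0,1)$ variables $\{U_\ell\}_{\ell\ge0}$. Process $\mathcal{J}=\{J(t)\}_{t\ge0}$: let $J(0)=i$ if $U_0\in[\sum_{j<i}\alpha_j,\sum_{j\le i}\alpha_j)$. Let $\chi_0=0$ and let $\chi_1<\chi_2<\cdots$ be the arrival times of $\mathcal{N}$; $J$ is constant on each $[\chi_\ell,\chi_{\ell+1})$. On $\{J(\chi_\ell-)=i\}$, $i\in\mathcal{E}$, set $J(\chi_\ell)=k\in\mathcal{E}$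 if $U_\ell\in[\sum_{j<k}(\lambda_0^{-1}\Lambda_{ij}(\chi_\ell)+\delta_{ij}),\sum_{j\le k}(\lambda_0^{-1}\Lambda_{ij}(\chi_\ell)+\delta_{ij}))$, and the process terminates (moves forever to a cemetery state $\star\notin\mathcal{E}$) if $U_\ell\in[1+\sum_{j\in\mathcal{E}}\lambda_0^{-1}\Lambda_{ij}(\chi_\ell),1)$. Then $\mathcal{J}$ is a time-inhomogeneous Markov jump process with initial distribution $\boldsymbol{\alpha}$ and intensity matrix function $\boldsymbol{\Lambda}(\cdot)$. For $n\ge\lambda_0$, $\mathcal{N}^{(n)}$ is the superposition of $\mathcal{N},\widehat{\mathcal{N}}^{(\lambda_0+1)},\dots,\widehat{\mathcal{N}}^{(n)}$ and $\mathcal{M}^{(n)}$ is the superposition of $\mathcal{M},\widehat{\mathcal{M}}^{(\lambda_0+1)},\dots,\widehat{\mathcal{M}}^{(n)}$ (both Poisson of intensity $n$), with arrival times $\{\chi^{(n)}_\ell\}_{\ell\ge0}$ and $\{\theta^{(n)}_\ell\}_{\ell\ge0}$ respectively, $\chi^{(n)}_0=\theta^{(n)}_0=0$. The process $\mathcal{J}^{(n)}=\{J^{(n)}(t)\}_{t\ge0}$ is $J^{(n)}(t)=J(\chi^{(n)}_\ell)$ for $t\in[\theta^{(n)}_\ell,\theta^{(n)}_{\ell+1})$. *)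

theory Defs
  imports "HOL-Probability.Probability"
begin

section \<open>Intensity matrix functions and the uniformization rate\<close>

definition intensity_matrix_function :: "nat \<Rightarrow> (nat \<Rightarrow> nat \<Rightarrow> real \<Rightarrow> real) \<Rightarrow> bool" where
  "intensity_matrix_function p \<Lambda> \<longleftrightarrow>
     (\<forall>i\<in>{1..p}. \<forall>j\<in>{1..p}.
        \<Lambda> i j \<in> borel_measurable (restrict_space borel {0..}) \<and>
        (\<forall>a b. 0 \<le> a \<longrightarrow> a \<le> b \<longrightarrow> set_integrable lborel {a..b} (\<Lambda> i j))) \<and>
     (\<forall>t\<ge>0. \<forall>i\<in>{1..p}.
        \<Lambda> i i t \<le> 0 \<and>
        (\<forall>j\<in>{1..p}. j \<noteq> i \<longrightarrow> 0 \<le> \<Lambda> i j t) \<and>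
        (\<Sum>j\<in>{1..p}. \<Lambda> i j t) \<le> 0)"

definition diagonal_sizes :: "nat \<Rightarrow> (nat \<Rightarrow> nat \<Rightarrow> real \<Rightarrow> real) \<Rightarrow> real set" where
  "diagonal_sizes p \<Lambda> = {\<bar>\<Lambda> i i t\<bar> | i t. i \<in> {1..p} \<and> 0 \<le> t}"

definition uniformization_rate :: "nat \<Rightarrow> (nat \<Rightarrow> nat \<Rightarrow> real \<Rightarrow> real) \<Rightarrow> nat" where
  "uniformization_rate p \<Lambda> = nat \<lceil>Sup (diagonal_sizes p \<Lambda>)\<rceil>"

definition probability_vector :: "nat \<Rightarrow> (nat \<Rightarrow> real) \<Rightarrow> bool" where
  "probability_vector p \<alpha> \<longleftrightarrow> (\<forall>i\<in>{1..p}. 0 \<le> \<alpha> i) \<and> (\<Sum>i\<in>{1..p}. \<alpha> i) = 1"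


section \<open>Poisson processes and their arrival times\<close>

text \<open>Processes are indexed by \<^typ>\<open>real\<close>, but only their values at nonnegative times matter.\<close>

definition counting_path :: "(real \<Rightarrow> nat) \<Rightarrow> bool" where
  "counting_path f \<longleftrightarrow> f 0 = 0 \<and> mono_on {0..} f \<and> (\<forall>t\<ge>0. continuous (at_right t) f)"

definition poisson_process :: "'w measure \<Rightarrow> real \<Rightarrow> (real \<Rightarrow> 'w \<Rightarrow> nat) \<Rightarrow> bool" where
  "poisson_process P r X \<longleftrightarrow>
     (\<forall>t\<ge>0. X t \<in> P \<rightarrow>\<^sub>M count_space UNIV) \<and>
     (\<forall>\<omega>\<in>space P. counting_path (\<lambda>t. X t \<omega>)) \<and>
     (\<forall>s t. 0 \<le> s \<longrightarrow> s < t \<longrightarrow>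
        distr P (count_space UNIV) (\<lambda>\<omega>. X t \<omega> - X s \<omega>) = measure_pmf (poisson_pmf (r * (t - s)))) \<and>
     (\<forall>k (t :: nat \<Rightarrow> real). 0 \<le> t 0 \<longrightarrow> (\<forall>i<k. t i \<le> t (Suc i)) \<longrightarrow>
        prob_space.indep_vars P (\<lambda>_. count_space UNIV)
          (\<lambda>i \<omega>. X (t (Suc i)) \<omega> - X (t i) \<omega>) {..<k})"

text \<open>
  The \<open>l\<close>-th arrival time is the first time at which the path has counted \<open>l\<close> points; it is
  infinite if there is no such time, which for a Poisson process happens with probability zero.
  Points are counted with multiplicity, so the definition also makes sense on the null event
  that superposed processes have simultaneous points.
\<close>

definition arrival :: "(real \<Rightarrow> 'w \<Rightarrow> nat) \<Rightarrow> nat \<Rightarrow> 'w \<Rightarrow> ereal" where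
  "arrival X l \<omega> = (INF t\<in>{t. 0 \<le> t \<and> l \<le> X t \<omega>}. ereal t)"

text \<open>
  Finite arrival times as real numbers; infinite ones (a null event) are sent to the
  irrelevant value \<open>0\<close>.
\<close>

definition arrival_time :: "(real \<Rightarrow> 'w \<Rightarrow> nat) \<Rightarrow> nat \<Rightarrow> 'w \<Rightarrow> real" where
  "arrival_time X l \<omega> = real_of_ereal (arrival X l \<omega>)"

definition arrival_index :: "(real \<Rightarrow> 'w \<Rightarrow> nat) \<Rightarrow> real \<Rightarrow> 'w \<Rightarrow> nat" where
  "arrival_index X t \<omega> = (THE l. arrival X l \<omega> \<le> ereal t \<and> ereal t < arrival X (Suc l) \<omega>)"

lemma arrival_le_iff:
  assumes "counting_path (\<lambda>t. X t \<omega>)" and "0 \<le> t"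
  shows "arrival X l \<omega> \<le> ereal t \<longleftrightarrow> l \<le> X t \<omega>"
proof
  assume "l \<le> X t \<omega>"
  then show "arrival X l \<omega> \<le> ereal t"
    unfolding arrival_def using assms(2) by (intro INF_lower) auto
next
  assume le: "arrival X l \<omega> \<le> ereal t"
  show "l \<le> X t \<omega>"
  proof (rule ccontr)
    assume less: "\<not> l \<le> X t \<omega>"
    have mono: "mono_on {0..} (\<lambda>t. X t \<omega>)"
      and "continuous (at_right t) (\<lambda>t. X t \<omega>)"
      using assms by (auto simp: counting_path_def)
    then have "((\<lambda>s. X s \<omega>) \<longlongrightarrow> X t \<omega>) (at_right t)"
      by (simp add: continuous_within)
    then have "\<forall>\<^sub>F s in at_right t. X s \<omega> = X t \<omega>"
      by (simp add: tendsto_discrete)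
    then obtain b where b: "b > t" "\<And>s. t < s \<Longrightarrow> s < b \<Longrightarrow> X s \<omega> = X t \<omega>"
      unfolding eventually_at_right_field by auto
    have "ereal b \<le> arrival X l \<omega>"
      unfolding arrival_def
    proof (rule INF_greatest)
      fix s assume s: "s \<in> {t. 0 \<le> t \<and> l \<le> X t \<omega>}"
      show "ereal b \<le> ereal s"
      proof (rule ccontr)
        assume "\<not> ereal b \<le> ereal s"
        then have "s < b" by simp
        then have "X s \<omega> \<le> X t \<omega>"
          using b(2)[of s] mono_onD[OF mono, of s t] s assms(2) by (cases "s \<le> t") auto
        then show False using s less by simp
      qed
    qed
    then show False using le b(1) by (meson ereal_less_eq(3) leD order_trans)
  qed
qed

lemma arrival_index_eq:
  assumes "counting_path (\<lambda>t. X t \<omega>)" and "0 \<le> t"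
  shows "arrival_index X t \<omega> = X t \<omega>"
  unfolding arrival_index_def
proof (rule the_equality)
  show "arrival X (X t \<omega>) \<omega> \<le> ereal t \<and> ereal t < arrival X (Suc (X t \<omega>)) \<omega>"
    using arrival_le_iff[where X = X and \<omega> = \<omega>, OF assms] by (metis Suc_n_not_le_n le_refl linorder_not_le)
next
  fix l assume "arrival X l \<omega> \<le> ereal t \<and> ereal t < arrival X (Suc l) \<omega>"
  then show "l = X t \<omega>"
    using arrival_le_iff[where X = X and \<omega> = \<omega>, OF assms] by (metis le_antisym linorder_not_le not_less_eq_eq)
qed

definition superposition ::
  "nat \<Rightarrow> nat \<Rightarrow> (real \<Rightarrow> 'w \<Rightarrow> nat) \<Rightarrow> (nat \<Rightarrow> real \<Rightarrow> 'w \<Rightarrow> nat) \<Rightarrow> real \<Rightarrow> 'w \<Rightarrow> nat" where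
  "superposition lam0 n X Xh t \<omega> = X t \<omega> + (\<Sum>k\<in>{lam0 + 1..n}. Xh k t \<omega>)"


section \<open>The coupled processes\<close>

text \<open>The cemetery state is \<^term>\<open>None\<close>; living states are of the form \<^term>\<open>Some i\<close>.\<close>

definition select_state :: "nat \<Rightarrow> (nat \<Rightarrow> real) \<Rightarrow> real \<Rightarrow> nat option" where
  "select_state p w u =
     (if \<exists>k\<in>{1..p}. (\<Sum>j\<in>{1..<k}. w j) \<le> u \<and> u < (\<Sum>j\<in>{1..k}. w j)
      then Some (THE k. k \<in> {1..p} \<and> (\<Sum>j\<in>{1..<k}. w j) \<le> u \<and> u < (\<Sum>j\<in>{1..k}. w j))
      else None)"

primrec embedded_chain ::
  "nat \<Rightarrow> nat \<Rightarrow> (nat \<Rightarrow> real) \<Rightarrow> (nat \<Rightarrow> nat \<Rightarrow> real \<Rightarrow> real) \<Rightarrow>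
   (nat \<Rightarrow> real) \<Rightarrow> (nat \<Rightarrow> real) \<Rightarrow> nat \<Rightarrow> nat option" where
  "embedded_chain p lam0 \<alpha> \<Lambda> \<tau> u 0 = select_state p \<alpha> (u 0)"
| "embedded_chain p lam0 \<alpha> \<Lambda> \<tau> u (Suc l) =
     (case embedded_chain p lam0 \<alpha> \<Lambda> \<tau> u l of
        None \<Rightarrow> None
      | Some i \<Rightarrow> select_state p
          (\<lambda>j. \<Lambda> i j (\<tau> (Suc l)) / real lam0 + (if i = j then 1 else 0)) (u (Suc l)))"

definition process_J ::
  "nat \<Rightarrow> nat \<Rightarrow> (nat \<Rightarrow> real) \<Rightarrow> (nat \<Rightarrow> nat \<Rightarrow> real \<Rightarrow> real) \<Rightarrow>
   (nat \<Rightarrow> 'w \<Rightarrow> real) \<Rightarrow> (real \<Rightarrow> 'w \<Rightarrow> nat) \<Rightarrow> real \<Rightarrow> 'w \<Rightarrow> nat option" where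
  "process_J p lam0 \<alpha> \<Lambda> U N t \<omega> =
     embedded_chain p lam0 \<alpha> \<Lambda> (\<lambda>l. arrival_time N l \<omega>) (\<lambda>l. U l \<omega>) (arrival_index N t \<omega>)"

text \<open>
  In the next three definitions \<open>J\<close> is the process to be sampled, \<open>Nn\<close> provides the sampling
  times and \<open>Mn\<close> provides the times at which the sampled values are put back.
\<close>

definition sampled_chain ::
  "(real \<Rightarrow> 'w \<Rightarrow> nat option) \<Rightarrow> (real \<Rightarrow> 'w \<Rightarrow> nat) \<Rightarrow> nat \<Rightarrow> 'w \<Rightarrow> nat option" where
  "sampled_chain J Nn l \<omega> = J (arrival_time Nn l \<omega>) \<omega>"

definition process_Jn ::
  "(real \<Rightarrow> 'w \<Rightarrow> nat option) \<Rightarrow> (real \<Rightarrow> 'w \<Rightarrow> nat) \<Rightarrow> (real \<Rightarrow> 'w \<Rightarrow> nat) \<Rightarrow>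
   real \<Rightarrow> 'w \<Rightarrow> nat option" where
  "process_Jn J Nn Mn t \<omega> = sampled_chain J Nn (arrival_index Mn t \<omega>) \<omega>"

text \<open>All pairs whose second component is the cemetery state are identified with \<^term>\<open>None\<close>.\<close>

definition process_LJn ::
  "(real \<Rightarrow> 'w \<Rightarrow> nat option) \<Rightarrow> (real \<Rightarrow> 'w \<Rightarrow> nat) \<Rightarrow> (real \<Rightarrow> 'w \<Rightarrow> nat) \<Rightarrow>
   real \<Rightarrow> 'w \<Rightarrow> (nat \<times> nat) option" where
  "process_LJn J Nn Mn t \<omega> = map_option (Pair (arrival_index Mn t \<omega>)) (process_Jn J Nn Mn t \<omega>)"

definition step_matrix ::
  "nat \<Rightarrow> (nat \<Rightarrow> nat \<Rightarrow> real \<Rightarrow> real) \<Rightarrow> (real \<Rightarrow> 'w \<Rightarrow> nat) \<Rightarrow> 'w \<Rightarrow>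
   nat \<Rightarrow> nat \<Rightarrow> nat \<Rightarrow> real" where
  "step_matrix n \<Lambda> Nn \<omega> l i j =
     (if i = j then 1 else 0) + \<Lambda> i j (arrival_time Nn l \<omega>) / real n"

definition block_intensity ::
  "nat \<Rightarrow> (nat \<Rightarrow> nat \<Rightarrow> nat \<Rightarrow> real) \<Rightarrow> nat \<times> nat \<Rightarrow> nat \<times> nat \<Rightarrow> real" where
  "block_intensity n Q x y = (case (x, y) of ((l, i), (m, j)) \<Rightarrow>
     if m = l then (if i = j then - real n else 0)
     else if m = Suc l then real n * Q (Suc l) i j
     else 0)"

definition block_initial :: "(nat \<Rightarrow> real) \<Rightarrow> nat \<times> nat \<Rightarrow> real" where
  "block_initial \<alpha> x = (if fst x = 0 then \<alpha> (snd x) else 0)"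


section \<open>Independent driving components\<close>

definition process_algebra :: "'w measure \<Rightarrow> (real \<Rightarrow> 'w \<Rightarrow> nat) \<Rightarrow> 'w measure" where
  "process_algebra P X =
     vimage_algebra (space P) (\<lambda>\<omega>. \<lambda>t\<in>{0..}. X t \<omega>) (PiM {0..} (\<lambda>_. count_space UNIV))"

datatype component = CN | CM | CN_hat nat | CM_hat nat | CU nat

primrec component_events ::
  "'w measure \<Rightarrow> (real \<Rightarrow> 'w \<Rightarrow> nat) \<Rightarrow> (real \<Rightarrow> 'w \<Rightarrow> nat) \<Rightarrow>
   (nat \<Rightarrow> real \<Rightarrow> 'w \<Rightarrow> nat) \<Rightarrow> (nat \<Rightarrow> real \<Rightarrow> 'w \<Rightarrow> nat) \<Rightarrow> (nat \<Rightarrow> 'w \<Rightarrow> real) \<Rightarrow>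
   component \<Rightarrow> 'w set set" where
  "component_events P N M Nh Mh U CN = sets (process_algebra P N)"
| "component_events P N M Nh Mh U CM = sets (process_algebra P M)"
| "component_events P N M Nh Mh U (CN_hat k) = sets (process_algebra P (Nh k))"
| "component_events P N M Nh Mh U (CM_hat k) = sets (process_algebra P (Mh k))"
| "component_events P N M Nh Mh U (CU l) = sets (vimage_algebra (space P) (U l) borel)"

definition component_indices :: "nat \<Rightarrow> component set" where
  "component_indices lam0 = {CN, CM} \<union> CN_hat ` {lam0 + 1..} \<union> CM_hat ` {lam0 + 1..} \<union> range CU"

definition driving_components ::
  "'w measure \<Rightarrow> nat \<Rightarrow> (real \<Rightarrow> 'w \<Rightarrow> nat) \<Rightarrow> (real \<Rightarrow> 'w \<Rightarrow> nat) \<Rightarrow>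
   (nat \<Rightarrow> real \<Rightarrow> 'w \<Rightarrow> nat) \<Rightarrow> (nat \<Rightarrow> real \<Rightarrow> 'w \<Rightarrow> nat) \<Rightarrow> (nat \<Rightarrow> 'w \<Rightarrow> real) \<Rightarrow> bool" where
  "driving_components P lam0 N M Nh Mh U \<longleftrightarrow>
     prob_space P \<and>
     poisson_process P (real lam0) N \<and>
     poisson_process P (real lam0) M \<and>
     (\<forall>k\<ge>lam0 + 1. poisson_process P 1 (Nh k)) \<and>
     (\<forall>k\<ge>lam0 + 1. poisson_process P 1 (Mh k)) \<and>
     (\<forall>l. U l \<in> borel_measurable P \<and> distr P borel (U l) = uniform_measure lborel {0<..<1}) \<and>
     prob_space.indep_sets P (component_events P N M Nh Mh U) (component_indices lam0)"


section \<open>Possibly terminating Markov chains and Markov jump processes\<close>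

text \<open>
  Extension of a matrix on \<open>S\<close> to \<open>S\<close> together with an absorbing cemetery state, such that all
  row sums become equal to \<open>c\<close>; used with \<open>c = 1\<close> for transition matrices and with \<open>c = 0\<close> for
  intensity matrices.
\<close>

fun with_cemetery :: "real \<Rightarrow> 's set \<Rightarrow> ('s \<Rightarrow> 's \<Rightarrow> real) \<Rightarrow> 's option \<Rightarrow> 's option \<Rightarrow> real" where
  "with_cemetery c S A (Some x) (Some y) = A x y"
| "with_cemetery c S A (Some x) None = c - (\<Sum>\<^sub>\<infinity>y\<in>S. A x y)"
| "with_cemetery c S A None (Some y) = 0"
| "with_cemetery c S A None None = c"

definition substochastic_matrix :: "'s set \<Rightarrow> ('s \<Rightarrow> 's \<Rightarrow> real) \<Rightarrow> bool" where
  "substochastic_matrix S Q \<longleftrightarrow>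
     (\<forall>x\<in>S. (\<forall>y\<in>S. 0 \<le> Q x y) \<and> Q x summable_on S \<and> (\<Sum>\<^sub>\<infinity>y\<in>S. Q x y) \<le> 1)"

definition intensity_matrix :: "'s set \<Rightarrow> ('s \<Rightarrow> 's \<Rightarrow> real) \<Rightarrow> bool" where
  "intensity_matrix S A \<longleftrightarrow>
     (\<forall>x\<in>S. A x x \<le> 0 \<and> (\<forall>y\<in>S. y \<noteq> x \<longrightarrow> 0 \<le> A x y) \<and>
        A x summable_on S \<and> (\<Sum>\<^sub>\<infinity>y\<in>S. A x y) \<le> 0)"

text \<open>
  Possibly terminating time-inhomogeneous Markov chain on the countable set \<open>S\<close> with initial
  distribution \<open>\<mu>\<close>; the matrix \<open>Q l\<close> governs the step from index \<open>l - 1\<close> to index \<open>l\<close>.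
\<close>

definition markov_chain ::
  "'a measure \<Rightarrow> (nat \<Rightarrow> 'a \<Rightarrow> 's option) \<Rightarrow> 's set \<Rightarrow> ('s \<Rightarrow> real) \<Rightarrow>
   (nat \<Rightarrow> 's \<Rightarrow> 's \<Rightarrow> real) \<Rightarrow> bool" where
  "markov_chain P Y S \<mu> Q \<longleftrightarrow>
     prob_space P \<and>
     (\<forall>l. Y l \<in> P \<rightarrow>\<^sub>M count_space UNIV) \<and>
     (\<forall>l. AE \<omega> in P. Y l \<omega> \<in> insert None (Some ` S)) \<and>
     (\<forall>x\<in>S. \<P>(\<omega> in P. Y 0 \<omega> = Some x) = \<mu> x) \<and>
     (\<forall>l\<ge>1. substochastic_matrix S (Q l)) \<and>
     (\<forall>l\<ge>1. \<forall>x y. (\<forall>k<l. x k \<in> insert None (Some ` S)) \<longrightarrow> y \<in> insert None (Some ` S) \<longrightarrow>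
        \<P>(\<omega> in P. \<forall>k<l. Y k \<omega> = x k) > 0 \<longrightarrow>
        \<P>(\<omega> in P. Y l \<omega> = y \<bar> \<forall>k<l. Y k \<omega> = x k) = with_cemetery 1 S (Q l) (x (l - 1)) y)"

text \<open>
  Right-continuous paths with left limits for the discrete topology, i.e. piecewise constant
  paths with finitely many jumps in every compact time interval.
\<close>

definition jump_path :: "(real \<Rightarrow> 'b) \<Rightarrow> bool" where
  "jump_path f \<longleftrightarrow>
     (\<forall>t\<ge>0. \<exists>e>0. \<forall>s\<in>{t..<t + e}. f s = f t) \<and>
     (\<forall>t>0. \<exists>e>0. \<exists>x. \<forall>s\<in>{t - e<..<t} \<inter> {0..}. f s = x)"

text \<open>Stochastic transition semigroup on the countable set \<open>S\<close>.\<close>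

definition transition_semigroup :: "'b set \<Rightarrow> (real \<Rightarrow> 'b \<Rightarrow> 'b \<Rightarrow> real) \<Rightarrow> bool" where
  "transition_semigroup S p \<longleftrightarrow>
     (\<forall>t\<ge>0. \<forall>x\<in>S. (\<forall>y\<in>S. 0 \<le> p t x y) \<and> (p t x has_sum 1) S) \<and>
     (\<forall>x\<in>S. \<forall>y\<in>S. p 0 x y = (if x = y then 1 else 0)) \<and>
     (\<forall>s\<ge>0. \<forall>t\<ge>0. \<forall>x\<in>S. \<forall>y\<in>S. ((\<lambda>z. p s x z * p t z y) has_sum p (s + t) x y) S)"

text \<open>
  Possibly terminating time-homogeneous Markov jump process on the countable set \<open>S\<close> with
  initial distribution \<open>\<mu>\<close>: its transition probabilities form a semigroup whose derivative at
  zero is the intensity matrix \<open>A\<close>, extended to the cemetery state.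
\<close>

definition markov_jump_process ::
  "'a measure \<Rightarrow> (real \<Rightarrow> 'a \<Rightarrow> 's option) \<Rightarrow> 's set \<Rightarrow> ('s \<Rightarrow> real) \<Rightarrow>
   ('s \<Rightarrow> 's \<Rightarrow> real) \<Rightarrow> bool" where
  "markov_jump_process P X S \<mu> A \<longleftrightarrow>
     prob_space P \<and>
     (\<forall>t\<ge>0. X t \<in> P \<rightarrow>\<^sub>M count_space UNIV) \<and>
     (\<forall>\<omega>\<in>space P. jump_path (\<lambda>t. X t \<omega>)) \<and>
     (\<forall>t\<ge>0. AE \<omega> in P. X t \<omega> \<in> insert None (Some ` S)) \<and>
     (\<forall>x\<in>S. \<P>(\<omega> in P. X 0 \<omega> = Some x) = \<mu> x) \<and>
     intensity_matrix S A \<and>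
     (\<exists>p. transition_semigroup (insert None (Some ` S)) p \<and>
        (\<forall>x\<in>insert None (Some ` S). \<forall>y\<in>insert None (Some ` S).
           ((\<lambda>h. (p h x y - (if x = y then 1 else 0)) / h) \<longlongrightarrow> with_cemetery 0 S A x y) (at_right 0)) \<and>
        (\<forall>k (t :: nat \<Rightarrow> real) x y.
           0 \<le> t 0 \<longrightarrow> (\<forall>i\<le>k. t i < t (Suc i)) \<longrightarrow>
           (\<forall>i\<le>k. x i \<in> insert None (Some ` S)) \<longrightarrow> y \<in> insert None (Some ` S) \<longrightarrow>
           \<P>(\<omega> in P. \<forall>i\<le>k. X (t i) \<omega> = x i) > 0 \<longrightarrow>
           \<P>(\<omega> in P. X (t (Suc k)) \<omega> = y \<bar> \<forall>i\<le>k. X (t i) \<omega> = x i) =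
             p (t (Suc k) - t k) (x k) y))"


section \<open>Conditional laws\<close>

text \<open>\<open>K\<close> is a regular conditional distribution, given the sub-sigma-algebra \<open>F\<close>, of the random
  element \<open>Y\<close> of the measurable space \<open>E\<close>.\<close>

definition conditional_distribution ::
  "'w measure \<Rightarrow> 'w measure \<Rightarrow> ('w \<Rightarrow> 'b) \<Rightarrow> 'b measure \<Rightarrow> ('w \<Rightarrow> 'b measure) \<Rightarrow> bool" where
  "conditional_distribution P F Y E K \<longleftrightarrow>
     subalgebra P F \<and> Y \<in> P \<rightarrow>\<^sub>M E \<and> K \<in> F \<rightarrow>\<^sub>M prob_algebra E \<and>
     (\<forall>A\<in>sets E. AE \<omega> in P.
        measure (K \<omega>) A = real_cond_exp P F (indicator (Y -` A \<inter> space P)) \<omega>)"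

text \<open>
  Conditionally on \<open>F\<close>, the law of \<open>Y\<close> has the (possibly \<open>\<omega>\<close>-dependent) property \<open>\<Phi> \<omega>\<close>. For the
  two countably generated spaces \<open>E\<close> below, regular conditional distributions are unique up to
  null sets, so the choice of \<open>K\<close> does not matter.
\<close>

definition conditionally ::
  "'w measure \<Rightarrow> 'w measure \<Rightarrow> ('w \<Rightarrow> 'b) \<Rightarrow> 'b measure \<Rightarrow> ('w \<Rightarrow> 'b measure \<Rightarrow> bool) \<Rightarrow> bool" where
  "conditionally P F Y E \<Phi> \<longleftrightarrow>
     (\<exists>K. conditional_distribution P F Y E K \<and> (AE \<omega> in P. \<Phi> \<omega> (K \<omega>)))"

definition sequence_space :: "(nat \<Rightarrow> 's option) measure" where
  "sequence_space = PiM UNIV (\<lambda>_. count_space UNIV)"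

text \<open>
  Paths on \<open>[0,\<infinity>)\<close> with the sigma-algebra generated by the evaluations. It is restricted to
  jump paths, because the full product space cannot express regularity of paths.
\<close>

definition jump_path_space :: "(real \<Rightarrow> 's option) measure" where
  "jump_path_space = restrict_space (PiM {0..} (\<lambda>_. count_space UNIV)) {f. jump_path f}"

definition conditionally_markov_chain ::
  "'w measure \<Rightarrow> 'w measure \<Rightarrow> (nat \<Rightarrow> 'w \<Rightarrow> 's option) \<Rightarrow> 's set \<Rightarrow> ('s \<Rightarrow> real) \<Rightarrow>
   ('w \<Rightarrow> nat \<Rightarrow> 's \<Rightarrow> 's \<Rightarrow> real) \<Rightarrow> bool" where
  "conditionally_markov_chain P F Y S \<mu> Q \<longleftrightarrow>
     conditionally P F (\<lambda>\<omega> l. Y l \<omega>) sequence_space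
       (\<lambda>\<omega> R. markov_chain R (\<lambda>l y. y l) S \<mu> (Q \<omega>))"

definition conditionally_markov_jump_process ::
  "'w measure \<Rightarrow> 'w measure \<Rightarrow> (real \<Rightarrow> 'w \<Rightarrow> 's option) \<Rightarrow> 's set \<Rightarrow> ('s \<Rightarrow> real) \<Rightarrow>
   ('w \<Rightarrow> 's \<Rightarrow> 's \<Rightarrow> real) \<Rightarrow> bool" where
  "conditionally_markov_jump_process P F X S \<mu> A \<longleftrightarrow>
     conditionally P F (\<lambda>\<omega>. \<lambda>t\<in>{0..}. X t \<omega>) jump_path_space
       (\<lambda>\<omega> R. markov_jump_process R (\<lambda>t f. f t) S \<mu> (A \<omega>))"

end

theory Submission
  imports Defs "HOL-Real_Asymp.Real_Asymp"
begin

text \<open>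
  Why the theorem holds. Every point of the superposition \<open>N\<^sup>(\<^sup>n\<^sup>)\<close> is a point of \<open>N\<close> with probability
  \<open>q = \<lambda>\<^sub>0 / n\<close>, independently of the other points and of where the points lie. The process \<open>J\<close> only
  moves at points of \<open>N\<close>, and then according to \<open>I + \<Lambda> / \<lambda>\<^sub>0\<close>. So between two consecutive points of the
  superposition the sampled chain stays put with probability \<open>1 - q\<close> and otherwise uses
  \<open>I + \<Lambda> / \<lambda>\<^sub>0\<close>, and the mixture \<open>(1 - q) I + q (I + \<Lambda> / \<lambda>\<^sub>0)\<close> is exactly \<open>I + \<Lambda> / n\<close>. Running this
  chain by the independent Poisson clock \<open>M\<^sup>(\<^sup>n\<^sup>)\<close> turns its \<open>l\<close>-th step into a jump of intensity
  \<open>n (I + \<Lambda> / n)\<close> from level \<open>l - 1\<close> to level \<open>l\<close>.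

  The marking property is \<open>thinning\<close>. It is the colouring theorem read backwards: attach coin tosses to
  the points of the superposition and keep the heads. The resulting pair of processes has the same
  finite-dimensional distributions as the given independent pair (\<open>pair_values\<close>, \<open>thinned_values\<close>),
  hence the same law, and the marks are a measurable function of the pair as soon as almost surely no two
  points coincide (\<open>AE_levels_visited\<close>). So the marks of the given pair behave like coin tosses that are
  independent of the superposition.

  Conditioning then costs nothing. Almost surely the sampled chain is a function of the points of the
  superposition, on which one conditions, and of noise that is independent of them: the marks, the
  uniform variables and the clock (\<open>sampled_chain_driven\<close>). Freezing the points therefore gives a regular
  conditional distribution (\<open>conditional_distribution_freeze\<close>), and it remains to study the chain for
  deterministic points. Its law along paths in living states is a sum over the possible sequences of
  marks, which factorizes (\<open>driven_path_law\<close>). Since the cemetery absorbs, such path probabilities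
  determine everything else: they give the Markov chain of the first claim
  (\<open>killed_chain.markov_chain\<close>) and, with the clock, the Markov jump process of the second
  (\<open>clocked_chain.markov_jump_process\<close>), whose transition probabilities are Poisson weights times products
  of transition matrices.
\<close>

section \<open>Poisson increments\<close>

text \<open>
  The rate \<open>0\<close> is included, with \<open>0 ^ 0 = 1\<close>. Grids with repeated times and the superposition of no
  processes at all then obey the same formulas as everything else.
\<close>

definition poisson_density :: "real \<Rightarrow> nat \<Rightarrow> real" where
  "poisson_density r k = r ^ k / fact k * exp (- r)"

lemma poisson_density_nonneg: "0 \<le> r \<Longrightarrow> 0 \<le> poisson_density r k"
  by (simp add: poisson_density_def)

lemma poisson_density_0: "poisson_density 0 k = (if k = 0 then 1 else 0)"
  by (simp add: poisson_density_def)

lemma poisson_density_convolution: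
  "(\<Sum>j\<le>k. poisson_density r j * poisson_density s (k - j)) = poisson_density (r + s) k"
proof -
  have "(r + s) ^ k / fact k = (\<Sum>j\<le>k. (r ^ j / fact j) * (s ^ (k - j) / fact (k - j)))"
    unfolding binomial_ring sum_divide_distrib
    by (rule sum.cong) (auto simp: binomial_fact field_simps)
  moreover have "exp (- (r + s)) = exp (- r) * exp (- s)"
    by (simp add: exp_add[symmetric])
  ultimately show ?thesis
    unfolding poisson_density_def by (simp add: sum_distrib_left sum_distrib_right mult_ac)
qed

text \<open>
  All that is used of a Poisson process besides the shape of its paths. The increments are differences
  of natural numbers, which is harmless because all paths considered are monotone.
\<close>

definition poisson_increments :: "'w measure \<Rightarrow> real \<Rightarrow> (real \<Rightarrow> 'w \<Rightarrow> nat) \<Rightarrow> bool" where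
  "poisson_increments P r X \<longleftrightarrow>
     (\<forall>k (t :: nat \<Rightarrow> real) a. 0 \<le> t 0 \<longrightarrow> (\<forall>i<k. t i \<le> t (Suc i)) \<longrightarrow>
        \<P>(\<omega> in P. \<forall>i<k. X (t (Suc i)) \<omega> - X (t i) \<omega> = a i) =
          (\<Prod>i<k. poisson_density (r * (t (Suc i) - t i)) (a i)))"

lemma poisson_process_increments:
  assumes P: "prob_space P" and X: "poisson_process P r X" and r: "0 < r"
  shows "poisson_increments P r X"
  unfolding poisson_increments_def
proof (intro allI impI)
  interpret prob_space P by fact
  fix k and t :: "nat \<Rightarrow> real" and a :: "nat \<Rightarrow> nat"
  assume t0: "0 \<le> t 0" and t: "\<forall>i<k. t i \<le> t (Suc i)"
  have nonneg: "0 \<le> t i" if "i \<le> k" for i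
    using that by (induction i) (use t0 t in \<open>auto intro: order_trans\<close>)
  let ?D = "\<lambda>i \<omega>. X (t (Suc i)) \<omega> - X (t i) \<omega>"
  have indep: "indep_vars (\<lambda>_. count_space UNIV) ?D {..<k}"
    using X t0 t unfolding poisson_process_def by blast
  have one: "\<P>(\<omega> in P. ?D i \<omega> = a i) = poisson_density (r * (t (Suc i) - t i)) (a i)" if i: "i < k" for i
  proof (cases "t i = t (Suc i)")
    case True
    then show ?thesis by (auto simp: poisson_density_0 prob_space)
  next
    case False
    then have less: "t i < t (Suc i)" using t i by force
    have [measurable]: "X (t i) \<in> P \<rightarrow>\<^sub>M count_space UNIV" "X (t (Suc i)) \<in> P \<rightarrow>\<^sub>M count_space UNIV"
      using X nonneg[of i] nonneg[of "Suc i"] i unfolding poisson_process_def by auto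
    have [measurable]: "?D i \<in> P \<rightarrow>\<^sub>M count_space UNIV"
      using indep i by (auto simp: indep_vars_def)
    have d: "distr P (count_space UNIV) (?D i) = measure_pmf (poisson_pmf (r * (t (Suc i) - t i)))"
      using X less nonneg[of i] i unfolding poisson_process_def by simp
    have "\<P>(\<omega> in P. ?D i \<omega> = a i) = measure (distr P (count_space UNIV) (?D i)) {a i}"
      by (subst measure_distr) (auto intro!: arg_cong[where f = prob])
    also have "\<dots> = poisson_density (r * (t (Suc i) - t i)) (a i)"
      using less r by (simp add: d measure_pmf_single poisson_density_def)
    finally show ?thesis .
  qed
  show "\<P>(\<omega> in P. \<forall>i<k. ?D i \<omega> = a i) = (\<Prod>i<k. poisson_density (r * (t (Suc i) - t i)) (a i))"
  proof (cases "k = 0")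
    case True
    then show ?thesis by (simp add: prob_space)
  next
    case False
    have "prob (\<Inter>i\<in>{..<k}. ?D i -` {a i} \<inter> space P) = (\<Prod>i<k. prob (?D i -` {a i} \<inter> space P))"
      using False by (intro indep_varsD[OF indep]) auto
    also have "(\<Inter>i\<in>{..<k}. ?D i -` {a i} \<inter> space P) = {\<omega>\<in>space P. \<forall>i<k. ?D i \<omega> = a i}"
      using False by auto
    also have "(\<Prod>i<k. prob (?D i -` {a i} \<inter> space P)) = (\<Prod>i<k. poisson_density (r * (t (Suc i) - t i)) (a i))"
      by (intro prod.cong refl) (simp add: one[symmetric] vimage_def Int_def conj_commute)
    finally show ?thesis .
  qed
qed

lemma increments_event:
  fixes X :: "real \<Rightarrow> 'w \<Rightarrow> nat"
  assumes "\<And>i. i \<le> k \<Longrightarrow> X (t i) \<in> G \<rightarrow>\<^sub>M count_space UNIV"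
  shows "{\<omega>\<in>space G. \<forall>i<k. X (t (Suc i)) \<omega> - X (t i) \<omega> = b i} \<in> sets G"
proof -
  have "{\<omega>\<in>space G. X (t (Suc i)) \<omega> - X (t i) \<omega> = b i} \<in> sets G" if "i < k" for i
  proof -
    have [measurable]: "X (t i) \<in> G \<rightarrow>\<^sub>M count_space UNIV" "X (t (Suc i)) \<in> G \<rightarrow>\<^sub>M count_space UNIV"
      using assms that by auto
    show ?thesis by measurable
  qed
  then have "{\<omega>\<in>space G. \<forall>i\<in>{..<k}. X (t (Suc i)) \<omega> - X (t i) \<omega> = b i} \<in> sets G"
    by (intro sets.sets_Collect_finite_All) auto
  then show ?thesis by (simp only: Ball_def lessThan_iff)
qed

text \<open>
  Each increment of the sum splits in finitely many ways into increments of the two summands.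
  Independence turns the probability of a splitting into a product, and the binomial theorem sums the
  products, one grid cell at a time.
\<close>

lemma poisson_increments_add:
  fixes X Y :: "real \<Rightarrow> 'w \<Rightarrow> nat"
  assumes P: "prob_space P"
    and X: "poisson_increments P r X" and Y: "poisson_increments P s Y"
    and mX: "\<And>\<omega>. \<omega> \<in> space P \<Longrightarrow> mono_on {0..} (\<lambda>t. X t \<omega>)"
    and mY: "\<And>\<omega>. \<omega> \<in> space P \<Longrightarrow> mono_on {0..} (\<lambda>t. Y t \<omega>)"
    and XG: "\<And>t. 0 \<le> t \<Longrightarrow> X t \<in> G \<rightarrow>\<^sub>M count_space UNIV"
    and YH: "\<And>t. 0 \<le> t \<Longrightarrow> Y t \<in> H \<rightarrow>\<^sub>M count_space UNIV"
    and G: "subalgebra P G" and H: "subalgebra P H"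
    and indep: "\<And>A B. A \<in> sets G \<Longrightarrow> B \<in> sets H \<Longrightarrow> measure P (A \<inter> B) = measure P A * measure P B"
  shows "poisson_increments P (r + s) (\<lambda>t \<omega>. X t \<omega> + Y t \<omega>)"
  unfolding poisson_increments_def
proof (intro allI impI)
  interpret prob_space P by fact
  fix k and t :: "nat \<Rightarrow> real" and a :: "nat \<Rightarrow> nat"
  assume t0: "0 \<le> t 0" and t: "\<forall>i<k. t i \<le> t (Suc i)"
  have nonneg: "0 \<le> t i" if "i \<le> k" for i
    using that by (induction i) (use t0 t in \<open>auto intro: order_trans\<close>)
  have spG: "space G = space P" "sets G \<subseteq> sets P" "space H = space P" "sets H \<subseteq> sets P"
    using G H by (auto simp: subalgebra_def)
  define SX where "SX b = {\<omega>\<in>space P. \<forall>i<k. X (t (Suc i)) \<omega> - X (t i) \<omega> = b i}" for b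
  define SY where "SY b = {\<omega>\<in>space P. \<forall>i<k. Y (t (Suc i)) \<omega> - Y (t i) \<omega> = b i}" for b
  have meas: "X (t i) \<in> G \<rightarrow>\<^sub>M count_space UNIV" "Y (t i) \<in> H \<rightarrow>\<^sub>M count_space UNIV" if "i \<le> k" for i
    using that XG YH nonneg by auto
  have SX: "SX b \<in> sets G" for b
    unfolding SX_def using increments_event[of k X t G b, OF meas(1)] by (simp only: spG)
  have SY: "SY b \<in> sets H" for b
    unfolding SY_def using increments_event[of k Y t H b, OF meas(2)] by (simp only: spG)
  let ?B = "PiE {..<k} (\<lambda>i. {..a i})"
  have split: "{\<omega>\<in>space P. \<forall>i<k. X (t (Suc i)) \<omega> + Y (t (Suc i)) \<omega> - (X (t i) \<omega> + Y (t i) \<omega>) = a i}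
      = (\<Union>b\<in>?B. SX b \<inter> SY (\<lambda>i. a i - b i))" (is "?L = ?R")
  proof (intro equalityI subsetI)
    fix \<omega> assume "\<omega> \<in> ?L"
    then have w: "\<omega> \<in> space P" and e: "\<And>i. i < k \<Longrightarrow> X (t (Suc i)) \<omega> + Y (t (Suc i)) \<omega> - (X (t i) \<omega> + Y (t i) \<omega>) = a i"
      by auto
    have m: "X (t i) \<omega> \<le> X (t (Suc i)) \<omega>" "Y (t i) \<omega> \<le> Y (t (Suc i)) \<omega>" if "i < k" for i
      using mono_onD[OF mX[OF w], of "t i" "t (Suc i)"] mono_onD[OF mY[OF w], of "t i" "t (Suc i)"]
        nonneg[of i] nonneg[of "Suc i"] t that by auto
    let ?b = "restrict (\<lambda>i. X (t (Suc i)) \<omega> - X (t i) \<omega>) {..<k}"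
    have le: "X (t (Suc i)) \<omega> - X (t i) \<omega> \<le> a i"
      and dY: "Y (t (Suc i)) \<omega> - Y (t i) \<omega> = a i - (X (t (Suc i)) \<omega> - X (t i) \<omega>)" if "i < k" for i
      using e[OF that] m[OF that] by linarith+
    have "?b \<in> ?B" using le by auto
    moreover have "\<omega> \<in> SX ?b \<inter> SY (\<lambda>i. a i - ?b i)"
      using w dY unfolding SX_def SY_def by auto
    ultimately show "\<omega> \<in> ?R" by blast
  next
    fix \<omega> assume "\<omega> \<in> ?R"
    then obtain b where b: "b \<in> ?B" and w: "\<omega> \<in> space P"
      and e: "\<And>i. i < k \<Longrightarrow> X (t (Suc i)) \<omega> - X (t i) \<omega> = b i" "\<And>i. i < k \<Longrightarrow> Y (t (Suc i)) \<omega> - Y (t i) \<omega> = a i - b i"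
      by (auto simp: SX_def SY_def)
    have m: "X (t i) \<omega> \<le> X (t (Suc i)) \<omega>" "Y (t i) \<omega> \<le> Y (t (Suc i)) \<omega>" if "i < k" for i
      using mono_onD[OF mX[OF w], of "t i" "t (Suc i)"] mono_onD[OF mY[OF w], of "t i" "t (Suc i)"]
        nonneg[of i] nonneg[of "Suc i"] t that by auto
    have ba: "b i \<le> a i" if "i < k" for i using b that by (auto simp: PiE_iff)
    have "X (t (Suc i)) \<omega> + Y (t (Suc i)) \<omega> - (X (t i) \<omega> + Y (t i) \<omega>) = a i" if "i < k" for i
      using e[OF that] m[OF that] ba[OF that] by linarith
    then show "\<omega> \<in> ?L" using w by blast
  qed
  have disj: "disjoint_family_on (\<lambda>b. SX b \<inter> SY (\<lambda>i. a i - b i)) ?B"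
    unfolding disjoint_family_on_def
  proof (intro ballI impI)
    fix b c assume "b \<in> ?B" "c \<in> ?B" "b \<noteq> c"
    then obtain i where "i < k" "b i \<noteq> c i" by (metis PiE_ext lessThan_iff)
    then show "SX b \<inter> SY (\<lambda>i. a i - b i) \<inter> (SX c \<inter> SY (\<lambda>i. a i - c i)) = {}" by (auto simp: SX_def)
  qed
  have ev: "SX b \<in> events" "SY b \<in> events" for b using SX SY spG by auto
  have "prob (\<Union>b\<in>?B. SX b \<inter> SY (\<lambda>i. a i - b i)) = (\<Sum>b\<in>?B. prob (SX b \<inter> SY (\<lambda>i. a i - b i)))"
    using ev disj by (intro finite_measure_finite_Union) (auto intro: finite_PiE)
  also have "\<dots> = (\<Sum>b\<in>?B. \<Prod>i<k. poisson_density (r * (t (Suc i) - t i)) (b i)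
                                 * poisson_density (s * (t (Suc i) - t i)) (a i - b i))"
  proof (rule sum.cong[OF refl])
    fix b
    have "prob (SX b) = (\<Prod>i<k. poisson_density (r * (t (Suc i) - t i)) (b i))"
      unfolding SX_def using X t0 t unfolding poisson_increments_def by blast
    moreover have "prob (SY (\<lambda>i. a i - b i)) = (\<Prod>i<k. poisson_density (s * (t (Suc i) - t i)) (a i - b i))"
      unfolding SY_def using Y[unfolded poisson_increments_def, rule_format, of t k "\<lambda>i. a i - b i"] t0 t by simp
    ultimately show "prob (SX b \<inter> SY (\<lambda>i. a i - b i)) = (\<Prod>i<k. poisson_density (r * (t (Suc i) - t i)) (b i)
                                 * poisson_density (s * (t (Suc i) - t i)) (a i - b i))"
      using indep[OF SX SY] by (simp add: prod.distrib)
  qed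
  also have "\<dots> = (\<Prod>i<k. \<Sum>j\<le>a i. poisson_density (r * (t (Suc i) - t i)) j
                                 * poisson_density (s * (t (Suc i) - t i)) (a i - j))"
    by (rule prod_sum_PiE[symmetric]) auto
  also have "\<dots> = (\<Prod>i<k. poisson_density ((r + s) * (t (Suc i) - t i)) (a i))"
    by (simp add: poisson_density_convolution distrib_right)
  finally show "\<P>(\<omega> in P. \<forall>i<k. X (t (Suc i)) \<omega> + Y (t (Suc i)) \<omega> - (X (t i) \<omega> + Y (t i) \<omega>) = a i)
      = (\<Prod>i<k. poisson_density ((r + s) * (t (Suc i) - t i)) (a i))"
    unfolding split .
qed

text \<open>
  Truncated subtraction loses information in general. Along a monotone path from \<open>0\<close> it does not, so that
  prescribing values is the same as prescribing increments, provided that the values are monotone.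
\<close>

lemma path_values_iff_increments:
  fixes f :: "real \<Rightarrow> nat"
  assumes f: "mono_on {0..} f" "f 0 = 0" and t: "t 0 = 0" "\<forall>i<k. t i \<le> t (Suc i)"
  shows "(\<forall>i\<le>k. f (t i) = v i) \<longleftrightarrow>
    v 0 = 0 \<and> (\<forall>i<k. v i \<le> v (Suc i)) \<and> (\<forall>i<k. f (t (Suc i)) - f (t i) = v (Suc i) - v i)"
proof -
  have nonneg: "0 \<le> t i" if "i \<le> k" for i
    using that by (induction i) (use t in \<open>auto intro: order_trans\<close>)
  have mono: "f (t i) \<le> f (t (Suc i))" if "i < k" for i
    using mono_onD[OF f(1), of "t i" "t (Suc i)"] nonneg[of i] nonneg[of "Suc i"] t(2) that by auto
  show ?thesis
  proof (intro iffI conjI allI impI)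
    assume v: "\<forall>i\<le>k. f (t i) = v i"
    show "v 0 = 0" using v f(2) t(1) by (metis le0)
    fix i assume i: "i < k"
    show "v i \<le> v (Suc i)" using mono[OF i] v i by (metis Suc_leI less_imp_le)
    show "f (t (Suc i)) - f (t i) = v (Suc i) - v i" using v i by (metis Suc_leI less_imp_le)
  next
    assume v: "v 0 = 0 \<and> (\<forall>i<k. v i \<le> v (Suc i)) \<and> (\<forall>i<k. f (t (Suc i)) - f (t i) = v (Suc i) - v i)"
    fix i assume "i \<le> k"
    then show "f (t i) = v i"
    proof (induction i)
      case 0
      then show ?case using v f(2) t(1) by simp
    next
      case (Suc i)
      then have "i < k" "f (t i) = v i" by auto
      moreover have "f (t (Suc i)) - f (t i) = v (Suc i) - v i" "v i \<le> v (Suc i)"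
        using v \<open>i < k\<close> by blast+
      ultimately show ?case using mono[of i] by linarith
    qed
  qed
qed

lemma poisson_values:
  assumes P: "prob_space P" and X: "poisson_increments P r X"
    and path: "\<And>\<omega>. \<omega> \<in> space P \<Longrightarrow> mono_on {0..} (\<lambda>t. X t \<omega>)" "\<And>\<omega>. \<omega> \<in> space P \<Longrightarrow> X 0 \<omega> = 0"
    and t: "t 0 = 0" "\<forall>i<k. t i \<le> t (Suc i)"
  shows "\<P>(\<omega> in P. \<forall>i\<le>k. X (t i) \<omega> = v i) =
    (if v 0 = 0 \<and> (\<forall>i<k. v i \<le> v (Suc i))
     then \<Prod>i<k. poisson_density (r * (t (Suc i) - t i)) (v (Suc i) - v i) else 0)"
proof -
  have eq: "{\<omega>\<in>space P. \<forall>i\<le>k. X (t i) \<omega> = v i} =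
    (if v 0 = 0 \<and> (\<forall>i<k. v i \<le> v (Suc i))
     then {\<omega>\<in>space P. \<forall>i<k. X (t (Suc i)) \<omega> - X (t i) \<omega> = v (Suc i) - v i} else {})"
    using path_values_iff_increments[OF path t, of _ v] by (auto simp del: all_simps)
  have "\<P>(\<omega> in P. \<forall>i<k. X (t (Suc i)) \<omega> - X (t i) \<omega> = v (Suc i) - v i) =
      (\<Prod>i<k. poisson_density (r * (t (Suc i) - t i)) (v (Suc i) - v i))"
    using X[unfolded poisson_increments_def, rule_format, of t k "\<lambda>i. v (Suc i) - v i"] t by simp
  then show ?thesis
    unfolding eq by (simp only: if_distrib[where f = "measure P"] measure_empty)
qed

text \<open>
  The Markov property of the counting process, read off from the product formula. The time \<open>0\<close> is
  prepended to the grid in order to express values by increments.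
\<close>

lemma poisson_values_step:
  assumes P: "prob_space P" and X: "poisson_increments P r X"
    and path: "\<And>\<omega>. \<omega> \<in> space P \<Longrightarrow> mono_on {0..} (\<lambda>t. X t \<omega>)" "\<And>\<omega>. \<omega> \<in> space P \<Longrightarrow> X 0 \<omega> = 0"
    and t: "0 \<le> t 0" "\<forall>i\<le>k. t i \<le> t (Suc i)"
  shows "\<P>(\<omega> in P. \<forall>i\<le>Suc k. X (t i) \<omega> = v i) =
    (if v k \<le> v (Suc k) then \<P>(\<omega> in P. \<forall>i\<le>k. X (t i) \<omega> = v i) * poisson_density (r * (t (Suc k) - t k)) (v (Suc k) - v k) else 0)"
proof -
  \<comment> \<open>The grid and the values, with time \<open>0\<close> in front.\<close>
  define s where "s i = (case i of 0 \<Rightarrow> 0 | Suc j \<Rightarrow> t j)" for i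
  define w where "w i = (case i of 0 \<Rightarrow> 0 | Suc j \<Rightarrow> v j)" for i
  have s: "s 0 = 0" "\<forall>i<m. s i \<le> s (Suc i)" if "m \<le> Suc (Suc k)" for m
    using t that by (auto simp: s_def split: nat.split)
  have eq: "{\<omega>\<in>space P. \<forall>i\<le>m. X (t i) \<omega> = v i} = {\<omega>\<in>space P. \<forall>i\<le>Suc m. X (s i) \<omega> = w i}" for m
  proof -
    have "(\<forall>i\<le>m. X (t i) \<omega> = v i) \<longleftrightarrow> (\<forall>i\<le>Suc m. X (s i) \<omega> = w i)" if "\<omega> \<in> space P" for \<omega>
    proof -
      have "(\<forall>i\<le>Suc m. X (s i) \<omega> = w i) \<longleftrightarrow> X (s 0) \<omega> = w 0 \<and> (\<forall>i\<le>m. X (s (Suc i)) \<omega> = w (Suc i))"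
        by (metis Suc_le_mono le0 not0_implies_Suc)
      then show ?thesis using path(2)[OF that] by (simp add: s_def w_def)
    qed
    then show ?thesis by blast
  qed
  have all: "(\<forall>i<Suc (Suc k). w i \<le> w (Suc i)) \<longleftrightarrow> (\<forall>i<Suc k. w i \<le> w (Suc i)) \<and> v k \<le> v (Suc k)"
    by (auto simp: less_Suc_eq w_def)
  have w0: "w 0 = 0" and sw: "s (Suc i) = t i" "w (Suc i) = v i" for i by (simp_all add: s_def w_def)
  let ?D = "\<lambda>i. poisson_density (r * (s (Suc i) - s i)) (w (Suc i) - w i)"
  have values1: "\<P>(\<omega> in P. \<forall>i\<le>Suc (Suc k). X (s i) \<omega> = w i) =
      (if (\<forall>i<Suc k. w i \<le> w (Suc i)) \<and> v k \<le> v (Suc k) then (\<Prod>i<Suc k. ?D i) * ?D (Suc k) else 0)"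
    using poisson_values[OF P X path s(1)[of 0] s(2)[of "Suc (Suc k)"], where v = w]
    unfolding all w0 by (simp only: prod.lessThan_Suc simp_thms order_refl le0)
  have values0: "\<P>(\<omega> in P. \<forall>i\<le>Suc k. X (s i) \<omega> = w i) =
      (if \<forall>i<Suc k. w i \<le> w (Suc i) then \<Prod>i<Suc k. ?D i else 0)"
    using poisson_values[OF P X path s(1)[of 0] s(2)[of "Suc k"], where v = w]
    unfolding w0 by (simp only: simp_thms le_SucI order_refl)
  have if_conj: "(if b \<and> c then x * y else 0) = (if c then (if b then x else 0) * y else 0)" for b c and x y :: real
    by simp
  show ?thesis
    unfolding eq values1 values0 sw by (rule if_conj)
qed

section \<open>Coin tosses\<close>

text \<open>
  The model for the marks of the points: \<open>True\<close> says that a point of the superposition belongs to the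
  process to be recovered.
\<close>

definition coin_tosses :: "real \<Rightarrow> (nat \<Rightarrow> bool) measure" where
  "coin_tosses q = PiM UNIV (\<lambda>_. measure_pmf (bernoulli_pmf q))"

definition heads :: "(nat \<Rightarrow> bool) \<Rightarrow> nat \<Rightarrow> nat" where
  "heads b m = card {k. k < m \<and> b k}"

lemma heads_0 [simp]: "heads b 0 = 0"
  by (simp add: heads_def)

lemma heads_Suc: "heads b (Suc m) = heads b m + (if b m then 1 else 0)"
proof -
  have "{k. k < Suc m \<and> b k} = (if b m then insert m {k. k < m \<and> b k} else {k. k < m \<and> b k})"
    by (auto simp: less_Suc_eq)
  then show ?thesis by (simp add: heads_def)
qed

lemma heads_mono: "m \<le> m' \<Longrightarrow> heads b m \<le> heads b m'"
  by (rule lift_Suc_mono_le[of "heads b"]) (auto simp: heads_Suc)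

lemma tails_mono: "m \<le> m' \<Longrightarrow> m - heads b m \<le> m' - heads b m'"
  by (rule lift_Suc_mono_le[of "\<lambda>m. m - heads b m"]) (auto simp: heads_Suc)

lemma heads_le: "heads b m \<le> m"
  by (induction m) (auto simp: heads_Suc)

lemma heads_cong: "(\<And>k. k < m \<Longrightarrow> b k = b' k) \<Longrightarrow> heads b m = heads b' m"
  unfolding heads_def by (rule arg_cong[where f = card]) auto

lemma space_coin_tosses [simp]: "space (coin_tosses q) = UNIV"
  by (simp add: coin_tosses_def space_PiM)

lemma prob_space_coin_tosses: "prob_space (coin_tosses q)"
  unfolding coin_tosses_def by (intro prob_space_PiM measure_pmf.prob_space_axioms)

lemma sets_coin_tosses [measurable_cong]: "sets (coin_tosses q) = sets (PiM UNIV (\<lambda>_. count_space UNIV))"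
  unfolding coin_tosses_def by (intro sets_PiM_cong) auto

lemma cylinder_sets: "{b. \<forall>k<m. b k = e k} \<in> sets (coin_tosses q)"
proof -
  let ?C = "PiM UNIV (\<lambda>_. count_space UNIV) :: (nat \<Rightarrow> bool) measure"
  have "(\<lambda>b. b k) -` {e k} \<inter> space ?C \<in> sets ?C" for k
    by (rule measurable_sets[OF measurable_component_singleton]) simp_all
  then have "{b \<in> space ?C. \<forall>k\<in>{..<m}. b k = e k} \<in> sets ?C"
    by (intro sets.sets_Collect_finite_All) (simp_all add: vimage_def Int_def conj_commute)
  then show ?thesis by (simp add: sets_coin_tosses space_PiM Ball_def)
qed

lemma measure_cylinder:
  "measure (coin_tosses q) {b. \<forall>k<m. b k = e k} = (\<Prod>k<m. pmf (bernoulli_pmf q) (e k))"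
proof -
  interpret product_prob_space "\<lambda>_::nat. measure_pmf (bernoulli_pmf q)" UNIV
    by unfold_locales
  have "measure (PiM UNIV (\<lambda>_. measure_pmf (bernoulli_pmf q)))
      (prod_emb UNIV (\<lambda>_. measure_pmf (bernoulli_pmf q)) {..<m} (PiE {..<m} (\<lambda>k. {e k}))) =
      (\<Prod>k<m. measure (measure_pmf (bernoulli_pmf q)) {e k})"
    by (rule measure_PiM_emb) auto
  moreover have "prod_emb UNIV (\<lambda>_. measure_pmf (bernoulli_pmf q)) {..<m} (PiE {..<m} (\<lambda>k. {e k})) = {b. \<forall>k<m. b k = e k}"
    by (rule set_eqI) (simp add: prod_emb_def PiE_iff Ball_def)
  ultimately show ?thesis by (simp only: coin_tosses_def measure_pmf_single)
qed

text \<open>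
  An event decided by the first \<open>m\<close> tosses is a finite union of cylinders of length \<open>m\<close>, and fixing the
  next toss multiplies the probability of each cylinder by the same factor.
\<close>

lemma prefix_event:
  assumes "\<And>b b'. (\<And>k. k < m \<Longrightarrow> b k = b' k) \<Longrightarrow> \<phi> b = \<phi> b'"
  shows "{b. \<phi> b} \<in> sets (coin_tosses q)" (is ?thesis1)
    and "measure (coin_tosses q) {b. \<phi> b \<and> b m = v} = measure (coin_tosses q) {b. \<phi> b} * pmf (bernoulli_pmf q) v" (is ?thesis2)
proof -
  interpret prob_space "coin_tosses q" by (rule prob_space_coin_tosses)
  define I where "I = {e\<in>PiE {..<m} (\<lambda>_. UNIV :: bool set). \<phi> e}"
  have fin: "finite I"
    unfolding I_def by (rule finite_subset[OF _ finite_PiE[of "{..<m}" "\<lambda>_. UNIV :: bool set"]]) auto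
  have prefix: "restrict b {..<m} \<in> I \<longleftrightarrow> \<phi> b" for b
    unfolding I_def using assms[of "restrict b {..<m}" b] by simp
  have separate: "\<exists>k<m. e k \<noteq> e' k" if "e \<in> I" "e' \<in> I" "e \<noteq> e'" for e e'
    using that PiE_ext[of e "{..<m}" "\<lambda>_. UNIV" e'] unfolding I_def by auto
  have restrict_eq: "restrict b {..<m} = e" if "e \<in> I" "\<forall>k<m. b k = e k" for b e
    by (rule PiE_ext[of _ "{..<m}" "\<lambda>_. UNIV"]) (use that in \<open>auto simp: I_def\<close>)
  have eq: "{b. \<phi> b} = (\<Union>e\<in>I. {b. \<forall>k<m. b k = e k})"
  proof (intro equalityI subsetI)
    fix b assume "b \<in> {b. \<phi> b}"
    then show "b \<in> (\<Union>e\<in>I. {b. \<forall>k<m. b k = e k})" using prefix[of b] by (intro UN_I[of "restrict b {..<m}"]) auto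
  next
    fix b assume "b \<in> (\<Union>e\<in>I. {b. \<forall>k<m. b k = e k})"
    then obtain e where "e \<in> I" "\<forall>k<m. b k = e k" by blast
    with restrict_eq[OF this] prefix[of b] show "b \<in> {b. \<phi> b}" by simp
  qed
  have eq2: "{b. \<phi> b \<and> b m = v} = (\<Union>e\<in>I. {b. \<forall>k<Suc m. b k = (e(m := v)) k})"
  proof -
    have upd: "(\<forall>k<Suc m. b k = (e(m := v)) k) \<longleftrightarrow> (\<forall>k<m. b k = e k) \<and> b m = v" for b e
      by (auto simp: less_Suc_eq)
    have \<phi>_iff: "\<phi> b \<longleftrightarrow> (\<exists>e\<in>I. \<forall>k<m. b k = e k)" for b
      using eq by (simp add: set_eq_iff)
    show ?thesis
      unfolding upd \<phi>_iff by blast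
  qed
  show ?thesis1 unfolding eq using fin cylinder_sets by (intro sets.finite_UN) auto
  have "prob {b. \<phi> b} = (\<Sum>e\<in>I. prob {b. \<forall>k<m. b k = e k})"
    unfolding eq
  proof (rule finite_measure_finite_Union[OF fin])
    show "disjoint_family_on (\<lambda>e. {b. \<forall>k<m. b k = e k}) I"
      unfolding disjoint_family_on_def
    proof (intro ballI impI)
      fix e e' assume "e \<in> I" "e' \<in> I" "e \<noteq> e'"
      from separate[OF this] show "{b. \<forall>k<m. b k = e k} \<inter> {b. \<forall>k<m. b k = e' k} = {}" by auto
    qed
  qed (intro image_subsetI cylinder_sets)
  moreover have "prob {b. \<phi> b \<and> b m = v} = (\<Sum>e\<in>I. prob {b. \<forall>k<Suc m. b k = (e(m := v)) k})"
    unfolding eq2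
  proof (rule finite_measure_finite_Union[OF fin])
    show "disjoint_family_on (\<lambda>e. {b. \<forall>k<Suc m. b k = (e(m := v)) k}) I"
      unfolding disjoint_family_on_def
    proof (intro ballI impI)
      fix e e' assume "e \<in> I" "e' \<in> I" "e \<noteq> e'"
      from separate[OF this] obtain k where k: "k < m" "e k \<noteq> e' k" by blast
      have False if "\<forall>k<Suc m. b k = (e(m := v)) k" "\<forall>k<Suc m. b k = (e'(m := v)) k" for b
        using that[rule_format, of k] k by simp
      then show "{b. \<forall>k<Suc m. b k = (e(m := v)) k} \<inter> {b. \<forall>k<Suc m. b k = (e'(m := v)) k} = {}" by blast
    qed
  qed (intro image_subsetI cylinder_sets)
  ultimately show ?thesis2
    by (simp only: measure_cylinder sum_distrib_right) simp
qed

text \<open>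
  Induction on the length of the block by Pascal's rule: the last toss of the block is independent of
  what came before.
\<close>

lemma prefix_block:
  assumes \<phi>: "\<And>b b'. (\<And>k. k < m \<Longrightarrow> b k = b' k) \<Longrightarrow> \<phi> b = \<phi> b'" and q: "0 \<le> q" "q \<le> 1"
  shows "measure (coin_tosses q) {b. \<phi> b \<and> heads b (m + d) = heads b m + c} =
    measure (coin_tosses q) {b. \<phi> b} * (real (d choose c) * q ^ c * (1 - q) ^ (d - c))"
proof (induction d arbitrary: c)
  case 0
  have "{b. \<phi> b \<and> heads b (m + 0) = heads b m + c} = (if c = 0 then {b. \<phi> b} else {})" by auto
  then show ?case by simp
next
  case (Suc d)
  interpret prob_space "coin_tosses q" by (rule prob_space_coin_tosses)
  have dep: "(\<phi> b \<and> heads b (m + d) = heads b m + c) = (\<phi> b' \<and> heads b' (m + d) = heads b' m + c)"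
    if "\<And>k. k < m + d \<Longrightarrow> b k = b' k" for b b' c
  proof -
    have "\<phi> b = \<phi> b'" by (rule \<phi>) (rule that, simp)
    moreover have "heads b (m + d) = heads b' (m + d)" by (rule heads_cong) (rule that)
    moreover have "heads b m = heads b' m" by (rule heads_cong) (rule that, simp)
    ultimately show ?thesis by simp
  qed
  let ?T = "\<lambda>c v. {b. (\<phi> b \<and> heads b (m + d) = heads b m + c) \<and> b (m + d) = v}"
  have T: "prob (?T c v) = prob {b. \<phi> b} * (real (d choose c) * q ^ c * (1 - q) ^ (d - c)) * pmf (bernoulli_pmf q) v" for c v
    using prefix_event(2)[where m = "m + d" and v = v and q = q and \<phi> = "\<lambda>b. \<phi> b \<and> heads b (m + d) = heads b m + c", OF dep]
    unfolding Suc.IH .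
  have T_ev: "?T c v \<in> events" for c v
  proof (rule prefix_event(1)[where m = "Suc (m + d)"])
    fix b b' :: "nat \<Rightarrow> bool" assume a: "\<And>k. k < Suc (m + d) \<Longrightarrow> b k = b' k"
    have "(\<phi> b \<and> heads b (m + d) = heads b m + c) = (\<phi> b' \<and> heads b' (m + d) = heads b' m + c)"
      by (rule dep) (rule a, simp)
    then show "((\<phi> b \<and> heads b (m + d) = heads b m + c) \<and> b (m + d) = v) = ((\<phi> b' \<and> heads b' (m + d) = heads b' m + c) \<and> b' (m + d) = v)"
      using a[of "m + d"] by simp
  qed
  show ?case
  proof (cases c)
    case 0
    have "{b. \<phi> b \<and> heads b (m + Suc d) = heads b m + c} = ?T 0 False"
    proof -
      have "heads b m \<le> heads b (m + d)" for b by (rule heads_mono) simp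
      then have "Suc (heads b (m + d)) \<noteq> heads b m" for b by (metis Suc_n_not_le_n)
      then show ?thesis using 0 by (auto simp: heads_Suc)
    qed
    then have "prob {b. \<phi> b \<and> heads b (m + Suc d) = heads b m + c} = prob (?T 0 False)" by (simp only:)
    also have "\<dots> = prob {b. \<phi> b} * (real (Suc d choose c) * q ^ c * (1 - q) ^ (Suc d - c))"
      unfolding T using q 0 by simp
    finally show ?thesis .
  next
    case (Suc c')
    have "{b. \<phi> b \<and> heads b (m + Suc d) = heads b m + c} = ?T c False \<union> ?T c' True"
      using Suc by (auto simp: heads_Suc)
    then have "prob {b. \<phi> b \<and> heads b (m + Suc d) = heads b m + c} = prob (?T c False \<union> ?T c' True)" by (simp only:)
    also have "\<dots> = prob (?T c False) + prob (?T c' True)"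
      by (rule finite_measure_Union[OF T_ev T_ev]) auto
    also have "\<dots> = prob {b. \<phi> b} * (real (Suc d choose c) * q ^ c * (1 - q) ^ (Suc d - c))"
    proof (cases "c \<le> d")
      case True
      then obtain e where d: "d = c + e" using le_Suc_ex by blast
      have e: "d - c = e" "d - c' = Suc e" "Suc d - c = Suc e" using d Suc by simp_all
      have choose: "real (Suc d choose c) = real (d choose c) + real (d choose c')" using Suc by simp
      have power: "q ^ c = q * q ^ c'" using Suc by simp
      show ?thesis
        unfolding T e choose power using q by (simp add: algebra_simps)
    next
      case False
      then show ?thesis unfolding T using q Suc by (simp add: binomial_eq_0)
    qed
    finally show ?thesis .
  qed
qed

text \<open>
  Consecutive blocks of tosses are independent and the number of heads in each is binomial.
\<close>

lemma heads_law:
  fixes z x :: "nat \<Rightarrow> nat"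
  assumes q: "0 \<le> q" "q \<le> 1" and z: "z 0 = 0" "\<forall>i<k. z i \<le> z (Suc i)"
  shows "measure (coin_tosses q) {b. \<forall>i\<le>k. heads b (z i) = x i} =
    (if x 0 = 0 \<and> (\<forall>i<k. x i \<le> x (Suc i))
     then \<Prod>i<k. real ((z (Suc i) - z i) choose (x (Suc i) - x i)) * q ^ (x (Suc i) - x i) * (1 - q) ^ (z (Suc i) - z i - (x (Suc i) - x i))
     else 0)"
  using z(2)
proof (induction k)
  case 0
  interpret prob_space "coin_tosses q" by (rule prob_space_coin_tosses)
  have "{b. \<forall>i\<le>0. heads b (z i) = x i} = (if x 0 = 0 then space (coin_tosses q) else {})"
    using z(1) by auto
  then show ?case using prob_space by (simp del: space_coin_tosses)
next
  case (Suc k)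
  have zk: "z i \<le> z k" if "i \<le> k" for i
    using that
  proof (induction rule: inc_induct)
    case (step i)
    then have "z i \<le> z (Suc i)" using Suc.prems by simp
    with step.IH show ?case by simp
  qed simp
  have zS: "z k \<le> z (Suc k)" using Suc.prems by simp
  show ?case
  proof (cases "x k \<le> x (Suc k)")
    case False
    have "{b. \<forall>i\<le>Suc k. heads b (z i) = x i} = {}"
    proof (rule equals0I)
      fix b assume b: "b \<in> {b. \<forall>i\<le>Suc k. heads b (z i) = x i}"
      then have "heads b (z k) = x k" "heads b (z (Suc k)) = x (Suc k)" by simp_all
      then show False using heads_mono[OF zS, of b] False by simp
    qed
    moreover have "\<not> (\<forall>i<Suc k. x i \<le> x (Suc i))" using False by blast
    ultimately show ?thesis by (simp only: measure_empty) simp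
  next
    case True
    have all: "(\<forall>i<Suc k. x i \<le> x (Suc i)) \<longleftrightarrow> (\<forall>i<k. x i \<le> x (Suc i))"
      using True by (auto simp: less_Suc_eq)
    have e: "{b. \<forall>i\<le>Suc k. heads b (z i) = x i} =
      {b. (\<forall>i\<le>k. heads b (z i) = x i) \<and> heads b (z k + (z (Suc k) - z k)) = heads b (z k) + (x (Suc k) - x k)}"
      using True zS by (auto simp: le_Suc_eq)
    have dep: "(\<forall>i\<le>k. heads b (z i) = x i) = (\<forall>i\<le>k. heads b' (z i) = x i)"
      if "\<And>j. j < z k \<Longrightarrow> b j = b' j" for b b'
    proof -
      have "heads b (z i) = heads b' (z i)" if "i \<le> k" for i
        by (rule heads_cong) (use \<open>\<And>j. j < z k \<Longrightarrow> b j = b' j\<close> zk[OF that] in auto)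
      then show ?thesis by simp
    qed
    have IH: "measure (coin_tosses q) {b. \<forall>i\<le>k. heads b (z i) = x i} =
      (if x 0 = 0 \<and> (\<forall>i<k. x i \<le> x (Suc i))
       then \<Prod>i<k. real ((z (Suc i) - z i) choose (x (Suc i) - x i)) * q ^ (x (Suc i) - x i) * (1 - q) ^ (z (Suc i) - z i - (x (Suc i) - x i))
       else 0)"
      by (rule Suc.IH) (use Suc.prems in simp)
    have if_mult: "(if b then u else 0) * v = (if b then u * v else 0)" for b and u v :: real by simp
    have block: "measure (coin_tosses q)
        {b. (\<forall>i\<le>k. heads b (z i) = x i) \<and> heads b (z k + (z (Suc k) - z k)) = heads b (z k) + (x (Suc k) - x k)} =
      measure (coin_tosses q) {b. \<forall>i\<le>k. heads b (z i) = x i} *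
        (real ((z (Suc k) - z k) choose (x (Suc k) - x k)) * q ^ (x (Suc k) - x k) * (1 - q) ^ (z (Suc k) - z k - (x (Suc k) - x k)))"
      by (rule prefix_block[OF dep q])
    show ?thesis
      unfolding e block IH all prod.lessThan_Suc by (rule if_mult)
  qed
qed

section \<open>Finite-dimensional distributions\<close>

text \<open>
  A generator of the product \<open>\<sigma>\<close>-algebra involves finitely many times only. Sorted and with \<open>0\<close> added they
  form a grid, and as the values range over a countable type it suffices to compare the probabilities of
  single lists of values.
\<close>

lemma process_law_eqI:
  fixes X :: "real \<Rightarrow> 'a \<Rightarrow> 'c::countable" and Y :: "real \<Rightarrow> 'b \<Rightarrow> 'c"
  assumes P: "prob_space P" and Q: "prob_space Q"
    and X: "\<And>t. 0 \<le> t \<Longrightarrow> X t \<in> P \<rightarrow>\<^sub>M count_space UNIV"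
    and Y: "\<And>t. 0 \<le> t \<Longrightarrow> Y t \<in> Q \<rightarrow>\<^sub>M count_space UNIV"
    and eq: "\<And>k (t :: nat \<Rightarrow> real) v. t 0 = 0 \<Longrightarrow> \<forall>i<k. t i \<le> t (Suc i) \<Longrightarrow>
      \<P>(\<omega> in P. \<forall>i\<le>k. X (t i) \<omega> = v i) = \<P>(\<omega> in Q. \<forall>i\<le>k. Y (t i) \<omega> = v i)"
  shows "distr P (PiM {0..} (\<lambda>_. count_space UNIV)) (\<lambda>\<omega>. \<lambda>t\<in>{0..}. X t \<omega>) =
    distr Q (PiM {0..} (\<lambda>_. count_space UNIV)) (\<lambda>\<omega>. \<lambda>t\<in>{0..}. Y t \<omega>)"
    (is "distr P ?S ?X = distr Q ?S ?Y")
proof (rule measure_eqI_PiM_infinite[where I = "{0..}" and M = "\<lambda>_. count_space UNIV"])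
  interpret P: prob_space P by fact
  interpret Q: prob_space Q by fact
  have mX: "?X \<in> P \<rightarrow>\<^sub>M ?S" using X by (intro measurable_restrict) simp
  have mY: "?Y \<in> Q \<rightarrow>\<^sub>M ?S" using Y by (intro measurable_restrict) simp
  show "finite_measure (distr P ?S ?X)"
    using P.prob_space_distr[OF mX] by (simp add: prob_space_def)
  fix J :: "real set" and A :: "real \<Rightarrow> 'c set"
  assume J: "finite J" "J \<subseteq> {0..}"
  \<comment> \<open>The grid through the times of the generator.\<close>
  define ts where "ts = sorted_list_of_set (insert 0 J)"
  have ts_set: "set ts = insert 0 J" and ts_sorted: "sorted ts"
    using J unfolding ts_def by (simp_all del: sorted_list_of_set_insert_remove)
  have ts_nonneg: "0 \<le> s" if "s \<in> set ts" for s using that J ts_set by auto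
  have ts0: "ts \<noteq> []" using ts_set by auto
  have "ts ! 0 = 0"
  proof (rule antisym)
    obtain i where "i < length ts" "ts ! i = 0" using ts_set by (metis in_set_conv_nth insertI1)
    then show "ts ! 0 \<le> 0" using sorted_nth_mono[OF ts_sorted, of 0 i] by simp
    show "0 \<le> ts ! 0" using ts0 by (intro ts_nonneg) simp
  qed
  define k where "k = length ts - 1"
  have len: "length ts = Suc k" using ts0 by (simp add: k_def)
  have mapX: "(\<lambda>\<omega>. map (\<lambda>s. X s \<omega>) ss) \<in> P \<rightarrow>\<^sub>M count_space UNIV" if "set ss \<subseteq> {0..}" for ss
    using that
  proof (induction ss)
    case (Cons s ss)
    then have "X s \<in> P \<rightarrow>\<^sub>M count_space UNIV" "(\<lambda>\<omega>. map (\<lambda>s. X s \<omega>) ss) \<in> P \<rightarrow>\<^sub>M count_space UNIV"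
      using X by auto
    then show ?case
      using measurable_compose_countable[where f = "\<lambda>x \<omega>. x # map (\<lambda>s. X s \<omega>) ss" and g = "X s"]
      by (auto intro: measurable_compose)
  qed simp
  have mapY: "(\<lambda>\<omega>. map (\<lambda>s. Y s \<omega>) ss) \<in> Q \<rightarrow>\<^sub>M count_space UNIV" if "set ss \<subseteq> {0..}" for ss
    using that
  proof (induction ss)
    case (Cons s ss)
    then have "Y s \<in> Q \<rightarrow>\<^sub>M count_space UNIV" "(\<lambda>\<omega>. map (\<lambda>s. Y s \<omega>) ss) \<in> Q \<rightarrow>\<^sub>M count_space UNIV"
      using Y by auto
    then show ?case
      using measurable_compose_countable[where f = "\<lambda>x \<omega>. x # map (\<lambda>s. Y s \<omega>) ss" and g = "Y s"]
      by (auto intro: measurable_compose)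
  qed simp
  have ts_sub: "set ts \<subseteq> {0..}" using ts_nonneg by auto
  note mapX = mapX[OF ts_sub] and mapY = mapY[OF ts_sub]
  have "distr P (count_space UNIV) (\<lambda>\<omega>. map (\<lambda>s. X s \<omega>) ts) = distr Q (count_space UNIV) (\<lambda>\<omega>. map (\<lambda>s. Y s \<omega>) ts)"
  proof (rule measure_eqI_countable[where A = UNIV])
    fix vs :: "'c list"
    have vX: "(\<lambda>\<omega>. map (\<lambda>s. X s \<omega>) ts) -` {vs} \<inter> space P =
        (if length vs = Suc k then {\<omega>\<in>space P. \<forall>i\<le>k. X (ts ! i) \<omega> = vs ! i} else {})"
      using len by (auto simp: list_eq_iff_nth_eq less_Suc_eq_le)
    have vY: "(\<lambda>\<omega>. map (\<lambda>s. Y s \<omega>) ts) -` {vs} \<inter> space Q =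
        (if length vs = Suc k then {\<omega>\<in>space Q. \<forall>i\<le>k. Y (ts ! i) \<omega> = vs ! i} else {})"
      using len by (auto simp: list_eq_iff_nth_eq less_Suc_eq_le)
    have "\<forall>i<k. ts ! i \<le> ts ! Suc i"
      using sorted_nth_mono[OF ts_sorted] len by simp
    from eq[where t = "\<lambda>i. ts ! i", OF \<open>ts ! 0 = 0\<close> this]
    show "emeasure (distr P (count_space UNIV) (\<lambda>\<omega>. map (\<lambda>s. X s \<omega>) ts)) {vs} =
       emeasure (distr Q (count_space UNIV) (\<lambda>\<omega>. map (\<lambda>s. Y s \<omega>) ts)) {vs}"
      by (simp add: emeasure_distr[OF mapX] emeasure_distr[OF mapY] vX vY P.emeasure_eq_measure Q.emeasure_eq_measure)
  qed auto
  define B where "B = {vs :: 'c list. \<forall>i\<le>k. ts ! i \<in> J \<longrightarrow> vs ! i \<in> A (ts ! i)}"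
  have emb: "\<omega> \<in> prod_emb {0..} (\<lambda>_. count_space UNIV) J (Pi\<^sub>E J A) \<longleftrightarrow> (\<forall>s\<in>J. \<omega> s \<in> A s)"
    if "\<omega> \<in> extensional {0..}" for \<omega> :: "real \<Rightarrow> 'c"
    using J that by (auto simp: prod_emb_def PiE_iff)
  have index: "(\<forall>s\<in>J. f s \<in> A s) \<longleftrightarrow> map f ts \<in> B" for f :: "real \<Rightarrow> 'c"
  proof
    assume "\<forall>s\<in>J. f s \<in> A s"
    then show "map f ts \<in> B" using len by (auto simp: B_def)
  next
    assume b: "map f ts \<in> B"
    show "\<forall>s\<in>J. f s \<in> A s"
    proof
      fix s assume s: "s \<in> J"
      then obtain i where "i < length ts" "ts ! i = s" using ts_set by (metis in_set_conv_nth insertCI)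
      then show "f s \<in> A s" using b s len by (auto simp: B_def less_Suc_eq_le)
    qed
  qed
  let ?Z = "prod_emb {0..} (\<lambda>_. count_space UNIV) J (Pi\<^sub>E J A)"
  have Z: "?Z \<in> sets ?S" using J by (intro sets_PiM_I) auto
  have "?X -` ?Z \<inter> space P = (\<lambda>\<omega>. map (\<lambda>s. X s \<omega>) ts) -` B \<inter> space P"
  proof -
    have "?X \<omega> \<in> ?Z \<longleftrightarrow> map (\<lambda>s. X s \<omega>) ts \<in> B" for \<omega>
      using J(2) unfolding emb[OF restrict_extensional] index[symmetric] by (auto simp: subset_iff)
    then show ?thesis by auto
  qed
  moreover have "?Y -` ?Z \<inter> space Q = (\<lambda>\<omega>. map (\<lambda>s. Y s \<omega>) ts) -` B \<inter> space Q"
  proof -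
    have "?Y \<omega> \<in> ?Z \<longleftrightarrow> map (\<lambda>s. Y s \<omega>) ts \<in> B" for \<omega>
      using J(2) unfolding emb[OF restrict_extensional] index[symmetric] by (auto simp: subset_iff)
    then show ?thesis by auto
  qed
  ultimately show "emeasure (distr P ?S ?X) ?Z = emeasure (distr Q ?S ?Y) ?Z"
    using \<open>distr P (count_space UNIV) (\<lambda>\<omega>. map (\<lambda>s. X s \<omega>) ts) = _\<close>[THEN arg_cong, of "\<lambda>M. emeasure M B"]
    by (simp add: emeasure_distr[OF mX Z] emeasure_distr[OF mY Z] emeasure_distr[OF mapX] emeasure_distr[OF mapY])
qed simp_all

section \<open>Simple points\<close>

lemma poisson_increments_single:
  assumes "poisson_increments P r X" "0 \<le> s" "s \<le> t"
  shows "\<P>(\<omega> in P. X t \<omega> - X s \<omega> = a) = poisson_density (r * (t - s)) a"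
  using assms(1)[unfolded poisson_increments_def, rule_format, of "\<lambda>i. if i = 0 then s else t" 1 "\<lambda>_. a"] assms(2,3)
  by simp

text \<open>
  Two points in a short interval are unlikely; this follows from \<open>1 - x \<le> exp (- x)\<close>.
\<close>

lemma poisson_density_tail: "0 \<le> x \<Longrightarrow> 1 - poisson_density x 0 - poisson_density x 1 \<le> x\<^sup>2"
proof -
  assume x: "0 \<le> x"
  have "(1 - x) * (1 + x) \<le> exp (- x) * (1 + x)"
    using exp_ge_add_one_self[of "- x"] x by (intro mult_right_mono) auto
  then show ?thesis by (simp add: poisson_density_def power2_eq_square algebra_simps)
qed

lemma poisson_density_vanishes:
  assumes "0 < r"
  shows "(\<lambda>K. poisson_density (r * real K) i) \<longlonglongrightarrow> 0"
proof -
  have "filterlim (\<lambda>K. r * real K) at_top sequentially"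
    using assms by real_asymp
  from filterlim_compose[OF tendsto_power_div_exp_0[of i] this]
  have "(\<lambda>K. (r * real K) ^ i / exp (r * real K) / fact i) \<longlonglongrightarrow> 0 / fact i"
    by (intro tendsto_divide) auto
  then show ?thesis by (simp add: poisson_density_def exp_minus field_simps)
qed

text \<open>
  In one statement: almost surely there are infinitely many points and no two of them coincide. Suppose
  that the level \<open>l\<close> is missed. Then either the path has not passed \<open>l\<close> by time \<open>K\<close>, or some cell of any
  given grid on \<open>[0, K]\<close> contains two points. With cells of length \<open>1 / K\<^sup>2\<close> there are \<open>K\<^sup>3\<close> cells, each with
  probability at most \<open>(r / K\<^sup>2)\<^sup>2\<close>, so the second possibility has probability at most \<open>r\<^sup>2 / K\<close>. Both bounds
  vanish as \<open>K\<close> grows.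
  
  Asking for rational times makes the event measurable.
\<close>

lemma AE_levels_visited:
  fixes Z :: "real \<Rightarrow> 'w \<Rightarrow> nat"
  assumes P: "prob_space P" and Z: "poisson_increments P r Z" and r: "0 < r"
    and mono: "\<And>\<omega>. \<omega> \<in> space P \<Longrightarrow> mono_on {0..} (\<lambda>t. Z t \<omega>)"
    and start: "\<And>\<omega>. \<omega> \<in> space P \<Longrightarrow> Z 0 \<omega> = 0"
    and meas: "\<And>t. 0 \<le> t \<Longrightarrow> Z t \<in> P \<rightarrow>\<^sub>M count_space UNIV"
  shows "AE \<omega> in P. \<forall>l. \<exists>t\<in>\<rat> \<inter> {0..}. Z t \<omega> = l"
proof (subst AE_all_countable, rule allI)
  interpret prob_space P by fact
  fix l
  have ev: "{\<omega>\<in>space P. R (Z t \<omega>)} \<in> events" if "0 \<le> t" for t R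
    using measurable_sets[OF meas[OF that], of "Collect R"] by (simp add: vimage_def Int_def conj_commute)
  have ev_inc: "{\<omega>\<in>space P. R (Z t \<omega> - Z s \<omega>)} \<in> events" if "0 \<le> t" "0 \<le> s" for t s R
  proof -
    have "(\<lambda>\<omega>. Z t \<omega> - Z s \<omega>) \<in> P \<rightarrow>\<^sub>M count_space UNIV"
      using meas[OF that(1)] meas[OF that(2)] by measurable
    from measurable_sets[OF this, of "Collect R"] show ?thesis by (simp add: vimage_def Int_def conj_commute)
  qed
  define Bad where "Bad = {\<omega>\<in>space P. \<forall>t\<in>\<rat> \<inter> {0..}. Z t \<omega> \<noteq> l}"
  have Bad: "Bad \<in> events"
    unfolding Bad_def
  proof (rule sets.sets_Collect_countable_All')
    show "{\<omega>\<in>space P. Z t \<omega> \<noteq> l} \<in> events" if "t \<in> \<rat> \<inter> {0..}" for t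
      by (rule ev) (use that in simp)
    show "countable (\<rat> \<inter> {0..} :: real set)" by (rule countable_subset[OF Int_lower1 countable_rat])
  qed
  define bound where "bound K = (\<Sum>i\<le>l. poisson_density (r * real K) i) + r\<^sup>2 / real K" for K
  have "prob Bad \<le> bound K" if K: "0 < K" for K :: nat
  proof -
    \<comment> \<open>A grid of mesh \<open>1 / K\<^sup>2\<close>; its \<open>K\<^sup>3\<close> cells cover \<open>[0, K]\<close>.\<close>
    define s where "s j = real j / (real K)\<^sup>2" for j :: nat
    have s: "0 \<le> s j" "s j \<in> \<rat>" "s j \<le> s (Suc j)" "s (Suc j) - s j = 1 / (real K)\<^sup>2" for j
      by (auto simp: s_def divide_right_mono diff_divide_distrib[symmetric])
    have s_end: "s (K ^ 3) = real K" using K by (simp add: s_def power2_eq_square power3_eq_cube)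
    define E where "E = {\<omega>\<in>space P. Z (real K) \<omega> \<le> l}"
    define D where "D j = {\<omega>\<in>space P. 2 \<le> Z (s (Suc j)) \<omega> - Z (s j) \<omega>}" for j
    have E_ev: "E \<in> events" unfolding E_def by (rule ev) simp
    have D_ev: "D j \<in> events" for j unfolding D_def by (rule ev_inc) (use s in auto)
    have "Bad \<subseteq> E \<union> (\<Union>j<K ^ 3. D j)"
    proof
      fix \<omega> assume w: "\<omega> \<in> Bad"
      then have wP: "\<omega> \<in> space P" and avoid: "\<And>t. t \<in> \<rat> \<Longrightarrow> 0 \<le> t \<Longrightarrow> Z t \<omega> \<noteq> l" by (auto simp: Bad_def)
      show "\<omega> \<in> E \<union> (\<Union>j<K ^ 3. D j)"
      proof (cases "Z (real K) \<omega> \<le> l")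
        case True
        then show ?thesis using wP by (simp add: E_def)
      next
        case False
        \<comment> \<open>The first grid point above the level: one cell earlier the path was strictly below it.\<close>
        define j where "j = (LEAST j. l < Z (s j) \<omega>)"
        have ex: "l < Z (s (K ^ 3)) \<omega>" using False s_end by simp
        have j: "l < Z (s j) \<omega>" unfolding j_def by (rule LeastI[where P = "\<lambda>j. l < Z (s j) \<omega>", OF ex])
        have j_le: "j \<le> K ^ 3" unfolding j_def by (rule Least_le[where P = "\<lambda>j. l < Z (s j) \<omega>", OF ex])
        have "j \<noteq> 0" using j start[OF wP] by (auto simp: s_def intro: ccontr)
        then obtain i where i: "j = Suc i" using not0_implies_Suc by blast
        have "\<not> l < Z (s i) \<omega>" unfolding i using not_less_Least[of i "\<lambda>j. l < Z (s j) \<omega>"] i j_def by simp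
        moreover have "Z (s i) \<omega> \<noteq> l" using avoid s by blast
        ultimately have "\<omega> \<in> D i" using j wP by (simp add: D_def i)
        then show ?thesis using j_le i by auto
      qed
    qed
    then have "prob Bad \<le> prob (E \<union> (\<Union>j<K ^ 3. D j))"
      using E_ev D_ev by (intro finite_measure_mono) auto
    also have "\<dots> \<le> prob E + prob (\<Union>j<K ^ 3. D j)"
      using E_ev D_ev by (intro measure_Un_le sets.finite_UN) auto
    also have "prob (\<Union>j<K ^ 3. D j) \<le> (\<Sum>j<K ^ 3. prob (D j))"
      using D_ev by (intro measure_UNION_le) auto
    also have "\<dots> \<le> (\<Sum>j<K ^ 3. (r / (real K)\<^sup>2)\<^sup>2)"
    proof (rule sum_mono)
      fix j
      let ?I = "\<lambda>a. {\<omega>\<in>space P. Z (s (Suc j)) \<omega> - Z (s j) \<omega> = a}"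
      have I_ev: "?I a \<in> events" for a by (rule ev_inc) (use s in auto)
      have I: "prob (?I a) = poisson_density (r / (real K)\<^sup>2) a" for a
        using poisson_increments_single[OF Z s(1) s(3), of j a] by (simp add: s(4))
      have "D j = space P - (?I 0 \<union> ?I 1)" unfolding D_def by auto
      then have "prob (D j) = 1 - prob (?I 0 \<union> ?I 1)"
        using I_ev by (simp only:) (rule prob_compl, blast)
      also have "prob (?I 0 \<union> ?I 1) = prob (?I 0) + prob (?I 1)"
        by (rule finite_measure_Union[OF I_ev I_ev]) auto
      finally have "prob (D j) = 1 - poisson_density (r / (real K)\<^sup>2) 0 - poisson_density (r / (real K)\<^sup>2) 1"
        unfolding I by simp
      also have "\<dots> \<le> (r / (real K)\<^sup>2)\<^sup>2" using r by (intro poisson_density_tail) simp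
      finally show "prob (D j) \<le> (r / (real K)\<^sup>2)\<^sup>2" .
    qed
    also have "\<dots> = r\<^sup>2 / real K"
      using K by (simp add: power_divide power2_eq_square power3_eq_cube)
    also have "prob E = (\<Sum>i\<le>l. prob {\<omega>\<in>space P. Z (real K) \<omega> - Z 0 \<omega> = i})"
    proof -
      have "E = (\<Union>i\<in>{..l}. {\<omega>\<in>space P. Z (real K) \<omega> - Z 0 \<omega> = i})"
        using start by (auto simp: E_def)
      then have "prob E = prob (\<Union>i\<in>{..l}. {\<omega>\<in>space P. Z (real K) \<omega> - Z 0 \<omega> = i})" by (simp only:)
      also have "\<dots> = (\<Sum>i\<le>l. prob {\<omega>\<in>space P. Z (real K) \<omega> - Z 0 \<omega> = i})"
      proof (rule finite_measure_finite_Union)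
        show "(\<lambda>i. {\<omega>\<in>space P. Z (real K) \<omega> - Z 0 \<omega> = i}) ` {..l} \<subseteq> events"
          by (intro image_subsetI ev_inc) simp_all
      qed (auto simp: disjoint_family_on_def)
      finally show ?thesis .
    qed
    also have "\<dots> = (\<Sum>i\<le>l. poisson_density (r * real K) i)"
      using poisson_increments_single[OF Z, of 0 "real K"] by simp
    finally show ?thesis unfolding bound_def by simp
  qed
  moreover have "bound \<longlonglongrightarrow> (\<Sum>i\<le>l. 0) + 0"
    unfolding bound_def
    by (intro tendsto_add tendsto_sum poisson_density_vanishes[OF r]) real_asymp
  ultimately have "prob Bad \<le> 0"
    by (intro LIMSEQ_le_const[of bound]) (auto intro!: exI[of _ 1])
  then have "prob Bad = 0" using measure_nonneg[of P Bad] by linarith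
  then have "Bad \<in> null_sets P" using Bad by (auto simp: emeasure_eq_measure)
  then show "AE \<omega> in P. \<exists>t\<in>\<rat> \<inter> {0..}. Z t \<omega> = l"
    by (rule AE_I') (auto simp: Bad_def)
qed

section \<open>Thinning\<close>

text \<open>
  If \<open>X\<close> counts marked and \<open>Y\<close> unmarked points and no two points coincide, this is the number of marked
  points among the first \<open>l\<close> points. It only looks at rational times, so that it is a measurable function of the pair of paths even
  though the product \<open>\<sigma>\<close>-algebra knows nothing about regularity of paths.
\<close>

definition marked_count :: "(real \<Rightarrow> 'w \<Rightarrow> nat) \<Rightarrow> (real \<Rightarrow> 'w \<Rightarrow> nat) \<Rightarrow> nat \<Rightarrow> 'w \<Rightarrow> nat" where
  "marked_count X Y l \<omega> = (LEAST c. \<exists>t\<in>\<rat> \<inter> {0..}. X t \<omega> + Y t \<omega> = l \<and> X t \<omega> = c)"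

lemma measurable_count_pair:
  fixes f g :: "'w \<Rightarrow> nat"
  assumes "f \<in> M \<rightarrow>\<^sub>M count_space UNIV" "g \<in> M \<rightarrow>\<^sub>M count_space UNIV" and "\<And>x y. h x y \<in> space K"
  shows "(\<lambda>\<omega>. h (f \<omega>) (g \<omega>)) \<in> M \<rightarrow>\<^sub>M K"
proof -
  have "(\<lambda>\<omega>. h x (g \<omega>)) \<in> M \<rightarrow>\<^sub>M K" for x
    by (rule measurable_compose_countable[where f = "\<lambda>y _. h x y", OF _ assms(2)]) (rule measurable_const[OF assms(3)])
  from measurable_compose_countable[where f = "\<lambda>x \<omega>. h x (g \<omega>)", OF this assms(1)] show ?thesis .
qed

lemma measurable_marked_count:
  assumes "\<And>t. 0 \<le> t \<Longrightarrow> X t \<in> M \<rightarrow>\<^sub>M count_space UNIV" "\<And>t. 0 \<le> t \<Longrightarrow> Y t \<in> M \<rightarrow>\<^sub>M count_space UNIV"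
  shows "marked_count X Y l \<in> M \<rightarrow>\<^sub>M count_space UNIV"
  unfolding marked_count_def[abs_def]
proof (rule measurable_Least)
  fix c
  have "Measurable.pred M (\<lambda>\<omega>. X t \<omega> + Y t \<omega> = l \<and> X t \<omega> = c)" if "t \<in> \<rat> \<inter> {0..}" for t
    using that assms[of t] by (intro measurable_count_pair[where h = "\<lambda>x y. x + y = l \<and> x = c"]) auto
  then show "Measurable.pred M (\<lambda>\<omega>. \<exists>t\<in>\<rat> \<inter> {0..}. X t \<omega> + Y t \<omega> = l \<and> X t \<omega> = c)"
    by (intro measurable_pred_countable countable_subset[OF Int_lower1 countable_rat])
qed

lemma measurable_heads: "(\<lambda>b m. heads b m) \<in> coin_tosses q \<rightarrow>\<^sub>M PiM UNIV (\<lambda>_. count_space UNIV)"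
proof (rule measurable_PiM_single')
  fix m
  show "(\<lambda>b. heads b m) \<in> coin_tosses q \<rightarrow>\<^sub>M count_space UNIV"
  proof (rule measurableI)
    fix A :: "nat set"
    have "{b. heads b m \<in> A} \<in> sets (coin_tosses q)"
      by (rule prefix_event(1)[where m = m]) (simp cong: heads_cong)
    then show "(\<lambda>b. heads b m) -` A \<inter> space (coin_tosses q) \<in> sets (coin_tosses q)"
      by (simp add: vimage_def)
  qed simp
qed simp

lemma poisson_density_thinning:
  assumes "0 < a" "0 \<le> b" "0 \<le> s"
  shows "poisson_density ((a + b) * s) (x + y) * (real ((x + y) choose x) * (a / (a + b)) ^ x * (1 - a / (a + b)) ^ y) =
    poisson_density (a * s) x * poisson_density (b * s) y"
proof -
  have ab: "a + b \<noteq> 0" and c: "1 - a / (a + b) = b / (a + b)" using assms by (auto simp: field_simps)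
  have choose: "real ((x + y) choose x) / fact (x + y) = 1 / (fact x * fact y)"
    by (simp add: binomial_fact)
  have exps: "exp (- ((a + b) * s)) = exp (- (a * s)) * exp (- (b * s))"
    by (simp add: distrib_right exp_add[symmetric])
  have powers: "((a + b) * s) ^ x * (a / (a + b)) ^ x = (a * s) ^ x" "((a + b) * s) ^ y * (b / (a + b)) ^ y = (b * s) ^ y"
    using ab by (simp_all add: mult.commute[of s] flip: power_mult_distrib)
  have "poisson_density ((a + b) * s) (x + y) * (real ((x + y) choose x) * (a / (a + b)) ^ x * (b / (a + b)) ^ y) =
    (((a + b) * s) ^ x * (a / (a + b)) ^ x) * (((a + b) * s) ^ y * (b / (a + b)) ^ y) *
    (real ((x + y) choose x) / fact (x + y)) * exp (- ((a + b) * s))"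
    unfolding poisson_density_def power_add by (simp add: mult_ac)
  also have "\<dots> = poisson_density (a * s) x * poisson_density (b * s) y"
    unfolding powers choose exps by (simp add: poisson_density_def)
  finally show ?thesis unfolding c .
qed

lemma measure_pair_Times:
  assumes "prob_space P" "prob_space Q" "A \<in> sets P" "B \<in> sets Q"
  shows "measure (P \<Otimes>\<^sub>M Q) (A \<times> B) = measure P A * measure Q B"
proof -
  interpret Q: prob_space Q by fact
  show ?thesis
    using assms by (simp add: measure_def Q.emeasure_pair_measure_Times enn2real_mult)
qed

lemma values_event:
  fixes X :: "real \<Rightarrow> 'w \<Rightarrow> nat" and t :: "nat \<Rightarrow> real"
  assumes "\<And>i. i \<le> k \<Longrightarrow> X (t i) \<in> M \<rightarrow>\<^sub>M count_space UNIV"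
  shows "{\<omega>\<in>space M. \<forall>i\<le>k. X (t i) \<omega> = v i} \<in> sets M"
proof -
  have "{\<omega>\<in>space M. X (t i) \<omega> = v i} \<in> sets M" if "i \<in> {..k}" for i
    using measurable_sets[OF assms, of i "{v i}"] that by (simp add: vimage_def Int_def conj_commute)
  then have "{\<omega>\<in>space M. \<forall>i\<in>{..k}. X (t i) \<omega> = v i} \<in> sets M"
    by (intro sets.sets_Collect_finite_All) simp_all
  then show ?thesis by (simp only: Ball_def atMost_iff)
qed

text \<open>
  Measurability with respect to two independent sub-\<open>\<sigma>\<close>-algebras is a convenient form of independence
  of two processes.
\<close>

locale independent_poisson_pair = prob_space P for P :: "'w measure" +
  fixes X Y :: "real \<Rightarrow> 'w \<Rightarrow> nat" and a b :: real and G H :: "'w measure"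
  assumes rates: "0 < a" "0 \<le> b"
    and increments: "poisson_increments P a X" "poisson_increments P b Y"
    and paths: "\<omega> \<in> space P \<Longrightarrow> counting_path (\<lambda>t. X t \<omega>)" "\<omega> \<in> space P \<Longrightarrow> counting_path (\<lambda>t. Y t \<omega>)"
    and subalgebras: "subalgebra P G" "subalgebra P H"
    and measurable_paths: "0 \<le> t \<Longrightarrow> X t \<in> G \<rightarrow>\<^sub>M count_space UNIV" "0 \<le> t \<Longrightarrow> Y t \<in> H \<rightarrow>\<^sub>M count_space UNIV"
    and independence: "A \<in> sets G \<Longrightarrow> B \<in> sets H \<Longrightarrow> prob (A \<inter> B) = prob A * prob B"
begin

abbreviation total :: "real \<Rightarrow> 'w \<Rightarrow> nat" where
  "total t \<omega> \<equiv> X t \<omega> + Y t \<omega>"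

lemma path_mono: "\<omega> \<in> space P \<Longrightarrow> mono_on {0..} (\<lambda>t. X t \<omega>)" "\<omega> \<in> space P \<Longrightarrow> mono_on {0..} (\<lambda>t. Y t \<omega>)"
  and path_start: "\<omega> \<in> space P \<Longrightarrow> X 0 \<omega> = 0" "\<omega> \<in> space P \<Longrightarrow> Y 0 \<omega> = 0"
  using paths by (auto simp: counting_path_def)

lemma total_mono: "\<omega> \<in> space P \<Longrightarrow> mono_on {0..} (\<lambda>t. total t \<omega>)"
  using path_mono by (auto simp: mono_on_def intro!: add_mono)

lemma measurable_P:
  assumes "0 \<le> t"
  shows "X t \<in> P \<rightarrow>\<^sub>M count_space UNIV" "Y t \<in> P \<rightarrow>\<^sub>M count_space UNIV" "total t \<in> P \<rightarrow>\<^sub>M count_space UNIV"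
proof -
  show X: "X t \<in> P \<rightarrow>\<^sub>M count_space UNIV" and Y: "Y t \<in> P \<rightarrow>\<^sub>M count_space UNIV"
    using measurable_from_subalg[OF subalgebras(1)] measurable_from_subalg[OF subalgebras(2)] measurable_paths[OF assms] by blast+
  show "total t \<in> P \<rightarrow>\<^sub>M count_space UNIV"
    by (rule measurable_count_pair[where h = "(+)", OF X Y]) simp
qed

lemma total_increments: "poisson_increments P (a + b) total"
  using poisson_increments_add[OF prob_space_axioms increments path_mono measurable_paths subalgebras independence] .

lemma total_levels: "AE \<omega> in P. \<forall>l. \<exists>t\<in>\<rat> \<inter> {0..}. total t \<omega> = l"
  using rates path_start
  by (intro AE_levels_visited[OF prob_space_axioms total_increments _ total_mono _ measurable_P(3)]) auto

lemma pair_values: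
  fixes t :: "nat \<Rightarrow> real"
  assumes t: "t 0 = 0" "\<forall>i<k. t i \<le> t (Suc i)"
  shows "prob {\<omega>\<in>space P. \<forall>i\<le>k. X (t i) \<omega> = x i \<and> Y (t i) \<omega> = y i} =
    (if x 0 = 0 \<and> y 0 = 0 \<and> (\<forall>i<k. x i \<le> x (Suc i)) \<and> (\<forall>i<k. y i \<le> y (Suc i))
     then \<Prod>i<k. poisson_density (a * (t (Suc i) - t i)) (x (Suc i) - x i) * poisson_density (b * (t (Suc i) - t i)) (y (Suc i) - y i)
     else 0)"
proof -
  have nonneg: "0 \<le> t i" if "i \<le> k" for i
    using that by (induction i) (use t in \<open>auto intro: order_trans\<close>)
  have sp: "space G = space P" "space H = space P" using subalgebras by (auto simp: subalgebra_def)
  have "{\<omega>\<in>space P. \<forall>i\<le>k. X (t i) \<omega> = x i} \<in> sets G" "{\<omega>\<in>space P. \<forall>i\<le>k. Y (t i) \<omega> = y i} \<in> sets H"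
    using values_event[of k X t G x, OF measurable_paths(1)[OF nonneg]] values_event[of k Y t H y, OF measurable_paths(2)[OF nonneg]]
    unfolding sp by blast+
  note indep = independence[OF this]
  have "{\<omega>\<in>space P. \<forall>i\<le>k. X (t i) \<omega> = x i \<and> Y (t i) \<omega> = y i} =
    {\<omega>\<in>space P. \<forall>i\<le>k. X (t i) \<omega> = x i} \<inter> {\<omega>\<in>space P. \<forall>i\<le>k. Y (t i) \<omega> = y i}" by blast
  then have "prob {\<omega>\<in>space P. \<forall>i\<le>k. X (t i) \<omega> = x i \<and> Y (t i) \<omega> = y i} =
      prob {\<omega>\<in>space P. \<forall>i\<le>k. X (t i) \<omega> = x i} * prob {\<omega>\<in>space P. \<forall>i\<le>k. Y (t i) \<omega> = y i}"
    using indep by (simp only:)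
  moreover note poisson_values[OF prob_space_axioms increments(1) path_mono(1) path_start(1) t, of x]
  moreover note poisson_values[OF prob_space_axioms increments(2) path_mono(2) path_start(2) t, of y]
  moreover have "(if c1 \<and> c2 then u else 0) * (if d1 \<and> d2 then w else 0) = (if c1 \<and> d1 \<and> c2 \<and> d2 then u * w else 0)"
    for c1 c2 d1 d2 and u w :: real by simp
  ultimately show ?thesis by (simp only: prod.distrib)
qed

text \<open>
  The other half of the comparison: coin tosses are attached to the points of \<open>total\<close> and the number of
  heads is separated from the number of tails. Prescribing both numbers means prescribing \<open>total\<close> and, for
  these values of \<open>total\<close>, the number of heads. The event is thus a rectangle, and Poisson times binomial
  weights recombine to the product of two Poisson weights.
\<close>

lemma thinned_values:
  fixes t :: "nat \<Rightarrow> real"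
  assumes t: "t 0 = 0" "\<forall>i<k. t i \<le> t (Suc i)"
  defines "q \<equiv> a / (a + b)"
  shows "measure (P \<Otimes>\<^sub>M coin_tosses q)
      {\<omega>\<in>space (P \<Otimes>\<^sub>M coin_tosses q). \<forall>i\<le>k. heads (snd \<omega>) (total (t i) (fst \<omega>)) = x i \<and>
        total (t i) (fst \<omega>) - heads (snd \<omega>) (total (t i) (fst \<omega>)) = y i} =
    (if x 0 = 0 \<and> y 0 = 0 \<and> (\<forall>i<k. x i \<le> x (Suc i)) \<and> (\<forall>i<k. y i \<le> y (Suc i))
     then \<Prod>i<k. poisson_density (a * (t (Suc i) - t i)) (x (Suc i) - x i) * poisson_density (b * (t (Suc i) - t i)) (y (Suc i) - y i)
     else 0)"
    (is "measure ?PQ ?E = _")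
proof -
  have nonneg: "0 \<le> t i" if "i \<le> k" for i
    using that by (induction i) (use t in \<open>auto intro: order_trans\<close>)
  have q: "0 \<le> q" "q \<le> 1" using rates by (auto simp: q_def field_simps)
  define z where "z i = x i + y i" for i
  define A where "A = {\<omega>\<in>space P. \<forall>i\<le>k. total (t i) \<omega> = z i}"
  define B where "B = {c. \<forall>i\<le>k. heads c (z i) = x i}"
  have iff: "h = x i \<and> s - h = y i \<longleftrightarrow> s = z i \<and> h = x i" if "h \<le> s" for h s i
    using that by (auto simp: z_def)
  have E: "?E = A \<times> B"
    by (auto simp: space_pair_measure A_def B_def iff[OF heads_le])
  have A: "A \<in> events"
    unfolding A_def by (rule values_event) (rule measurable_P(3)[OF nonneg])
  have B: "B \<in> sets (coin_tosses q)"
    unfolding B_def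
  proof (rule prefix_event(1)[where m = "\<Sum>i\<le>k. z i"])
    fix c c' :: "nat \<Rightarrow> bool" assume c: "\<And>j. j < (\<Sum>i\<le>k. z i) \<Longrightarrow> c j = c' j"
    have "heads c (z i) = heads c' (z i)" if "i \<le> k" for i
    proof (rule heads_cong)
      fix j assume "j < z i"
      moreover have "z i \<le> (\<Sum>i\<le>k. z i)" using that by (intro member_le_sum) auto
      ultimately show "c j = c' j" by (intro c) simp
    qed
    then show "(\<forall>i\<le>k. heads c (z i) = x i) = (\<forall>i\<le>k. heads c' (z i) = x i)" by simp
  qed
  have prod: "measure ?PQ ?E = prob A * measure (coin_tosses q) B"
    unfolding E by (rule measure_pair_Times[OF prob_space_axioms prob_space_coin_tosses A B])
  have total_start: "total 0 \<omega> = 0" if "\<omega> \<in> space P" for \<omega> using path_start[OF that] by simp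
  have A_prob: "prob A = (if z 0 = 0 \<and> (\<forall>i<k. z i \<le> z (Suc i))
     then \<Prod>i<k. poisson_density ((a + b) * (t (Suc i) - t i)) (z (Suc i) - z i) else 0)"
    unfolding A_def by (rule poisson_values[OF prob_space_axioms total_increments total_mono total_start t])
  show ?thesis
  proof (cases "z 0 = 0 \<and> (\<forall>i<k. z i \<le> z (Suc i))")
    case False
    have "\<not> (x 0 = 0 \<and> y 0 = 0 \<and> (\<forall>i<k. x i \<le> x (Suc i)) \<and> (\<forall>i<k. y i \<le> y (Suc i)))"
      using False unfolding z_def by (metis add_mono add_0)
    then show ?thesis unfolding prod A_prob using False by (simp only: if_False mult_zero_left)
  next
    case True
    then have x0: "x 0 = 0" "y 0 = 0" by (auto simp: z_def)
    have B_prob: "measure (coin_tosses q) B = (if x 0 = 0 \<and> (\<forall>i<k. x i \<le> x (Suc i))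
       then \<Prod>i<k. real ((z (Suc i) - z i) choose (x (Suc i) - x i)) * q ^ (x (Suc i) - x i) * (1 - q) ^ (z (Suc i) - z i - (x (Suc i) - x i))
       else 0)"
      unfolding B_def by (rule heads_law[OF q conjunct1[OF True] conjunct2[OF True]])
    show ?thesis
    proof (cases "\<forall>i<k. y i \<le> y (Suc i)")
      case False
      then obtain i where i: "i < k" "y (Suc i) < y i" by (auto simp: not_le)
      have "B = {}"
      proof (rule equals0I)
        fix c assume "c \<in> B"
        then have "heads c (z i) = x i" "heads c (z (Suc i)) = x (Suc i)" using i by (auto simp: B_def)
        moreover have "z i \<le> z (Suc i)" using True i by blast
        note tails_mono[OF this, of c]
        ultimately show False using i by (simp add: z_def)
      qed
      then show ?thesis unfolding prod using False by (simp only: measure_empty mult_zero_right) simp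
    next
      case y: True
      show ?thesis
      proof (cases "\<forall>i<k. x i \<le> x (Suc i)")
        case False
        then have n1: "\<not> (x 0 = 0 \<and> (\<forall>i<k. x i \<le> x (Suc i)))"
          and n2: "\<not> (x 0 = 0 \<and> y 0 = 0 \<and> (\<forall>i<k. x i \<le> x (Suc i)) \<and> (\<forall>i<k. y i \<le> y (Suc i)))" by blast+
        show ?thesis unfolding prod B_prob if_not_P[OF n1] if_not_P[OF n2] by simp
      next
        case x: True
        have "measure ?PQ ?E = (\<Prod>i<k. poisson_density ((a + b) * (t (Suc i) - t i)) (z (Suc i) - z i) *
            (real ((z (Suc i) - z i) choose (x (Suc i) - x i)) * q ^ (x (Suc i) - x i) * (1 - q) ^ (z (Suc i) - z i - (x (Suc i) - x i))))"
          unfolding prod A_prob B_prob if_P[OF True] if_P[OF conjI[OF x0(1) x]] by (simp only: prod.distrib)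
        also have "\<dots> = (\<Prod>i<k. poisson_density (a * (t (Suc i) - t i)) (x (Suc i) - x i) * poisson_density (b * (t (Suc i) - t i)) (y (Suc i) - y i))"
        proof (rule prod.cong[OF refl])
          fix i assume "i \<in> {..<k}"
          then have i: "x i \<le> x (Suc i)" "y i \<le> y (Suc i)" "0 \<le> t (Suc i) - t i" using x y t by auto
          have e: "z (Suc i) - z i = (x (Suc i) - x i) + (y (Suc i) - y i)"
            "z (Suc i) - z i - (x (Suc i) - x i) = y (Suc i) - y i"
            using i by (auto simp: z_def)
          show "poisson_density ((a + b) * (t (Suc i) - t i)) (z (Suc i) - z i) *
              (real ((z (Suc i) - z i) choose (x (Suc i) - x i)) * q ^ (x (Suc i) - x i) * (1 - q) ^ (z (Suc i) - z i - (x (Suc i) - x i))) =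
              poisson_density (a * (t (Suc i) - t i)) (x (Suc i) - x i) * poisson_density (b * (t (Suc i) - t i)) (y (Suc i) - y i)"
            unfolding e(2) unfolding e(1) q_def by (rule poisson_density_thinning[OF rates i(3)])
        qed
        finally show ?thesis unfolding if_P[OF conjI[OF x0(1) conjI[OF x0(2) conjI[OF x y]]]] .
      qed
    qed
  qed
qed

text \<open>
  The pair \<open>(X, Y)\<close> has the law of the pair obtained by tossing a coin at each point of \<open>total\<close>. For the latter
  the marks are the coin tosses themselves, which are independent of \<open>total\<close> by construction; and being
  independent of \<open>total\<close> is a property of the law of the pair, since \<open>total\<close> and the marks are measurable
  functions of it.
\<close>

theorem thinning:
  defines "q \<equiv> a / (a + b)"
  assumes A: "A \<in> sets (process_algebra P total)" and D: "D \<in> sets (PiM UNIV (\<lambda>_. count_space UNIV))"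
  shows "prob (A \<inter> {\<omega>\<in>space P. (\<lambda>l. marked_count X Y l \<omega>) \<in> D}) = prob A * measure (coin_tosses q) {c. heads c \<in> D}"
proof -
  let ?PQ = "P \<Otimes>\<^sub>M coin_tosses q"
  interpret coin: prob_space "coin_tosses q" by (rule prob_space_coin_tosses)
  interpret PQ: pair_prob_space P "coin_tosses q" ..
  let ?S = "PiM {0..} (\<lambda>_. count_space UNIV) :: (real \<Rightarrow> nat \<times> nat) measure"
  let ?N = "PiM {0..} (\<lambda>_. count_space UNIV) :: (real \<Rightarrow> nat) measure"
  define X2 where "X2 t p = heads (snd p) (total t (fst p))" for t p
  define Y2 where "Y2 t p = total t (fst p) - heads (snd p) (total t (fst p))" for t p
  have mtotal: "(\<lambda>p. total t (fst p)) \<in> ?PQ \<rightarrow>\<^sub>M count_space UNIV" if "0 \<le> t" for t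
    by (rule measurable_compose[OF measurable_fst measurable_P(3)[OF that]])
  have mheads: "(\<lambda>p. heads (snd p) m) \<in> ?PQ \<rightarrow>\<^sub>M count_space UNIV" for m
    by (rule measurable_compose[OF measurable_snd measurable_compose[OF measurable_heads measurable_component_singleton]]) simp
  have mX2: "X2 t \<in> ?PQ \<rightarrow>\<^sub>M count_space UNIV" if "0 \<le> t" for t
    unfolding X2_def[abs_def] by (rule measurable_compose_countable[OF mheads mtotal[OF that]])
  have mY2: "Y2 t \<in> ?PQ \<rightarrow>\<^sub>M count_space UNIV" if "0 \<le> t" for t
    unfolding Y2_def[abs_def] X2_def[symmetric]
    by (rule measurable_count_pair[where h = "\<lambda>x y. x - y", OF mtotal[OF that] mX2[OF that]]) simp
  have m1: "(\<lambda>\<omega>. (X t \<omega>, Y t \<omega>)) \<in> P \<rightarrow>\<^sub>M count_space UNIV" if "0 \<le> t" for t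
    by (rule measurable_count_pair[OF measurable_P(1,2)[OF that]]) simp
  have m2: "(\<lambda>\<omega>. (X2 t \<omega>, Y2 t \<omega>)) \<in> ?PQ \<rightarrow>\<^sub>M count_space UNIV" if "0 \<le> t" for t
    by (rule measurable_count_pair[OF mX2[OF that] mY2[OF that]]) simp
  let ?f1 = "\<lambda>\<omega>. \<lambda>t\<in>{0..}. (X t \<omega>, Y t \<omega>)" and ?f2 = "\<lambda>p. \<lambda>t\<in>{0..}. (X2 t p, Y2 t p)"
  have law: "distr P ?S ?f1 = distr ?PQ ?S ?f2"
  proof (rule process_law_eqI[OF prob_space_axioms PQ.prob_space_axioms m1 m2])
    fix k and t :: "nat \<Rightarrow> real" and v :: "nat \<Rightarrow> nat \<times> nat"
    assume t: "t 0 = 0" "\<forall>i<k. t i \<le> t (Suc i)"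
    have v: "(u, w) = v i \<longleftrightarrow> u = fst (v i) \<and> w = snd (v i)" for u w i by (cases "v i") auto
    show "\<P>(\<omega> in P. \<forall>i\<le>k. (X (t i) \<omega>, Y (t i) \<omega>) = v i) = \<P>(p in ?PQ. \<forall>i\<le>k. (X2 (t i) p, Y2 (t i) p) = v i)"
      unfolding v X2_def Y2_def q_def
      by (rule trans[OF pair_values[OF t] thinned_values[OF t, symmetric]])
  qed
  have mf1: "?f1 \<in> P \<rightarrow>\<^sub>M ?S" using m1 by (intro measurable_restrict) simp
  have mf2: "?f2 \<in> ?PQ \<rightarrow>\<^sub>M ?S" using m2 by (intro measurable_restrict) simp
  \<comment> \<open>Both the superposed path and the counts of marked points are measurable functions of the pair of paths.\<close>
  define \<Phi> where "\<Phi> w = (\<lambda>l. marked_count (\<lambda>t w. fst (w t)) (\<lambda>t w. snd (w t)) l w)" for w :: "real \<Rightarrow> nat \<times> nat"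
  define \<zeta> where "\<zeta> w = (\<lambda>t\<in>{0..}. fst (w t) + snd (w t))" for w :: "real \<Rightarrow> nat \<times> nat"
  have m\<Phi>: "\<Phi> \<in> ?S \<rightarrow>\<^sub>M PiM UNIV (\<lambda>_. count_space UNIV)"
    unfolding \<Phi>_def
  proof (rule measurable_PiM_single')
    fix l
    show "(\<lambda>w. marked_count (\<lambda>t w. fst (w t)) (\<lambda>t w. snd (w t)) l w) \<in> ?S \<rightarrow>\<^sub>M count_space UNIV"
      by (rule measurable_marked_count)
        (rule measurable_compose[OF measurable_component_singleton], simp_all)+
  qed simp
  have m\<zeta>: "\<zeta> \<in> ?S \<rightarrow>\<^sub>M ?N"
    unfolding \<zeta>_def
  proof (rule measurable_restrict)
    fix t :: real assume "t \<in> {0..}"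
    then have "(\<lambda>w. w t) \<in> ?S \<rightarrow>\<^sub>M count_space UNIV" by (rule measurable_component_singleton)
    then show "(\<lambda>w. fst (w t) + snd (w t)) \<in> ?S \<rightarrow>\<^sub>M count_space UNIV"
      by (rule measurable_compose) simp
  qed
  have "(\<lambda>\<omega>. \<lambda>t\<in>{0..}. total t \<omega>) \<in> space P \<rightarrow> space ?N" by (auto simp: space_PiM)
  then obtain A' where A': "A' \<in> sets ?N" and A_eq: "A = (\<lambda>\<omega>. \<lambda>t\<in>{0..}. total t \<omega>) -` A' \<inter> space P"
    using A unfolding process_algebra_def sets_vimage_algebra2[OF \<open>_ \<in> space P \<rightarrow> space ?N\<close>] by blast
  define W where "W = (\<zeta> -` A' \<inter> space ?S) \<inter> (\<Phi> -` D \<inter> space ?S)"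
  have W: "W \<in> sets ?S"
    unfolding W_def using measurable_sets[OF m\<zeta> A'] measurable_sets[OF m\<Phi> D] by (rule sets.Int)
  have mc_restrict: "marked_count (\<lambda>t w. fst (w t)) (\<lambda>t w. snd (w t)) l (\<lambda>t\<in>{0..}. (f t, g t)) =
      (LEAST c. \<exists>t\<in>\<rat> \<inter> {0..}. f t + g t = l \<and> f t = c)" for l and f g :: "real \<Rightarrow> nat"
    unfolding marked_count_def by (rule arg_cong[where f = Least]) auto
  have space_S: "(\<lambda>t\<in>{0..}. h t) \<in> space ?S" for h :: "real \<Rightarrow> nat \<times> nat" by (simp add: space_PiM)
  have \<zeta>_pair: "\<zeta> (\<lambda>t\<in>{0..}. (f t, g t)) = (\<lambda>t\<in>{0..}. f t + g t)" for f g :: "real \<Rightarrow> nat"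
    unfolding \<zeta>_def by (rule restrict_ext) simp
  have "?f1 -` W \<inter> space P = A \<inter> {\<omega>\<in>space P. (\<lambda>l. marked_count X Y l \<omega>) \<in> D}"
    unfolding W_def A_eq \<Phi>_def
    by (auto simp: space_S \<zeta>_pair mc_restrict marked_count_def[of X Y])
  then have "prob (A \<inter> {\<omega>\<in>space P. (\<lambda>l. marked_count X Y l \<omega>) \<in> D}) = measure (distr P ?S ?f1) W"
    using measure_distr[OF mf1 W] by (simp only:)
  also have "\<dots> = measure ?PQ (?f2 -` W \<inter> space ?PQ)"
    unfolding law by (rule measure_distr[OF mf2 W])
  also have "\<dots> = measure ?PQ (A \<times> {c. heads c \<in> D})"
  proof (rule PQ.finite_measure_eq_AE)
    have "AE p in ?PQ. \<forall>l. \<exists>t\<in>\<rat> \<inter> {0..}. total t (fst p) = l"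
    proof (rule AE_distrD[OF measurable_fst])
      show "AE \<omega> in distr ?PQ P fst. \<forall>l. \<exists>t\<in>\<rat> \<inter> {0..}. total t \<omega> = l"
        unfolding coin.distr_pair_fst by (rule total_levels)
    qed
    then show "AE p in ?PQ. p \<in> ?f2 -` W \<inter> space ?PQ \<longleftrightarrow> p \<in> A \<times> {c. heads c \<in> D}"
    proof (rule AE_mp, intro AE_I2 impI)
      fix p assume p: "p \<in> space ?PQ" and levels: "\<forall>l. \<exists>t\<in>\<rat> \<inter> {0..}. total t (fst p) = l"
      have sum: "X2 t p + Y2 t p = total t (fst p)" for t
        using heads_le[of "snd p"] by (simp add: X2_def Y2_def)
      have "(LEAST c. \<exists>t\<in>\<rat> \<inter> {0..}. X2 t p + Y2 t p = l \<and> X2 t p = c) = heads (snd p) l" for l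
      proof -
        have iff: "(\<exists>t\<in>\<rat> \<inter> {0..}. X2 t p + Y2 t p = l \<and> X2 t p = c) \<longleftrightarrow> c = heads (snd p) l" for c
          unfolding sum using levels by (auto simp: X2_def)
        show ?thesis unfolding iff by (rule Least_equality) simp_all
      qed
      then have "\<Phi> (?f2 p) = heads (snd p)"
        unfolding \<Phi>_def mc_restrict by (simp add: fun_eq_iff)
      moreover have "\<zeta> (?f2 p) = (\<lambda>t\<in>{0..}. total t (fst p))"
        unfolding \<zeta>_pair sum ..
      ultimately show "p \<in> ?f2 -` W \<inter> space ?PQ \<longleftrightarrow> p \<in> A \<times> {c. heads c \<in> D}"
        using p space_S unfolding W_def A_eq by (cases p) (auto simp: space_pair_measure)
    qed
    show "?f2 -` W \<inter> space ?PQ \<in> sets ?PQ" by (rule measurable_sets[OF mf2 W])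
    have "A \<in> events"
      unfolding A_eq
      by (rule measurable_sets[OF measurable_restrict A']) (use measurable_P(3) in simp)
    then show "A \<times> {c. heads c \<in> D} \<in> sets ?PQ"
      using measurable_sets[OF measurable_heads D] by (intro pair_measureI) (simp_all add: vimage_def)
  qed
  also have "\<dots> = prob A * measure (coin_tosses q) {c. heads c \<in> D}"
  proof (rule measure_pair_Times[OF prob_space_axioms prob_space_coin_tosses])
    show "A \<in> events"
      unfolding A_eq
      by (rule measurable_sets[OF measurable_restrict A']) (use measurable_P(3) in simp)
    show "{c. heads c \<in> D} \<in> sets (coin_tosses q)"
      using measurable_sets[OF measurable_heads D, of q] by (simp add: vimage_def)
  qed
  finally show ?thesis .
qed

end

section \<open>Conditioning on independent noise\<close>

text \<open>
  What is known is put into \<open>\<tau>\<close>, and the rest of the randomness is independent of it. Then one may freeze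
  \<open>\<tau> \<omega>\<close> and average over the rest only. By independence the diagonal map \<open>\<omega> \<mapsto> (\<omega>, \<omega>)\<close> carries \<open>P\<close> to the product
  of its restrictions to \<open>F\<close> and \<open>G\<close>, so that the defining identity of a conditional probability is Fubini's
  theorem.
\<close>

lemma conditional_distribution_freeze:
  assumes P: "prob_space P" and F: "subalgebra P F" and G: "subalgebra P G"
    and indep: "\<And>A B. A \<in> sets F \<Longrightarrow> B \<in> sets G \<Longrightarrow> measure P (A \<inter> B) = measure P A * measure P B"
    and \<tau>: "\<tau> \<in> F \<rightarrow>\<^sub>M T"
    and H: "(\<lambda>(t, \<omega>). H t \<omega>) \<in> T \<Otimes>\<^sub>M G \<rightarrow>\<^sub>M E"
    and Y: "Y \<in> P \<rightarrow>\<^sub>M E" and eq: "AE \<omega> in P. Y \<omega> = H (\<tau> \<omega>) \<omega>"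
  shows "conditional_distribution P F Y E (\<lambda>\<omega>. distr P E (H (\<tau> \<omega>)))"
proof -
  interpret prob_space P by fact
  interpret F: finite_measure_subalgebra P F
    by (intro finite_measure_subalgebra.intro finite_measure_axioms finite_measure_subalgebra_axioms.intro F)
  have sp: "space F = space P" "space G = space P" and sub: "sets F \<subseteq> sets P" "sets G \<subseteq> sets P"
    using F G by (auto simp: subalgebra_def)
  let ?F = "restr_to_subalg P F" and ?G = "restr_to_subalg P G"
  have sets_eq [measurable_cong]: "sets ?G = sets G" "sets ?F = sets F"
    using F G by (auto simp: sets_restr_to_subalg)
  have sps: "space ?F = space P" "space ?G = space P"
    by (auto simp: space_restr_to_subalg)
  interpret rF: prob_space ?F by (rule prob_space_restr_to_subalg[OF F]) unfold_locales
  interpret rG: prob_space ?G by (rule prob_space_restr_to_subalg[OF G]) unfold_locales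
  have idF: "(\<lambda>\<omega>. \<omega>) \<in> P \<rightarrow>\<^sub>M F" and idG: "(\<lambda>\<omega>. \<omega>) \<in> P \<rightarrow>\<^sub>M G"
    using sp sub by (auto simp: measurable_def)
  have mdiag: "(\<lambda>\<omega>. (\<omega>, \<omega>)) \<in> P \<rightarrow>\<^sub>M ?F \<Otimes>\<^sub>M ?G"
    using measurable_Pair[OF idF idG] sets_pair_measure_cong[OF sets_eq(2,1)]
    by (simp cong: measurable_cong_sets)
  \<comment> \<open>Independence says that the pair \<open>(\<omega>, \<omega>)\<close> has the product law on \<open>F \<Otimes> G\<close>.\<close>
  have diag: "?F \<Otimes>\<^sub>M ?G = distr P (?F \<Otimes>\<^sub>M ?G) (\<lambda>\<omega>. (\<omega>, \<omega>))"
  proof (rule pair_measure_eqI)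
    fix A B assume "A \<in> sets ?F" "B \<in> sets ?G"
    then have A: "A \<in> sets F" and B: "B \<in> sets G" by (auto simp: sets_eq)
    have "emeasure (distr P (?F \<Otimes>\<^sub>M ?G) (\<lambda>\<omega>. (\<omega>, \<omega>))) (A \<times> B) = emeasure P (A \<inter> B)"
      using A B sub sets.sets_into_space[of A P]
      by (subst emeasure_distr[OF mdiag]) (auto intro!: arg_cong[where f = "emeasure P"] simp: sets_eq)
    also have "\<dots> = emeasure P A * emeasure P B"
      using indep[OF A B] by (simp add: emeasure_eq_measure ennreal_mult)
    finally show "emeasure ?F A * emeasure ?G B = emeasure (distr P (?F \<Otimes>\<^sub>M ?G) (\<lambda>\<omega>. (\<omega>, \<omega>))) (A \<times> B)"
      using A B F G by (simp add: emeasure_restr_to_subalg)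
  qed (use rF.sigma_finite_measure_axioms rG.sigma_finite_measure_axioms in auto)
  have H_frozen: "H (\<tau> \<omega>) \<in> G \<rightarrow>\<^sub>M E" if "\<omega> \<in> space P" for \<omega>
    using measurable_Pair2[OF H, of "\<tau> \<omega>"] measurable_space[OF \<tau>, of \<omega>] that sp by simp
  have H\<tau>: "(\<lambda>(\<omega>, \<omega>'). H (\<tau> \<omega>) \<omega>') \<in> F \<Otimes>\<^sub>M G \<rightarrow>\<^sub>M E"
    using measurable_compose[OF _ H, of "\<lambda>(\<omega>, \<omega>'). (\<tau> \<omega>, \<omega>')" "F \<Otimes>\<^sub>M G"] \<tau>
    by (simp add: case_prod_beta')
  have distr_eq: "distr P E (H (\<tau> \<omega>)) = distr ?G E (H (\<tau> \<omega>))" if "\<omega> \<in> space F" for \<omega>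
  proof (rule measure_eqI)
    fix A assume A: "A \<in> sets (distr P E (H (\<tau> \<omega>)))"
    have m: "H (\<tau> \<omega>) \<in> G \<rightarrow>\<^sub>M E" using H_frozen that sp by auto
    have m2: "H (\<tau> \<omega>) \<in> P \<rightarrow>\<^sub>M E" by (rule measurable_from_subalg[OF G m])
    have m3: "H (\<tau> \<omega>) \<in> ?G \<rightarrow>\<^sub>M E" by (rule measurable_in_subalg[OF G m])
    have "H (\<tau> \<omega>) -` A \<inter> space P \<in> sets G"
      using measurable_sets[OF m, of A] A sp by simp
    then show "emeasure (distr P E (H (\<tau> \<omega>))) A = emeasure (distr ?G E (H (\<tau> \<omega>))) A"
      using A by (simp add: emeasure_distr[OF m2] emeasure_distr[OF m3] sps emeasure_restr_to_subalg[OF G])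
  qed simp
  have "(\<lambda>\<omega>. distr ?G E (H (\<tau> \<omega>))) \<in> F \<rightarrow>\<^sub>M prob_algebra E"
  proof (rule measurable_distr_prob_space2[where M = G])
    show "(\<lambda>\<omega>. ?G) \<in> F \<rightarrow>\<^sub>M prob_algebra G"
      using rG.prob_space_axioms sets_eq by (intro measurable_const) (simp add: space_prob_algebra)
  qed (fact H\<tau>)
  then have K: "(\<lambda>\<omega>. distr P E (H (\<tau> \<omega>))) \<in> F \<rightarrow>\<^sub>M prob_algebra E"
    by (subst measurable_cong[OF distr_eq])
  have "AE \<omega> in P. measure (distr P E (H (\<tau> \<omega>))) B = real_cond_exp P F (indicator (Y -` B \<inter> space P)) \<omega>"
    if B: "B \<in> sets E" for B
  proof -
    define g where "g \<omega> = measure (distr P E (H (\<tau> \<omega>))) B" for \<omega>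
    have g: "g \<in> borel_measurable F"
      unfolding g_def using measurable_compose[OF measurable_prob_algebraD[OF K] measurable_measure_subprob_algebra[OF B]]
      by (simp add: comp_def)
    have g_bound: "norm (g \<omega>) \<le> 1" if "\<omega> \<in> space P" for \<omega>
    proof -
      have "prob_space (distr P E (H (\<tau> \<omega>)))"
        using H_frozen[OF that] measurable_from_subalg[OF G] by (intro prob_space_distr) auto
      then show ?thesis unfolding g_def by (simp add: prob_space.prob_le_1)
    qed
    have gP: "g \<in> borel_measurable P" using g by (rule measurable_from_subalg[OF F])
    have int_g: "integrable P g"
      using gP g_bound by (intro integrable_const_bound[where B = 1]) auto
    have YB: "Y -` B \<inter> space P \<in> sets P" using Y B by (rule measurable_sets)
    have "AE \<omega> in P. real_cond_exp P F (indicator (Y -` B \<inter> space P)) \<omega> = g \<omega>"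
    proof (rule F.real_cond_exp_charact)
      fix A assume A: "A \<in> sets F"
      then have AP: "A \<in> sets P" using sub by auto
      let ?D = "{(\<omega>, \<omega>'). \<omega> \<in> A \<and> \<omega> \<in> space P \<and> \<omega>' \<in> space P \<and> H (\<tau> \<omega>) \<omega>' \<in> B}"
      have Deq: "?D = (A \<times> space G) \<inter> ((\<lambda>(\<omega>, \<omega>'). H (\<tau> \<omega>) \<omega>') -` B \<inter> space (F \<Otimes>\<^sub>M G))"
        using sp by (auto simp: space_pair_measure)
      have "?D \<in> sets (F \<Otimes>\<^sub>M G)"
        unfolding Deq by (intro sets.Int pair_measureI A sets.top measurable_sets[OF H\<tau> B])
      then have D: "?D \<in> sets (?F \<Otimes>\<^sub>M ?G)"
        using sets_pair_measure_cong[OF sets_eq(2,1)] by simp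
      have "ennreal (\<integral>\<omega>\<in>A. indicator (Y -` B \<inter> space P) \<omega> \<partial>P) = ennreal (measure P (A \<inter> (Y -` B \<inter> space P)))"
        using AP YB by (simp add: set_lebesgue_integral_def indicator_inter_arith[symmetric])
      also have "\<dots> = emeasure P (A \<inter> (Y -` B \<inter> space P))"
        by (simp add: emeasure_eq_measure)
      also have "\<dots> = emeasure P ((\<lambda>\<omega>. (\<omega>, \<omega>)) -` ?D \<inter> space P)"
      proof (rule emeasure_eq_AE)
        show "AE \<omega> in P. \<omega> \<in> A \<inter> (Y -` B \<inter> space P) \<longleftrightarrow> \<omega> \<in> (\<lambda>\<omega>. (\<omega>, \<omega>)) -` ?D \<inter> space P"
          using eq by eventually_elim auto
        show "(\<lambda>\<omega>. (\<omega>, \<omega>)) -` ?D \<inter> space P \<in> events" by (rule measurable_sets[OF mdiag D])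
      qed (use AP YB in auto)
      also have "\<dots> = emeasure (?F \<Otimes>\<^sub>M ?G) ?D"
        by (subst diag, subst emeasure_distr[OF mdiag D]) simp
      also have "\<dots> = (\<integral>\<^sup>+\<omega>. emeasure ?G (Pair \<omega> -` ?D) \<partial>?F)"
        by (rule rG.emeasure_pair_measure_alt[OF D])
      also have "\<dots> = (\<integral>\<^sup>+\<omega>. ennreal (indicator A \<omega> * g \<omega>) \<partial>?F)"
      proof (rule nn_integral_cong)
        fix \<omega> assume "\<omega> \<in> space ?F"
        then have w: "\<omega> \<in> space P" "\<omega> \<in> space F" using sps sp by auto
        have m: "H (\<tau> \<omega>) \<in> G \<rightarrow>\<^sub>M E" using H_frozen w by auto
        have m2: "H (\<tau> \<omega>) \<in> P \<rightarrow>\<^sub>M E" by (rule measurable_from_subalg[OF G m])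
        have s: "H (\<tau> \<omega>) -` B \<inter> space P \<in> sets G"
          using measurable_sets[OF m, of B] B sp by simp
        have "Pair \<omega> -` ?D = (if \<omega> \<in> A then H (\<tau> \<omega>) -` B \<inter> space P else {})"
          using w by auto
        then show "emeasure ?G (Pair \<omega> -` ?D) = ennreal (indicator A \<omega> * g \<omega>)"
          using s B by (simp add: g_def emeasure_restr_to_subalg[OF G] measure_distr[OF m2] emeasure_eq_measure)
      qed
      also have "\<dots> = (\<integral>\<^sup>+\<omega>. ennreal (indicator A \<omega> * g \<omega>) \<partial>P)"
        using A g by (intro nn_integral_subalgebra2[OF F]) auto
      also have "\<dots> = ennreal (\<integral>\<omega>. indicator A \<omega> * g \<omega> \<partial>P)"
        using AP int_g by (intro nn_integral_eq_integral integrable_mult_indicator[where f = g, simplified]) (auto simp: g_def)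
      finally show "(\<integral>\<omega>\<in>A. indicator (Y -` B \<inter> space P) \<omega> \<partial>P) = (\<integral>\<omega>\<in>A. g \<omega> \<partial>P)"
        by (subst (asm) ennreal_inj) (auto simp: set_lebesgue_integral_def g_def intro!: integral_nonneg_AE)
    qed (use int_g g YB in \<open>auto simp: emeasure_eq_measure\<close>)
    then show ?thesis unfolding g_def by eventually_elim simp
  qed
  with F Y K show ?thesis
    unfolding conditional_distribution_def by blast
qed

section \<open>Killed Markov chains\<close>

text \<open>
  The numbering follows \<open>markov_chain\<close>: the step from index \<open>l\<close> to \<open>Suc l\<close> is governed by \<open>Q (Suc l)\<close>.
\<close>

locale substochastic_matrices =
  fixes S :: "'s set" and Q :: "nat \<Rightarrow> 's \<Rightarrow> 's \<Rightarrow> real"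
  assumes finite_states: "finite S"
    and substochastic: "substochastic_matrix S (Q (Suc l))"
begin

fun transition_product :: "nat \<Rightarrow> nat \<Rightarrow> 's \<Rightarrow> 's \<Rightarrow> real" where
  "transition_product l 0 i j = (if i = j then 1 else 0)"
| "transition_product l (Suc d) i j = (\<Sum>k\<in>S. transition_product l d i k * Q (Suc (l + d)) k j)"

lemma substochastic_nonneg: "i \<in> S \<Longrightarrow> j \<in> S \<Longrightarrow> 0 \<le> Q (Suc l) i j"
  using substochastic[of l] by (auto simp: substochastic_matrix_def)

lemma substochastic_sum: "i \<in> S \<Longrightarrow> (\<Sum>j\<in>S. Q (Suc l) i j) \<le> 1"
  using substochastic[of l] by (auto simp: substochastic_matrix_def finite_states)

lemma transition_product_nonneg: "i \<in> S \<Longrightarrow> j \<in> S \<Longrightarrow> 0 \<le> transition_product l d i j"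
  by (induction d arbitrary: j) (auto intro!: sum_nonneg mult_nonneg_nonneg substochastic_nonneg)

lemma transition_product_row:
  assumes "i \<in> S"
  shows "(\<Sum>j\<in>S. transition_product l d i j) \<le> 1"
proof (induction d)
  case 0
  then show ?case using finite_states by (simp add: sum.delta')
next
  case (Suc d)
  have "(\<Sum>j\<in>S. transition_product l (Suc d) i j) = (\<Sum>k\<in>S. transition_product l d i k * (\<Sum>j\<in>S. Q (Suc (l + d)) k j))"
    by (simp add: sum_distrib_left) (rule sum.swap)
  also have "\<dots> \<le> (\<Sum>k\<in>S. transition_product l d i k)"
    using assms by (intro sum_mono mult_left_le substochastic_sum transition_product_nonneg)
  finally show ?case using Suc by linarith
qed

lemma transition_product_add:
  assumes "i \<in> S" and "j \<in> S"
  shows "(\<Sum>k\<in>S. transition_product l d i k * transition_product (l + d) e k j) = transition_product l (d + e) i j"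
  using assms(2)
proof (induction e arbitrary: j)
  case 0
  then show ?case using finite_states by (simp add: if_distrib[where f = "\<lambda>x. _ * x"] sum.delta cong: if_cong)
next
  case (Suc e)
  have "(\<Sum>k\<in>S. transition_product l d i k * transition_product (l + d) (Suc e) k j) =
    (\<Sum>m\<in>S. (\<Sum>k\<in>S. transition_product l d i k * transition_product (l + d) e k m) * Q (Suc (l + d + e)) m j)"
    by (simp add: sum_distrib_left sum_distrib_right mult.assoc) (rule sum.swap)
  also have "\<dots> = transition_product l (d + Suc e) i j"
    by (simp add: Suc.IH add.assoc)
  finally show ?case .
qed

end

text \<open>
  Only paths in living states are described. With an absorbing cemetery this determines the law: a path
  that is alive at time \<open>l\<close> has been alive before, and the probability of dying is what the living states
  leave over.
\<close>

locale killed_chain = prob_space P + substochastic_matrices S Q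
  for P :: "'w measure" and S :: "'s set" and Q :: "nat \<Rightarrow> 's \<Rightarrow> 's \<Rightarrow> real" +
  fixes Y :: "nat \<Rightarrow> 'w \<Rightarrow> 's option" and \<mu> :: "'s \<Rightarrow> real"
  assumes measurable_chain: "Y l \<in> P \<rightarrow>\<^sub>M count_space UNIV"
    and states: "\<omega> \<in> space P \<Longrightarrow> Y l \<omega> \<in> insert None (Some ` S)"
    and absorbing: "\<omega> \<in> space P \<Longrightarrow> Y l \<omega> = None \<Longrightarrow> Y (Suc l) \<omega> = None"
    and path_law: "(\<And>k. k \<le> l \<Longrightarrow> y k \<in> S) \<Longrightarrow>
      prob {\<omega>\<in>space P. \<forall>k\<le>l. Y k \<omega> = Some (y k)} = \<mu> (y 0) * (\<Prod>k<l. Q (Suc k) (y k) (y (Suc k)))"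
begin

lemma absorbed:
  assumes "\<omega> \<in> space P" "Y l \<omega> = None" "l \<le> m"
  shows "Y m \<omega> = None"
  using assms(3) by (induction rule: dec_induct) (use assms(1,2) absorbing in auto)

lemma chain_event [measurable]: "{\<omega>\<in>space P. R (Y l \<omega>)} \<in> events"
  using measurable_sets[OF measurable_chain, of "Collect R" l] by (simp add: vimage_def Int_def conj_commute)

text \<open>
  Being alive at time \<open>l\<close> makes the whole history up to \<open>l\<close> living, so the event splits into finitely many
  histories to which \<open>path_law\<close> applies.
\<close>

lemma history_event:
  assumes "\<And>y y'. (\<And>k. k \<le> l \<Longrightarrow> y k = y' k) \<Longrightarrow> G y = G y'"
  shows "{\<omega>\<in>space P. G (\<lambda>k. Y k \<omega>) \<and> Y l \<omega> = Some i} =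
    (\<Union>y\<in>{y\<in>PiE {..l} (\<lambda>_. S). G (\<lambda>k. Some (y k)) \<and> y l = i}. {\<omega>\<in>space P. \<forall>k\<le>l. Y k \<omega> = Some (y k)})"
    (is "?L = (\<Union>y\<in>?I. ?E y)")
proof (intro equalityI subsetI)
  fix \<omega> assume "\<omega> \<in> ?L"
  then have w: "\<omega> \<in> space P" and G: "G (\<lambda>k. Y k \<omega>)" and i: "Y l \<omega> = Some i" by auto
  define y where "y = restrict (\<lambda>k. the (Y k \<omega>)) {..l}"
  have Some: "Y k \<omega> = Some (y k)" if "k \<le> l" for k
    using absorbed[OF w, of k l] i that by (cases "Y k \<omega>") (auto simp: y_def)
  have "G (\<lambda>k. Some (y k)) = G (\<lambda>k. Y k \<omega>)"
    by (rule assms) (simp add: Some)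
  moreover have "y k \<in> S" if "k \<le> l" for k
    using states[OF w, of k] Some[OF that] by auto
  moreover have "y l = i" using Some[of l] i by simp
  ultimately have "y \<in> ?I" using G by (auto simp: y_def)
  then show "\<omega> \<in> (\<Union>y\<in>?I. ?E y)" using Some w by blast
next
  fix \<omega> assume "\<omega> \<in> (\<Union>y\<in>?I. ?E y)"
  then obtain y where w: "\<omega> \<in> space P" and G: "G (\<lambda>k. Some (y k))" and y: "y l = i"
    and Some: "\<And>k. k \<le> l \<Longrightarrow> Y k \<omega> = Some (y k)" by blast
  have "G (\<lambda>k. Y k \<omega>) = G (\<lambda>k. Some (y k))"
    by (rule assms) (simp add: Some)
  then show "\<omega> \<in> ?L" using w G y Some[of l] by simp
qed

lemma prob_histories:
  assumes "finite I" and I: "I \<subseteq> PiE {..l} (\<lambda>_. S)"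
  shows "prob (\<Union>y\<in>I. {\<omega>\<in>space P. \<forall>k\<le>l. Y k \<omega> = Some (y k)}) =
    (\<Sum>y\<in>I. \<mu> (y 0) * (\<Prod>k<l. Q (Suc k) (y k) (y (Suc k))))"
proof -
  have ev: "{\<omega>\<in>space P. \<forall>k\<le>l. Y k \<omega> = Some (y k)} \<in> events" for y
  proof -
    have "{\<omega>\<in>space P. \<forall>k\<in>{..l}. Y k \<omega> = Some (y k)} \<in> events"
      by (intro sets.sets_Collect_finite_All chain_event) auto
    then show ?thesis by (simp only: Ball_def atMost_iff)
  qed
  have "prob (\<Union>y\<in>I. {\<omega>\<in>space P. \<forall>k\<le>l. Y k \<omega> = Some (y k)}) =
    (\<Sum>y\<in>I. prob {\<omega>\<in>space P. \<forall>k\<le>l. Y k \<omega> = Some (y k)})"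
  proof (rule finite_measure_finite_Union[OF \<open>finite I\<close>])
    show "disjoint_family_on (\<lambda>y. {\<omega>\<in>space P. \<forall>k\<le>l. Y k \<omega> = Some (y k)}) I"
      unfolding disjoint_family_on_def
    proof (intro ballI impI)
      fix y z assume yz: "y \<in> I" "z \<in> I" "y \<noteq> z"
      then have "y \<in> PiE {..l} (\<lambda>_. S)" "z \<in> PiE {..l} (\<lambda>_. S)" using I by auto
      then obtain k where k: "k \<le> l" "y k \<noteq> z k" using yz(3) PiE_ext[of y "{..l}" "\<lambda>_. S" z] by auto
      then show "{\<omega>\<in>space P. \<forall>k\<le>l. Y k \<omega> = Some (y k)} \<inter> {\<omega>\<in>space P. \<forall>k\<le>l. Y k \<omega> = Some (z k)} = {}"
        by auto
    qed
  qed (use ev in auto)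
  also have "\<dots> = (\<Sum>y\<in>I. \<mu> (y 0) * (\<Prod>k<l. Q (Suc k) (y k) (y (Suc k))))"
    by (intro sum.cong refl path_law) (use I in auto)
  finally show ?thesis .
qed

lemma one_step:
  assumes G: "\<And>y y'. (\<And>k. k \<le> l \<Longrightarrow> y k = y' k) \<Longrightarrow> G y = G y'" and i: "i \<in> S" and j: "j \<in> S"
  shows "prob {\<omega>\<in>space P. G (\<lambda>k. Y k \<omega>) \<and> Y l \<omega> = Some i \<and> Y (Suc l) \<omega> = Some j} =
    prob {\<omega>\<in>space P. G (\<lambda>k. Y k \<omega>) \<and> Y l \<omega> = Some i} * Q (Suc l) i j"
proof -
  define I where "I = {y\<in>PiE {..l} (\<lambda>_. S). G (\<lambda>k. Some (y k)) \<and> y l = i}"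
  define I' where "I' = {y\<in>PiE {..Suc l} (\<lambda>_. S). (G (\<lambda>k. Some (y k)) \<and> y l = i) \<and> y (Suc l) = j}"
  have fin: "finite I" "finite I'"
    unfolding I_def I'_def
    using finite_subset[OF _ finite_PiE[of "{..l}" "\<lambda>_. S"]] finite_subset[OF _ finite_PiE[of "{..Suc l}" "\<lambda>_. S"]]
      finite_states by simp_all
  have sub: "I \<subseteq> PiE {..l} (\<lambda>_. S)" "I' \<subseteq> PiE {..Suc l} (\<lambda>_. S)"
    unfolding I_def I'_def by auto
  have H: "{\<omega>\<in>space P. G (\<lambda>k. Y k \<omega>) \<and> Y l \<omega> = Some i} =
      (\<Union>y\<in>I. {\<omega>\<in>space P. \<forall>k\<le>l. Y k \<omega> = Some (y k)})"
    unfolding I_def by (rule history_event[where G = G, OF G])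
  have G': "(G y \<and> y l = Some i) = (G y' \<and> y' l = Some i)" if "\<And>k. k \<le> Suc l \<Longrightarrow> y k = y' k"
    for y y' :: "nat \<Rightarrow> 's option"
  proof -
    have "G y = G y'" by (rule G) (rule that, simp)
    moreover have "y l = y' l" by (rule that) simp
    ultimately show ?thesis by simp
  qed
  have "{\<omega>\<in>space P. (G (\<lambda>k. Y k \<omega>) \<and> Y l \<omega> = Some i) \<and> Y (Suc l) \<omega> = Some j} =
      (\<Union>y\<in>I'. {\<omega>\<in>space P. \<forall>k\<le>Suc l. Y k \<omega> = Some (y k)})"
    unfolding I'_def
    using history_event[where l = "Suc l" and i = j and G = "\<lambda>y. G y \<and> y l = Some i", OF G']
    by (simp only: option.inject)
  then have "prob {\<omega>\<in>space P. G (\<lambda>k. Y k \<omega>) \<and> Y l \<omega> = Some i \<and> Y (Suc l) \<omega> = Some j} =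
      (\<Sum>y\<in>I'. \<mu> (y 0) * (\<Prod>k<Suc l. Q (Suc k) (y k) (y (Suc k))))"
    using prob_histories[OF fin(2) sub(2)] by (simp only: conj_assoc)
  also have "\<dots> = (\<Sum>y\<in>I. \<mu> (y 0) * (\<Prod>k<l. Q (Suc k) (y k) (y (Suc k))) * Q (Suc l) i j)"
  proof (rule sum.reindex_bij_witness[where i = "\<lambda>y. y(Suc l := j)" and j = "\<lambda>y. restrict y {..l}"])
    fix y assume y: "y \<in> I'"
    then have yP: "y \<in> PiE {..Suc l} (\<lambda>_. S)" by (simp add: I'_def)
    have "G (\<lambda>k. Some (restrict y {..l} k)) = G (\<lambda>k. Some (y k))" by (rule G) simp
    moreover have "restrict y {..l} \<in> PiE {..l} (\<lambda>_. S)"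
      using yP by (simp add: PiE_iff)
    ultimately show "restrict y {..l} \<in> I" using y unfolding I_def I'_def by simp
    show "(restrict y {..l})(Suc l := j) = y"
    proof (rule ext)
      fix k
      show "((restrict y {..l})(Suc l := j)) k = y k"
        using PiE_arb[OF yP, of k] y unfolding I'_def by (cases "k = Suc l"; cases "k \<le> l") simp_all
    qed
    show "\<mu> (restrict y {..l} 0) * (\<Prod>k<l. Q (Suc k) (restrict y {..l} k) (restrict y {..l} (Suc k))) * Q (Suc l) i j
        = \<mu> (y 0) * (\<Prod>k<Suc l. Q (Suc k) (y k) (y (Suc k)))"
      using y by (simp add: I'_def)
  next
    fix y assume y: "y \<in> I"
    then have yP: "y \<in> PiE {..l} (\<lambda>_. S)" by (simp add: I_def)
    have "G (\<lambda>k. Some ((y(Suc l := j)) k)) = G (\<lambda>k. Some (y k))" by (rule G) simp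
    moreover have "y(Suc l := j) \<in> PiE {..Suc l} (\<lambda>_. S)"
      using PiE_fun_upd[OF j yP, of "Suc l"] by (simp add: atMost_Suc)
    ultimately show "y(Suc l := j) \<in> I'"
      using y unfolding I_def I'_def by simp
    show "restrict (y(Suc l := j)) {..l} = y"
    proof (rule ext)
      fix k
      show "restrict (y(Suc l := j)) {..l} k = y k"
        using PiE_arb[OF yP, of k] by (cases "k \<le> l") simp_all
    qed
  qed
  also have "\<dots> = prob {\<omega>\<in>space P. G (\<lambda>k. Y k \<omega>) \<and> Y l \<omega> = Some i} * Q (Suc l) i j"
    unfolding H prob_histories[OF fin(1) sub(1)] by (rule sum_distrib_right[symmetric])
  finally show ?thesis .
qed

lemma history_event_sets:
  assumes G: "\<And>y y'. (\<And>k. k \<le> l \<Longrightarrow> y k = y' k) \<Longrightarrow> G y = G y'"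
  shows "{\<omega>\<in>space P. G (\<lambda>k. Y k \<omega>)} \<in> events"
proof -
  have "countable (PiE {..l} (\<lambda>_. insert None (Some ` S)))"
    by (intro countable_PiE) (auto intro: countable_finite finite_states)
  moreover have ev: "{\<omega>\<in>space P. \<forall>k\<in>{..l}. Y k \<omega> = y k} \<in> events" for y
    by (intro sets.sets_Collect_finite_All chain_event) auto
  moreover have "{\<omega>\<in>space P. G (\<lambda>k. Y k \<omega>)} =
      (\<Union>y\<in>{y\<in>PiE {..l} (\<lambda>_. insert None (Some ` S)). G y}. {\<omega>\<in>space P. \<forall>k\<in>{..l}. Y k \<omega> = y k})"
  proof (intro equalityI subsetI)
    fix \<omega> assume "\<omega> \<in> {\<omega>\<in>space P. G (\<lambda>k. Y k \<omega>)}"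
    then have w: "\<omega> \<in> space P" and g: "G (\<lambda>k. Y k \<omega>)" by auto
    let ?y = "restrict (\<lambda>k. Y k \<omega>) {..l}"
    have "G ?y = G (\<lambda>k. Y k \<omega>)" by (rule G) simp
    with g have "?y \<in> {y\<in>PiE {..l} (\<lambda>_. insert None (Some ` S)). G y}"
      using states[OF w] by (auto simp: PiE_iff)
    then show "\<omega> \<in> (\<Union>y\<in>{y\<in>PiE {..l} (\<lambda>_. insert None (Some ` S)). G y}. {\<omega>\<in>space P. \<forall>k\<in>{..l}. Y k \<omega> = y k})"
      using w by (rule_tac UN_I[of ?y]) auto
  next
    fix \<omega> assume "\<omega> \<in> (\<Union>y\<in>{y\<in>PiE {..l} (\<lambda>_. insert None (Some ` S)). G y}. {\<omega>\<in>space P. \<forall>k\<in>{..l}. Y k \<omega> = y k})"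
    then obtain y where w: "\<omega> \<in> space P" and g: "G y" and y: "\<And>k. k \<le> l \<Longrightarrow> Y k \<omega> = y k" by auto
    have "G (\<lambda>k. Y k \<omega>) = G y" by (rule G) (rule y)
    with g w show "\<omega> \<in> {\<omega>\<in>space P. G (\<lambda>k. Y k \<omega>)}" by simp
  qed
  ultimately show ?thesis
    by (simp only:) (intro sets.countable_UN' countable_subset[OF _ \<open>countable _\<close>], auto)
qed

text \<open>
  The events \<open>G\<close> need not determine the path up to \<open>l\<close>. This freedom is used both for the intermediate
  times of the induction and for chains that are observed at a subset of the times.
\<close>

lemma multi_step:
  assumes G: "\<And>y y'. (\<And>k. k \<le> l \<Longrightarrow> y k = y' k) \<Longrightarrow> G y = G y'" and i: "i \<in> S" and j: "j \<in> S"
  shows "prob {\<omega>\<in>space P. G (\<lambda>k. Y k \<omega>) \<and> Y l \<omega> = Some i \<and> Y (l + d) \<omega> = Some j} =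
    prob {\<omega>\<in>space P. G (\<lambda>k. Y k \<omega>) \<and> Y l \<omega> = Some i} * transition_product l d i j"
  using j
proof (induction d arbitrary: j)
  case 0
  have "{\<omega>\<in>space P. G (\<lambda>k. Y k \<omega>) \<and> Y l \<omega> = Some i \<and> Y l \<omega> = Some j} =
     (if i = j then {\<omega>\<in>space P. G (\<lambda>k. Y k \<omega>) \<and> Y l \<omega> = Some i} else {})" by auto
  then show ?case by simp
next
  case (Suc d)
  define D where "D k = {\<omega>\<in>space P. (G (\<lambda>k. Y k \<omega>) \<and> Y l \<omega> = Some i) \<and> Y (l + d) \<omega> = Some k \<and> Y (Suc (l + d)) \<omega> = Some j}" for k
  have G1: "(G y \<and> y l = Some i) = (G y' \<and> y' l = Some i)" if "\<And>k. k \<le> l + d \<Longrightarrow> y k = y' k"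
    for y y' :: "nat \<Rightarrow> 's option"
  proof -
    have "G y = G y'" by (rule G) (rule that, simp)
    moreover have "y l = y' l" by (rule that) simp
    ultimately show ?thesis by simp
  qed
  have G2: "((G y \<and> y l = Some i) \<and> y (l + d) = Some k \<and> y (Suc (l + d)) = Some j) = ((G y' \<and> y' l = Some i) \<and> y' (l + d) = Some k \<and> y' (Suc (l + d)) = Some j)"
    if "\<And>k. k \<le> Suc (l + d) \<Longrightarrow> y k = y' k"
    for y y' :: "nat \<Rightarrow> 's option" and k
  proof -
    have "(G y \<and> y l = Some i) = (G y' \<and> y' l = Some i)" by (rule G1) (rule that, simp)
    moreover have "y (l + d) = y' (l + d)" by (rule that) simp
    moreover have "y (Suc (l + d)) = y' (Suc (l + d))" by (rule that) simp
    ultimately show ?thesis by simp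
  qed
  have "{\<omega>\<in>space P. G (\<lambda>k. Y k \<omega>) \<and> Y l \<omega> = Some i \<and> Y (l + Suc d) \<omega> = Some j} = (\<Union>k\<in>S. D k)"
  proof (intro equalityI subsetI)
    fix \<omega> assume a: "\<omega> \<in> {\<omega>\<in>space P. G (\<lambda>k. Y k \<omega>) \<and> Y l \<omega> = Some i \<and> Y (l + Suc d) \<omega> = Some j}"
    then have w: "\<omega> \<in> space P" and "Y (Suc (l + d)) \<omega> \<noteq> None" by auto
    then have "Y (l + d) \<omega> \<noteq> None" using absorbing[OF w, of "l + d"] by (cases "Y (l + d) \<omega>") auto
    then obtain k where "k \<in> S" "Y (l + d) \<omega> = Some k" using states[OF w, of "l + d"] by auto
    then show "\<omega> \<in> (\<Union>k\<in>S. D k)" using a by (auto simp: D_def)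
  qed (auto simp: D_def)
  then have "prob {\<omega>\<in>space P. G (\<lambda>k. Y k \<omega>) \<and> Y l \<omega> = Some i \<and> Y (l + Suc d) \<omega> = Some j} = prob (\<Union>k\<in>S. D k)"
    by (simp only:)
  also have "\<dots> = (\<Sum>k\<in>S. prob (D k))"
  proof (rule finite_measure_finite_Union[OF finite_states])
    show "D ` S \<subseteq> events"
    proof (rule image_subsetI)
      fix k
      show "D k \<in> events"
        unfolding D_def by (rule history_event_sets[where l = "Suc (l + d)" and
            G = "\<lambda>y. (G y \<and> y l = Some i) \<and> y (l + d) = Some k \<and> y (Suc (l + d)) = Some j", OF G2])
    qed
  qed (auto simp: D_def disjoint_family_on_def)
  also have "\<dots> = (\<Sum>k\<in>S. prob {\<omega>\<in>space P. G (\<lambda>k. Y k \<omega>) \<and> Y l \<omega> = Some i \<and> Y (l + d) \<omega> = Some k} * Q (Suc (l + d)) k j)"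
  proof (rule sum.cong[OF refl])
    fix k assume k: "k \<in> S"
    show "prob (D k) = prob {\<omega>\<in>space P. G (\<lambda>k. Y k \<omega>) \<and> Y l \<omega> = Some i \<and> Y (l + d) \<omega> = Some k} * Q (Suc (l + d)) k j"
      unfolding D_def using one_step[where l = "l + d" and i = k and j = j and G = "\<lambda>y. G y \<and> y l = Some i", OF G1] k Suc.prems
      by (simp only: conj_assoc)
  qed
  also have "\<dots> = prob {\<omega>\<in>space P. G (\<lambda>k. Y k \<omega>) \<and> Y l \<omega> = Some i} * transition_product l (Suc d) i j"
    by (simp add: Suc.IH sum_distrib_left mult.assoc)
  finally show ?case .
qed

text \<open>
  A history that ends in the cemetery stays there. A living one is continued by \<open>one_step\<close>, and what the
  living states leave over goes to the cemetery.
\<close>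

lemma markov_chain: "markov_chain P Y S \<mu> Q"
  unfolding markov_chain_def
proof (intro conjI allI impI ballI)
  show "prob_space P" by (rule prob_space_axioms)
  show "Y l \<in> P \<rightarrow>\<^sub>M count_space UNIV" for l by (rule measurable_chain)
  show "AE \<omega> in P. Y l \<omega> \<in> insert None (Some ` S)" for l using states by (intro AE_I2) auto
  show "prob {\<omega>\<in>space P. Y 0 \<omega> = Some x} = \<mu> x" if "x \<in> S" for x
    using path_law[of 0 "\<lambda>_. x"] that by simp
  show "substochastic_matrix S (Q l)" if "1 \<le> l" for l
    using substochastic[of "l - 1"] that by simp
  fix l x y
  assume "1 \<le> l" and x: "\<forall>k<l. x k \<in> insert None (Some ` S)" and y: "y \<in> insert None (Some ` S)"
    and pos: "0 < prob {\<omega>\<in>space P. \<forall>k<l. Y k \<omega> = x k}"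
  then obtain m where l: "l = Suc m" by (cases l) auto
  let ?G = "\<lambda>y. \<forall>k<Suc m. y k = x k"
  have G: "?G y = ?G y'" if "\<And>k. k \<le> m \<Longrightarrow> y k = y' k" for y y'
    using that by (auto simp: less_Suc_eq_le)
  have ev: "{\<omega>\<in>space P. (\<forall>k<Suc m. Y k \<omega> = x k) \<and> Y (Suc m) \<omega> = z} \<in> events"
    "{\<omega>\<in>space P. \<forall>k<Suc m. Y k \<omega> = x k} \<in> events" for z
  proof -
    show "{\<omega>\<in>space P. \<forall>k<Suc m. Y k \<omega> = x k} \<in> events"
      by (rule history_event_sets[where G = ?G, OF G])
    then show "{\<omega>\<in>space P. (\<forall>k<Suc m. Y k \<omega> = x k) \<and> Y (Suc m) \<omega> = z} \<in> events"
      by (intro sets.sets_Collect_conj chain_event)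
  qed
  let ?H = "{\<omega>\<in>space P. \<forall>k<Suc m. Y k \<omega> = x k}"
  let ?J = "\<lambda>z. {\<omega>\<in>space P. (\<forall>k<Suc m. Y k \<omega> = x k) \<and> Y (Suc m) \<omega> = z}"
  have J: "prob (?J y) = prob ?H * with_cemetery 1 S (Q (Suc m)) (x m) y"
  proof (cases "x m")
    case None
    have e1: "?J None = ?H" using absorbing[of _ m] None by auto
    have e2: "?J (Some z) = {}" for z using absorbing[of _ m] None by fastforce
    show ?thesis
      by (cases y) (simp_all only: None e1 e2 with_cemetery.simps measure_empty mult_zero_right mult_1_right)
  next
    case (Some i)
    with x have i: "i \<in> S" unfolding l by (auto dest!: spec[of _ m])
    have step: "prob (?J (Some j)) = prob ?H * Q (Suc m) i j" if j: "j \<in> S" for j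
    proof -
      have e: "{\<omega>\<in>space P. (\<forall>k<Suc m. Y k \<omega> = x k) \<and> Y m \<omega> = Some i \<and> Y (Suc m) \<omega> = Some j} = ?J (Some j)"
        "{\<omega>\<in>space P. (\<forall>k<Suc m. Y k \<omega> = x k) \<and> Y m \<omega> = Some i} = ?H"
        using Some by auto
      show ?thesis
        using one_step[where G = ?G and l = m, OF G i j] by (simp only: e)
    qed
    show ?thesis
    proof (cases y)
      case (Some j)
      then show ?thesis using step y \<open>x m = Some i\<close> by auto
    next
      case None
      have "prob ?H = prob (\<Union>z\<in>insert None (Some ` S). ?J z)"
        using states by (intro arg_cong[where f = prob]) auto
      also have "\<dots> = (\<Sum>z\<in>insert None (Some ` S). prob (?J z))"
        using ev finite_states by (intro finite_measure_finite_Union) (auto simp: disjoint_family_on_def)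
      also have "\<dots> = prob (?J None) + (\<Sum>j\<in>S. prob (?J (Some j)))"
        using finite_states by (subst sum.insert) (auto simp: sum.reindex)
      also have "(\<Sum>j\<in>S. prob (?J (Some j))) = (\<Sum>j\<in>S. prob ?H * Q (Suc m) i j)"
        by (intro sum.cong refl step)
      also have "\<dots> = prob ?H * (\<Sum>j\<in>S. Q (Suc m) i j)" by (simp add: sum_distrib_left)
      finally show ?thesis
        using None Some finite_states by (simp add: algebra_simps)
    qed
  qed
  have e: "{\<omega>\<in>space P. Y l \<omega> = y \<and> (\<forall>k<l. Y k \<omega> = x k)} = ?J y" unfolding l by auto
  show "\<P>(\<omega> in P. Y l \<omega> = y \<bar> \<forall>k<l. Y k \<omega> = x k) = with_cemetery 1 S (Q l) (x (l - 1)) y"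
    unfolding cond_prob_def e using J pos unfolding l by simp
qed

end

section \<open>The level semigroup\<close>

text \<open>
  The row sums \<open>R\<close> of a substochastic semigroup satisfy \<open>R (s + t) = r s R t\<close>: exchange the two summations in
  the sum of the Chapman--Kolmogorov equations over the final state. This is the Chapman--Kolmogorov
  equation for entering the cemetery.
\<close>

lemma cemetery_semigroup:
  fixes r :: "real \<Rightarrow> 's \<Rightarrow> 's \<Rightarrow> real"
  assumes nonneg: "\<And>t x y. 0 \<le> t \<Longrightarrow> x \<in> S \<Longrightarrow> y \<in> S \<Longrightarrow> 0 \<le> r t x y"
    and summable: "\<And>t x. 0 \<le> t \<Longrightarrow> x \<in> S \<Longrightarrow> r t x summable_on S"
    and le_1: "\<And>t x. 0 \<le> t \<Longrightarrow> x \<in> S \<Longrightarrow> (\<Sum>\<^sub>\<infinity>y\<in>S. r t x y) \<le> 1"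
    and zero: "\<And>x y. x \<in> S \<Longrightarrow> y \<in> S \<Longrightarrow> r 0 x y = (if x = y then 1 else 0)"
    and chapman_kolmogorov: "\<And>s t x y. 0 \<le> s \<Longrightarrow> 0 \<le> t \<Longrightarrow> x \<in> S \<Longrightarrow> y \<in> S \<Longrightarrow>
      ((\<lambda>z. r s x z * r t z y) has_sum r (s + t) x y) S"
  shows "transition_semigroup (insert None (Some ` S)) (\<lambda>t. with_cemetery 1 S (r t))"
proof -
  have split: "(f has_sum (f None + a)) (insert None (Some ` S))" if "((\<lambda>z. f (Some z)) has_sum a) S"
    for f :: "'s option \<Rightarrow> real" and a
    using that by (intro has_sum_insert) (auto simp: has_sum_reindex o_def)
  define R where "R t x = (\<Sum>\<^sub>\<infinity>y\<in>S. r t x y)" for t x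
  have R: "(r t x has_sum R t x) S" if "0 \<le> t" "x \<in> S" for t x
    unfolding R_def using summable[OF that] by (rule has_sum_infsum)
  have none: "with_cemetery 1 S (r t) (Some x) None = 1 - R t x" for t x
    by (simp add: R_def)
  have row: "(with_cemetery 1 S (r t) x has_sum 1) (insert None (Some ` S))"
    if "0 \<le> t" "x \<in> insert None (Some ` S)" for t x
  proof (cases x)
    case None
    then show ?thesis using split[of "with_cemetery 1 S (r t) None" 0] by simp
  next
    case (Some a)
    then show ?thesis using split[of "with_cemetery 1 S (r t) (Some a)" "R t a"] R[of t a] that by (auto simp: R_def)
  qed
  have CK_none: "((\<lambda>z. r s x z * (1 - R t z)) has_sum (R s x - R (s + t) x)) S"
    if st: "0 \<le> s" "0 \<le> t" and x: "x \<in> S" for s t x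
  proof -
    let ?f = "\<lambda>(z, y). r s x z * r t z y" and ?g = "\<lambda>(y, z). r s x z * r t z y"
    have col: "((\<lambda>z. ?g (y, z)) has_sum r (s + t) x y) S" if "y \<in> S" for y
      using chapman_kolmogorov[OF st x that] by simp
    have "?g summable_on S \<times> S"
      by (rule summable_on_SigmaI[OF col]) (use st x nonneg in \<open>auto intro!: summable mult_nonneg_nonneg\<close>)
    then have "(?g has_sum R (s + t) x) (S \<times> S)"
      by (intro has_sum_SigmaI[OF col R]) (use st x in auto)
    then have f: "(?f has_sum R (s + t) x) (S \<times> S)"
      by (subst has_sum_swap) (simp add: case_prod_beta')
    have "((\<lambda>z. r s x z * R t z) has_sum R (s + t) x) S"
      by (rule has_sum_SigmaD[OF f]) (use st in \<open>auto intro!: has_sum_cmult_right R\<close>)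
    then have "((\<lambda>z. - (r s x z * R t z)) has_sum - R (s + t) x) S" by (simp add: has_sum_uminus)
    from has_sum_add[OF R[OF st(1) x] this] show ?thesis by (simp add: algebra_simps)
  qed
  show ?thesis
    unfolding transition_semigroup_def
  proof (intro conjI allI impI ballI)
    fix t :: real and x y assume t: "0 \<le> t" and x: "x \<in> insert None (Some ` S)" and y: "y \<in> insert None (Some ` S)"
    show "0 \<le> with_cemetery 1 S (r t) x y"
      using t x y nonneg le_1 by (cases x; cases y) auto
  next
    fix t :: real and x assume "0 \<le> t" "x \<in> insert None (Some ` S)"
    then show "(with_cemetery 1 S (r t) x has_sum 1) (insert None (Some ` S))" by (rule row)
  next
    fix x y assume x: "x \<in> insert None (Some ` S)" and y: "y \<in> insert None (Some ` S)"
    have "R 0 a = 1" if "a \<in> S" for a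
    proof -
      have "(r 0 a has_sum 1) S"
        by (rule has_sum_finite_neutralI[of "{a}"]) (use that zero in auto)
      then show ?thesis unfolding R_def by (rule infsumI)
    qed
    then show "with_cemetery 1 S (r 0) x y = (if x = y then 1 else 0)"
      using x y zero by (cases x; cases y) (auto simp: R_def)
  next
    fix s t :: real and x y assume st: "0 \<le> s" "0 \<le> t"
      and x: "x \<in> insert None (Some ` S)" and y: "y \<in> insert None (Some ` S)"
    let ?h = "\<lambda>z. with_cemetery 1 S (r s) x z * with_cemetery 1 S (r t) z y"
    show "(?h has_sum with_cemetery 1 S (r (s + t)) x y) (insert None (Some ` S))"
    proof (cases x)
      case None
      then show ?thesis using split[of ?h 0] by (cases y) simp_all
    next
      case (Some a)
      note xa = this
      with x have a: "a \<in> S" by auto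
      show ?thesis
      proof (cases y)
        case None
        then show ?thesis
          using split[of ?h "R s a - R (s + t) a"] CK_none[OF st a] by (simp add: xa none del: with_cemetery.simps(2))
      next
        case (Some b)
        then show ?thesis
          using split[of ?h "r (s + t) a b"] chapman_kolmogorov[OF st a, of b] y by (auto simp: xa)
      qed
    qed
  qed
qed

lemma poisson_density_sum: "0 \<le> r \<Longrightarrow> (poisson_density r has_sum 1) UNIV"
proof -
  assume r: "0 \<le> r"
  have "(\<lambda>k. r ^ k / fact k * exp (- r)) sums (exp r * exp (- r))"
    using exp_converges[of r] by (intro sums_mult2) (simp add: field_simps)
  then show ?thesis
    using r unfolding poisson_density_def[abs_def] by (intro sums_nonneg_imp_has_sum) (auto simp: exp_minus_inverse)
qed

context substochastic_matrices
begin

text \<open>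
  In time \<open>t\<close> the clock advances by a Poisson number \<open>d\<close> of levels, and the state moves according to the
  product of the \<open>d\<close> matrices on the way.
\<close>

definition level_transition :: "real \<Rightarrow> real \<Rightarrow> nat \<times> 's \<Rightarrow> nat \<times> 's \<Rightarrow> real" where
  "level_transition \<nu> t x y =
     (if fst x \<le> fst y then poisson_density (\<nu> * t) (fst y - fst x) *
        transition_product (fst x) (fst y - fst x) (snd x) (snd y) else 0)"

lemma level_transition_nonneg:
  "0 \<le> \<nu> \<Longrightarrow> 0 \<le> t \<Longrightarrow> x \<in> UNIV \<times> S \<Longrightarrow> y \<in> UNIV \<times> S \<Longrightarrow> 0 \<le> level_transition \<nu> t x y"
  unfolding level_transition_def
  by (auto intro!: mult_nonneg_nonneg transition_product_nonneg poisson_density_nonneg)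

lemma row_sums_summable:
  assumes "0 \<le> r" "i \<in> S"
  shows "(\<lambda>d. poisson_density r d * (\<Sum>j\<in>S. transition_product l d i j)) summable_on UNIV"
proof (rule summable_on_comparison_test[where f = "poisson_density r"])
  show "poisson_density r summable_on UNIV" using poisson_density_sum[OF assms(1)] by (auto simp: summable_on_def)
  fix d
  show "poisson_density r d * (\<Sum>j\<in>S. transition_product l d i j) \<le> poisson_density r d"
    using assms by (intro mult_left_le transition_product_row poisson_density_nonneg)
  show "0 \<le> poisson_density r d * (\<Sum>j\<in>S. transition_product l d i j)"
    using assms by (intro mult_nonneg_nonneg sum_nonneg transition_product_nonneg poisson_density_nonneg)
qed

lemma level_transition_row:
  assumes "0 \<le> \<nu>" "0 \<le> t" "i \<in> S"
  shows "(level_transition \<nu> t (l, i) has_sum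
    (\<Sum>\<^sub>\<infinity>d. poisson_density (\<nu> * t) d * (\<Sum>j\<in>S. transition_product l d i j))) (UNIV \<times> S)"
proof -
  have \<nu>t: "0 \<le> \<nu> * t" using assms by simp
  let ?f = "\<lambda>(d, j). poisson_density (\<nu> * t) d * transition_product l d i j"
  let ?g = "\<lambda>d. poisson_density (\<nu> * t) d * (\<Sum>j\<in>S. transition_product l d i j)"
  have inner: "((\<lambda>j. ?f (d, j)) has_sum ?g d) S" for d
    using finite_states by (intro has_sum_finiteI) (auto simp: sum_distrib_left)
  have g: "?g summable_on UNIV" by (rule row_sums_summable[OF \<nu>t assms(3)])
  have "?f summable_on UNIV \<times> S"
    by (rule summable_on_SigmaI[OF inner g])
      (use assms \<nu>t in \<open>auto intro!: mult_nonneg_nonneg transition_product_nonneg poisson_density_nonneg\<close>)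
  then have "(?f has_sum (\<Sum>\<^sub>\<infinity>d. ?g d)) (UNIV \<times> S)"
    by (intro has_sum_SigmaI[OF inner has_sum_infsum[OF g]])
  also have "?f = (\<lambda>x. level_transition \<nu> t (l, i) (l + fst x, snd x))"
    by (auto simp: level_transition_def)
  also have "(\<dots> has_sum (\<Sum>\<^sub>\<infinity>d. ?g d)) (UNIV \<times> S) \<longleftrightarrow>
     (level_transition \<nu> t (l, i) has_sum (\<Sum>\<^sub>\<infinity>d. ?g d)) ({l..} \<times> S)"
    by (rule has_sum_reindex_bij_witness[where i = "\<lambda>x. (fst x - l, snd x)" and j = "\<lambda>x. (l + fst x, snd x)"]) auto
  also have "\<dots> \<longleftrightarrow> (level_transition \<nu> t (l, i) has_sum (\<Sum>\<^sub>\<infinity>d. ?g d)) (UNIV \<times> S)"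
    by (rule has_sum_cong_neutral) (auto simp: level_transition_def)
  finally show ?thesis .
qed

text \<open>
  For a given final level only finitely many intermediate levels contribute. The matrix products
  compose to a factor that does not depend on the intermediate level, and what remains is the
  convolution of Poisson weights.
\<close>

lemma level_transition_chapman_kolmogorov:
  assumes "i \<in> S" "j \<in> S"
  shows "((\<lambda>z. level_transition \<nu> s (l, i) z * level_transition \<nu> t z (m, j)) has_sum
     level_transition \<nu> (s + t) (l, i) (m, j)) (UNIV \<times> S)"
proof (rule has_sum_finite_neutralI[of "{l..m} \<times> S"])
  show "finite ({l..m} \<times> S)" using finite_states by simp
  show "{l..m} \<times> S \<subseteq> UNIV \<times> S" by auto
  show "level_transition \<nu> s (l, i) z * level_transition \<nu> t z (m, j) = 0" if "z \<in> UNIV \<times> S - {l..m} \<times> S" for z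
    using that by (auto simp: level_transition_def)
  show "level_transition \<nu> (s + t) (l, i) (m, j) =
     (\<Sum>z\<in>{l..m} \<times> S. level_transition \<nu> s (l, i) z * level_transition \<nu> t z (m, j))"
  proof (cases "l \<le> m")
    case False
    then show ?thesis by (simp add: level_transition_def)
  next
    case True
    then obtain D where m: "m = l + D" using le_Suc_ex by blast
    have "(\<Sum>z\<in>{l..m} \<times> S. level_transition \<nu> s (l, i) z * level_transition \<nu> t z (m, j)) =
      (\<Sum>q\<in>{l..m}. \<Sum>k\<in>S. level_transition \<nu> s (l, i) (q, k) * level_transition \<nu> t (q, k) (m, j))"
      by (simp add: sum.cartesian_product case_prod_beta')
    also have "\<dots> = (\<Sum>d\<le>D. \<Sum>k\<in>S. level_transition \<nu> s (l, i) (l + d, k) * level_transition \<nu> t (l + d, k) (m, j))"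
      by (rule sum.reindex_bij_witness[where i = "\<lambda>d. l + d" and j = "\<lambda>q. q - l"]) (auto simp: m)
    also have "\<dots> = (\<Sum>d\<le>D. poisson_density (\<nu> * s) d * poisson_density (\<nu> * t) (D - d) * transition_product l D i j)"
    proof (rule sum.cong[OF refl])
      fix d assume d: "d \<in> {..D}"
      have "(\<Sum>k\<in>S. level_transition \<nu> s (l, i) (l + d, k) * level_transition \<nu> t (l + d, k) (m, j)) =
        poisson_density (\<nu> * s) d * poisson_density (\<nu> * t) (D - d) *
          (\<Sum>k\<in>S. transition_product l d i k * transition_product (l + d) (D - d) k j)"
        using d by (simp add: level_transition_def m sum_distrib_left mult_ac)
      also have "(\<Sum>k\<in>S. transition_product l d i k * transition_product (l + d) (D - d) k j) = transition_product l D i j"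
        using transition_product_add[OF assms, of l d "D - d"] d by simp
      finally show "(\<Sum>k\<in>S. level_transition \<nu> s (l, i) (l + d, k) * level_transition \<nu> t (l + d, k) (m, j)) =
        poisson_density (\<nu> * s) d * poisson_density (\<nu> * t) (D - d) * transition_product l D i j" .
    qed
    also have "\<dots> = poisson_density (\<nu> * (s + t)) D * transition_product l D i j"
      by (simp add: poisson_density_convolution flip: sum_distrib_right distrib_left)
    finally show ?thesis by (simp add: level_transition_def m)
  qed
qed

lemma level_transition_semigroup:
  assumes "0 \<le> \<nu>"
  shows "transition_semigroup (insert None (Some ` (UNIV \<times> S)))
    (\<lambda>t. with_cemetery 1 (UNIV \<times> S) (level_transition \<nu> t))"
proof (rule cemetery_semigroup)
  fix t :: real and x :: "nat \<times> 's" assume t: "0 \<le> t" and x: "x \<in> UNIV \<times> S"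
  then obtain l i where x: "x = (l, i)" and i: "i \<in> S" by auto
  note row = level_transition_row[OF assms t i, of l]
  show "level_transition \<nu> t x summable_on UNIV \<times> S"
    unfolding x using row by (auto simp: summable_on_def)
  have "0 \<le> \<nu> * t" using assms t by simp
  have "infsum (level_transition \<nu> t x) (UNIV \<times> S) =
      (\<Sum>\<^sub>\<infinity>d. poisson_density (\<nu> * t) d * (\<Sum>j\<in>S. transition_product l d i j))"
    unfolding x using row by (rule infsumI)
  also have "\<dots> \<le> 1"
    by (rule has_sum_mono[OF has_sum_infsum[OF row_sums_summable] poisson_density_sum])
      (use \<open>0 \<le> \<nu> * t\<close> i in \<open>auto intro!: mult_left_le transition_product_row poisson_density_nonneg\<close>)
  finally show "infsum (level_transition \<nu> t x) (UNIV \<times> S) \<le> 1" .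
next
  fix x y :: "nat \<times> 's" assume "x \<in> UNIV \<times> S" "y \<in> UNIV \<times> S"
  then show "level_transition \<nu> 0 x y = (if x = y then 1 else 0)"
    by (cases x; cases y) (auto simp: level_transition_def poisson_density_0)
qed (use assms level_transition_nonneg level_transition_chapman_kolmogorov in auto)

text \<open>
  The matrix \<open>block_intensity\<close> for states of an arbitrary type.
\<close>

definition level_intensity :: "nat \<Rightarrow> nat \<times> 's \<Rightarrow> nat \<times> 's \<Rightarrow> real" where
  "level_intensity n x y = (case (x, y) of ((l, i), (m, j)) \<Rightarrow>
     if m = l then (if i = j then - real n else 0)
     else if m = Suc l then real n * Q (Suc l) i j
     else 0)"

lemma level_intensity_sum:
  assumes "i \<in> S"
  shows "(level_intensity n (l, i) has_sum (- real n + real n * (\<Sum>j\<in>S. Q (Suc l) i j))) (UNIV \<times> S)"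
proof (rule has_sum_finite_neutralI[of "{l, Suc l} \<times> S"])
  have "(\<Sum>y\<in>{l, Suc l} \<times> S. level_intensity n (l, i) y) =
      (\<Sum>m\<in>{l, Suc l}. \<Sum>j\<in>S. level_intensity n (l, i) (m, j))"
    by (simp add: sum.cartesian_product case_prod_beta')
  also have "\<dots> = - real n + real n * (\<Sum>j\<in>S. Q (Suc l) i j)"
    using assms finite_states by (simp add: level_intensity_def sum_distrib_left)
  finally show "- real n + real n * (\<Sum>j\<in>S. Q (Suc l) i j) = (\<Sum>y\<in>{l, Suc l} \<times> S. level_intensity n (l, i) y)" ..
qed (use finite_states in \<open>auto simp: level_intensity_def split: if_splits\<close>)

lemma level_intensity_matrix: "intensity_matrix (UNIV \<times> S) (level_intensity n)"
  unfolding intensity_matrix_def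
proof (intro ballI conjI impI)
  fix x :: "nat \<times> 's" assume "x \<in> UNIV \<times> S"
  then obtain l i where x: "x = (l, i)" and i: "i \<in> S" by auto
  show "level_intensity n x x \<le> 0" by (simp add: x level_intensity_def)
  show "level_intensity n x summable_on UNIV \<times> S"
    using level_intensity_sum[OF i] x by (auto simp: summable_on_def)
  have "real n * (\<Sum>j\<in>S. Q (Suc l) i j) \<le> real n"
    using substochastic_sum[OF i, of l] by (intro mult_left_le) auto
  then show "(\<Sum>\<^sub>\<infinity>y\<in>UNIV \<times> S. level_intensity n x y) \<le> 0"
    using infsumI[OF level_intensity_sum[OF i, of n l]] x by simp
  fix y :: "nat \<times> 's" assume "y \<in> UNIV \<times> S" "y \<noteq> x"
  then show "0 \<le> level_intensity n x y"
    using i by (cases y) (auto simp: x level_intensity_def substochastic_nonneg)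
qed

lemma level_transition_derivative:
  "((\<lambda>h. (level_transition (real n) h (l, i) (m, j) - (if (l, i) = (m, j) then 1 else 0)) / h)
     \<longlongrightarrow> level_intensity n (l, i) (m, j)) (at_right 0)" if "i \<in> S"
proof -
  consider "m < l" | "m = l" | "m = Suc l" | e where "m = Suc (Suc (l + e))"
    by (metis Suc_lessI less_imp_Suc_add linorder_neqE_nat)
  then show ?thesis
  proof cases
    case 1
    then show ?thesis by (simp add: level_transition_def level_intensity_def)
  next
    case 2
    have "((\<lambda>h. (exp (- (real n * h)) - 1) / h) \<longlongrightarrow> - real n) (at_right 0)"
      by real_asymp
    then show ?thesis
      using 2 by (simp add: level_transition_def level_intensity_def poisson_density_def)
  next
    case 3
    have Q: "transition_product l 1 i j = Q (Suc l) i j"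
      using that finite_states by (simp add: if_distrib[where f = "\<lambda>x. x * _"] cong: if_cong)
    have "((\<lambda>h. real n * h * exp (- (real n * h)) / h) \<longlongrightarrow> real n) (at_right 0)"
      by real_asymp
    then have "((\<lambda>h. real n * h * exp (- (real n * h)) / h * Q (Suc l) i j) \<longlongrightarrow> real n * Q (Suc l) i j) (at_right 0)"
      by (intro tendsto_mult tendsto_const)
    moreover have "(level_transition (real n) h (l, i) (m, j) - (if (l, i) = (m, j) then 1 else 0)) / h =
        real n * h * exp (- (real n * h)) / h * Q (Suc l) i j" for h
      using 3 Q by (simp add: level_transition_def poisson_density_def)
    moreover have "level_intensity n (l, i) (m, j) = real n * Q (Suc l) i j"
      using 3 by (simp add: level_intensity_def)
    ultimately show ?thesis by (simp only:)
  next
    case 4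
    let ?c = "transition_product l (Suc (Suc e)) i j * real n ^ Suc (Suc e) / fact (Suc (Suc e))"
    have "((\<lambda>h. ?c * (h * h ^ e * exp (- (real n * h)))) \<longlongrightarrow> ?c * (0 * 0 ^ e * exp (- (real n * 0)))) (at_right 0)"
      by (intro tendsto_intros)
    moreover have "\<forall>\<^sub>F h in at_right 0. ?c * (h * h ^ e * exp (- (real n * h))) =
        (level_transition (real n) h (l, i) (m, j) - (if (l, i) = (m, j) then 1 else 0)) / h"
      using eventually_at_right_less[of "0::real"]
      by eventually_elim
        (simp add: 4 level_transition_def poisson_density_def power_mult_distrib del: transition_product.simps fact_Suc)
    ultimately show ?thesis
      using 4 by (simp add: level_intensity_def tendsto_cong del: transition_product.simps fact_Suc)
  qed
qed

text \<open>
  Write \<open>\<sigma> d\<close> for the probability to survive \<open>d\<close> steps. The probability to be dead at time \<open>h\<close> is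
  \<open>\<Sum>d. poisson_density (n h) d * (1 - \<sigma> d)\<close>. The term \<open>d = 0\<close> vanishes, the term \<open>d = 1\<close> gives the derivative, and the
  terms with \<open>d \<ge> 2\<close> are squeezed between \<open>0\<close> and the Poisson tail of order \<open>h\<^sup>2\<close>.
\<close>

lemma killing_derivative:
  assumes i: "i \<in> S"
  shows "((\<lambda>h. (1 - (\<Sum>\<^sub>\<infinity>y\<in>UNIV \<times> S. level_transition (real n) h (l, i) y)) / h)
     \<longlongrightarrow> real n - real n * (\<Sum>j\<in>S. Q (Suc l) i j)) (at_right 0)"
proof -
  define \<sigma> where "\<sigma> d = (\<Sum>j\<in>S. transition_product l d i j)" for d
  define R where "R h = (\<Sum>\<^sub>\<infinity>y\<in>UNIV \<times> S. level_transition (real n) h (l, i) y)" for h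
  have \<sigma>0: "\<sigma> 0 = 1" using i finite_states by (simp add: \<sigma>_def)
  have \<sigma>1: "\<sigma> 1 = (\<Sum>j\<in>S. Q (Suc l) i j)"
    using i finite_states by (simp add: \<sigma>_def if_distrib[where f = "\<lambda>x. x * _"] cong: if_cong)
  have \<sigma>_le: "\<sigma> d \<le> 1" and \<sigma>_nonneg: "0 \<le> \<sigma> d" for d
    using transition_product_row[OF i] i by (auto simp: \<sigma>_def intro!: sum_nonneg transition_product_nonneg)
  let ?p = "\<lambda>h. poisson_density (real n * h)"
  have bounds: "?p h 1 * (1 - \<sigma> 1) \<le> 1 - R h" "1 - R h \<le> 1 - ?p h 0 - ?p h 1 * \<sigma> 1" if "0 < h" for h
  proof -
    have nh: "0 \<le> real n * h" using that by simp
    have "(level_transition (real n) h (l, i) has_sum (\<Sum>\<^sub>\<infinity>d. ?p h d * \<sigma> d)) (UNIV \<times> S)"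
      unfolding \<sigma>_def using that i by (intro level_transition_row) auto
    then have R: "((\<lambda>d. ?p h d * \<sigma> d) has_sum R h) UNIV"
      unfolding R_def using row_sums_summable[OF nh i, of l] by (simp add: infsumI \<sigma>_def)
    then have "((\<lambda>d. - (?p h d * \<sigma> d)) has_sum - R h) UNIV" by (simp add: has_sum_uminus)
    from has_sum_add[OF poisson_density_sum[OF nh] this]
    have D: "((\<lambda>d. ?p h d * (1 - \<sigma> d)) has_sum 1 - R h) UNIV" by (simp add: algebra_simps)
    have "((\<lambda>d. ?p h d * (1 - \<sigma> d)) has_sum ?p h 1 * (1 - \<sigma> 1)) {1}" by (simp add: has_sum_finite_iff)
    from has_sum_mono2[OF this D] show "?p h 1 * (1 - \<sigma> 1) \<le> 1 - R h"
      using nh \<sigma>_le by (simp add: poisson_density_nonneg)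
    have "((\<lambda>d. ?p h d * \<sigma> d) has_sum ?p h 0 + ?p h 1 * \<sigma> 1) {0, 1}" by (simp add: has_sum_finite_iff \<sigma>0)
    from has_sum_mono2[OF this R] show "1 - R h \<le> 1 - ?p h 0 - ?p h 1 * \<sigma> 1"
      using nh \<sigma>_nonneg by (simp add: poisson_density_nonneg)
  qed
  have "((\<lambda>h. (1 - R h) / h) \<longlongrightarrow> real n * (1 - \<sigma> 1)) (at_right 0)"
  proof (rule tendsto_sandwich)
    show "\<forall>\<^sub>F h in at_right 0. real n * h * exp (- (real n * h)) / h * (1 - \<sigma> 1) \<le> (1 - R h) / h"
      using eventually_at_right_less[of "0::real"]
    proof eventually_elim
      case (elim h)
      then show ?case using divide_right_mono[OF bounds(1)[OF elim], of h] by (simp add: poisson_density_def)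
    qed
    show "\<forall>\<^sub>F h in at_right 0. (1 - R h) / h \<le> (1 - exp (- (real n * h))) / h - real n * h * exp (- (real n * h)) / h * \<sigma> 1"
      using eventually_at_right_less[of "0::real"]
    proof eventually_elim
      case (elim h)
      then show ?case using divide_right_mono[OF bounds(2)[OF elim], of h]
        by (simp add: poisson_density_def diff_divide_distrib)
    qed
    have e: "((\<lambda>h. real n * h * exp (- (real n * h)) / h) \<longlongrightarrow> real n) (at_right 0)"
      by real_asymp
    then show "((\<lambda>h. real n * h * exp (- (real n * h)) / h * (1 - \<sigma> 1)) \<longlongrightarrow> real n * (1 - \<sigma> 1)) (at_right 0)"
      by (intro tendsto_mult tendsto_const)
    have "((\<lambda>h. (1 - exp (- (real n * h))) / h) \<longlongrightarrow> real n) (at_right 0)"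
      by real_asymp
    then have "((\<lambda>h. (1 - exp (- (real n * h))) / h - real n * h * exp (- (real n * h)) / h * \<sigma> 1) \<longlongrightarrow> real n - real n * \<sigma> 1) (at_right 0)"
      by (intro tendsto_diff tendsto_mult tendsto_const e)
    then show "((\<lambda>h. (1 - exp (- (real n * h))) / h - real n * h * exp (- (real n * h)) / h * \<sigma> 1) \<longlongrightarrow> real n * (1 - \<sigma> 1)) (at_right 0)"
      by (simp add: algebra_simps)
  qed
  then show ?thesis unfolding R_def \<sigma>1 by (simp add: right_diff_distrib)
qed

lemma cemetery_derivative:
  assumes x: "x \<in> insert None (Some ` (UNIV \<times> S))"
  shows "((\<lambda>h. (with_cemetery 1 (UNIV \<times> S) (level_transition (real n) h) x y - (if x = y then 1 else 0)) / h)
     \<longlongrightarrow> with_cemetery 0 (UNIV \<times> S) (level_intensity n) x y) (at_right 0)"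
proof (cases x)
  case None
  then show ?thesis by (cases y) simp_all
next
  case (Some a)
  obtain l i where a: "a = (l, i)" by fastforce
  then have i: "i \<in> S" using x Some by auto
  show ?thesis
  proof (cases y)
    case None
    show ?thesis
      using killing_derivative[OF i, of n l] infsumI[OF level_intensity_sum[OF i, of n l]]
      by (simp add: None Some a)
  next
    case (Some b)
    obtain m j where "b = (m, j)" by fastforce
    then show ?thesis
      using level_transition_derivative[OF i, of n l m j] by (simp add: Some \<open>x = Some a\<close> a)
  qed
qed

end

section \<open>Killed chains run by a Poisson clock\<close>

text \<open>
  To the left of \<open>t\<close> a monotone path takes finitely many natural values, and from the time at which the
  largest of them is reached it is constant up to \<open>t\<close>.
\<close>

lemma counting_path_jump_path:
  assumes "counting_path f"
  shows "jump_path (\<lambda>t. h (f t))"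
proof -
  have mono: "mono_on {0..} f" and cont: "\<And>t. 0 \<le> t \<Longrightarrow> continuous (at_right t) f"
    using assms by (auto simp: counting_path_def)
  have right: "\<exists>e>0. \<forall>s\<in>{t..<t + e}. f s = f t" if "0 \<le> t" for t
  proof -
    have "(f \<longlongrightarrow> f t) (at_right t)" using cont[OF that] by (simp add: continuous_within)
    then have "\<forall>\<^sub>F s in at_right t. f s = f t" by (simp add: tendsto_discrete)
    then obtain b where b: "b > t" "\<And>s. t < s \<Longrightarrow> s < b \<Longrightarrow> f s = f t"
      unfolding eventually_at_right_field by auto
    have "f s = f t" if "s \<in> {t..<t + (b - t)}" for s
      using b(2)[of s] that by (cases "s = t") simp_all
    moreover have "0 < b - t" using b(1) by simp
    ultimately show ?thesis by blast
  qed
  have left: "\<exists>e>0. \<exists>x. \<forall>s\<in>{t - e<..<t} \<inter> {0..}. f s = x" if t: "0 < t" for t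
  proof -
    have fin: "finite (f ` {0..<t})"
      by (rule finite_subset[of _ "{..f t}"]) (use t in \<open>auto intro!: mono_onD[OF mono]\<close>)
    have "f ` {0..<t} \<noteq> {}" using t by auto
    from Max_in[OF fin this] obtain s0 where s0: "0 \<le> s0" "s0 < t" "Max (f ` {0..<t}) = f s0" by auto
    have "f s = f s0" if "s \<in> {t - (t - s0)<..<t} \<inter> {0..}" for s
    proof (rule antisym)
      show "f s \<le> f s0" using Max_ge[OF fin, of "f s"] that s0 by auto
      show "f s0 \<le> f s" using that s0 by (intro mono_onD[OF mono]) auto
    qed
    moreover have "0 < t - s0" using s0 by simp
    ultimately show ?thesis by blast
  qed
  show ?thesis
    unfolding jump_path_def
  proof (intro conjI allI impI)
    fix t :: real assume "0 \<le> t"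
    from right[OF this] show "\<exists>e>0. \<forall>s\<in>{t..<t + e}. h (f s) = h (f t)" by metis
  next
    fix t :: real assume "0 < t"
    from left[OF this] show "\<exists>e>0. \<exists>x. \<forall>s\<in>{t - e<..<t} \<inter> {0..}. h (f s) = x" by metis
  qed
qed

lemma jump_path_cong:
  assumes "\<And>t. 0 \<le> t \<Longrightarrow> f t = g t"
  shows "jump_path f \<longleftrightarrow> jump_path g"
proof -
  have "jump_path g" if "jump_path f" and fg: "\<And>t. 0 \<le> t \<Longrightarrow> f t = g t" for f g :: "real \<Rightarrow> 'a"
    unfolding jump_path_def
  proof (intro conjI allI impI)
    fix t :: real assume t: "0 \<le> t"
    with that(1) obtain e where e: "e > 0" "\<And>s. s \<in> {t..<t + e} \<Longrightarrow> f s = f t"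
      unfolding jump_path_def by blast
    have "g s = g t" if "s \<in> {t..<t + e}" for s
      using e(2)[OF that] fg[of s] fg[OF t] that t by simp
    with e(1) show "\<exists>e>0. \<forall>s\<in>{t..<t + e}. g s = g t" by blast
  next
    fix t :: real assume t: "0 < t"
    have "\<forall>t>0. \<exists>e>0. \<exists>x. \<forall>s\<in>{t - e<..<t} \<inter> {0..}. f s = x"
      using \<open>jump_path f\<close> unfolding jump_path_def by (rule conjunct2)
    from this[rule_format, OF t] obtain e where e: "0 < e" and "\<exists>x. \<forall>s\<in>{t - e<..<t} \<inter> {0..}. f s = x" by blast
    then obtain x where x: "\<forall>s\<in>{t - e<..<t} \<inter> {0..}. f s = x" by blast
    have "\<forall>s\<in>{t - e<..<t} \<inter> {0..}. g s = x"
      using x fg by simp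
    with e show "\<exists>e>0. \<exists>x. \<forall>s\<in>{t - e<..<t} \<inter> {0..}. g s = x" by blast
  qed
  from this[of f g] this[of g f] assms show ?thesis by metis
qed

text \<open>
  The chain and the clock are independent: they are measurable with respect to the independent
  \<open>\<sigma>\<close>-algebras \<open>G\<close> and \<open>H\<close>.
\<close>

locale clocked_chain = killed_chain P S Q Y \<mu>
  for P :: "'w measure" and S :: "'s set" and Q Y \<mu> +
  fixes n :: nat and M :: "real \<Rightarrow> 'w \<Rightarrow> nat" and G H :: "'w measure"
  assumes clock_path: "\<omega> \<in> space P \<Longrightarrow> counting_path (\<lambda>t. M t \<omega>)"
    and clock_increments: "poisson_increments P (real n) M"
    and subalgebras: "subalgebra P G" "subalgebra P H"
    and chain_measurable: "Y l \<in> G \<rightarrow>\<^sub>M count_space UNIV"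
    and clock_measurable: "0 \<le> t \<Longrightarrow> M t \<in> H \<rightarrow>\<^sub>M count_space UNIV"
    and independence: "A \<in> sets G \<Longrightarrow> B \<in> sets H \<Longrightarrow> prob (A \<inter> B) = prob A * prob B"
begin

definition level_process :: "real \<Rightarrow> 'w \<Rightarrow> (nat \<times> 's) option" where
  "level_process t \<omega> = map_option (Pair (M t \<omega>)) (Y (M t \<omega>) \<omega>)"

lemma clock_mono: "\<omega> \<in> space P \<Longrightarrow> mono_on {0..} (\<lambda>t. M t \<omega>)"
  and clock_start: "\<omega> \<in> space P \<Longrightarrow> M 0 \<omega> = 0"
  using clock_path by (auto simp: counting_path_def)

lemma level_process_measurable: "0 \<le> t \<Longrightarrow> level_process t \<in> P \<rightarrow>\<^sub>M count_space UNIV"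
proof -
  assume "0 \<le> t"
  then have M: "M t \<in> P \<rightarrow>\<^sub>M count_space UNIV"
    using measurable_from_subalg[OF subalgebras(2)] clock_measurable by blast
  show ?thesis
    unfolding level_process_def[abs_def]
    by (rule measurable_compose_countable[where f = "\<lambda>m \<omega>. map_option (Pair m) (Y m \<omega>)", OF _ M])
      (rule measurable_compose[OF measurable_chain], simp)
qed

lemma level_process_states: "\<omega> \<in> space P \<Longrightarrow> level_process t \<omega> \<in> insert None (Some ` (UNIV \<times> S))"
  using states[of \<omega> "M t \<omega>"] by (auto simp: level_process_def)

lemma level_process_absorbed:
  assumes w: "\<omega> \<in> space P" and "0 \<le> s" "s \<le> t" and "level_process s \<omega> = None"
  shows "level_process t \<omega> = None"
proof -
  have "M s \<omega> \<le> M t \<omega>" using assms by (intro mono_onD[OF clock_mono[OF w]]) auto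
  with assms absorbed[OF w, of "M s \<omega>"] show ?thesis by (auto simp: level_process_def)
qed

lemma times_nonneg:
  fixes t :: "nat \<Rightarrow> real"
  assumes "0 \<le> t 0" "\<forall>i\<le>k. t i < t (Suc i)"
  shows "i \<le> Suc k \<Longrightarrow> 0 \<le> t i" and "i \<le> j \<Longrightarrow> j \<le> Suc k \<Longrightarrow> t i \<le> t j"
proof -
  show *: "i \<le> j \<Longrightarrow> j \<le> Suc k \<Longrightarrow> t i \<le> t j" for i j
  proof (induction j rule: dec_induct)
    case (step j)
    then have "t i \<le> t j" "t j < t (Suc j)" using assms(2) by auto
    then show ?case by simp
  qed simp
  show "i \<le> Suc k \<Longrightarrow> 0 \<le> t i" using *[of 0 i] assms(1) by simp
qed

lemma level_event: "0 \<le> t \<Longrightarrow> {\<omega>\<in>space P. level_process t \<omega> = y} \<in> events"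
  using measurable_sets[OF level_process_measurable, of t "{y}"]
  by (simp add: vimage_def Int_def conj_commute)

lemma history_measurable:
  fixes t :: "nat \<Rightarrow> real"
  assumes "\<And>i. i \<le> k \<Longrightarrow> 0 \<le> t i"
  shows "{\<omega>\<in>space P. \<forall>i\<le>k. level_process (t i) \<omega> = x i} \<in> events"
proof -
  have "{\<omega>\<in>space P. level_process (t i) \<omega> = x i} \<in> events" if "i \<le> k" for i
    by (rule level_event[OF assms[OF that]])
  then have "{\<omega>\<in>space P. \<forall>i\<in>{..k}. level_process (t i) \<omega> = x i} \<in> events"
    by (intro sets.sets_Collect_finite_All) auto
  then show ?thesis by (simp only: Ball_def atMost_iff)
qed

lemma living_history:
  "level_process s \<omega> = Some z \<longleftrightarrow> M s \<omega> = fst z \<and> Y (fst z) \<omega> = Some (snd z)"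
  by (cases z) (auto simp: level_process_def)

text \<open>
  The process is alive in \<open>(l, j)\<close> exactly if the clock shows \<open>l\<close> and the chain is in \<open>j\<close> at time \<open>l\<close>. The event
  factorizes into one for the clock and one for the chain, and both satisfy a Markov property.
\<close>

lemma living_step:
  fixes t :: "nat \<Rightarrow> real"
  assumes t: "0 \<le> t 0" "\<forall>i\<le>k. t i < t (Suc i)"
    and z: "\<And>i. i \<le> Suc k \<Longrightarrow> z i \<in> UNIV \<times> S"
    and pos: "0 < prob {\<omega>\<in>space P. \<forall>i\<le>k. level_process (t i) \<omega> = Some (z i)}"
  shows "prob {\<omega>\<in>space P. \<forall>i\<le>Suc k. level_process (t i) \<omega> = Some (z i)} =
    prob {\<omega>\<in>space P. \<forall>i\<le>k. level_process (t i) \<omega> = Some (z i)} * level_transition (real n) (t (Suc k) - t k) (z k) (z (Suc k))"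
proof -
  define L J where "L i = fst (z i)" and "J i = snd (z i)" for i
  define A where "A m = {\<omega>\<in>space P. \<forall>i\<le>m. M (t i) \<omega> = L i}" for m
  define B where "B m = {\<omega>\<in>space P. \<forall>i\<le>m. Y (L i) \<omega> = Some (J i)}" for m
  have split: "{\<omega>\<in>space P. \<forall>i\<le>m. level_process (t i) \<omega> = Some (z i)} = B m \<inter> A m" for m
    by (auto simp: living_history A_def B_def L_def J_def)
  have sp: "space G = space P" "space H = space P" using subalgebras by (auto simp: subalgebra_def)
  have A: "A m \<in> sets H" if "m \<le> Suc k" for m
  proof -
    have "{\<omega>\<in>space H. M (t i) \<omega> = L i} \<in> sets H" if "i \<in> {..m}" for i
      using measurable_sets[OF clock_measurable, of "t i" "{L i}"] times_nonneg(1)[OF t, of i] that \<open>m \<le> Suc k\<close>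
      by (simp add: vimage_def Int_def conj_commute)
    then have "{\<omega>\<in>space H. \<forall>i\<in>{..m}. M (t i) \<omega> = L i} \<in> sets H"
      by (intro sets.sets_Collect_finite_All) auto
    then show ?thesis unfolding A_def by (simp only: Ball_def atMost_iff sp)
  qed
  have B: "B m \<in> sets G" for m
  proof -
    have "{\<omega>\<in>space G. Y (L i) \<omega> = Some (J i)} \<in> sets G" for i
      using measurable_sets[OF chain_measurable, of "{Some (J i)}" "L i"]
      by (simp add: vimage_def Int_def conj_commute)
    then have "{\<omega>\<in>space G. \<forall>i\<in>{..m}. Y (L i) \<omega> = Some (J i)} \<in> sets G"
      by (intro sets.sets_Collect_finite_All) auto
    then show ?thesis unfolding B_def by (simp only: Ball_def atMost_iff sp)
  qed
  obtain \<omega>0 where \<omega>0: "\<omega>0 \<in> B k \<inter> A k"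
    using pos unfolding split by (metis all_not_in_conv less_irrefl measure_empty)
  have L_le: "L i \<le> L k" if "i \<le> k" for i
  proof -
    have "M (t i) \<omega>0 \<le> M (t k) \<omega>0"
      using \<omega>0 times_nonneg[OF t] that by (intro mono_onD[OF clock_mono]) (auto simp: A_def)
    then show ?thesis using \<omega>0 that by (auto simp: A_def)
  qed
  have Js: "J i \<in> S" if "i \<le> Suc k" for i using z[OF that] by (auto simp: J_def)
  have probA: "prob (A (Suc k)) = (if L k \<le> L (Suc k) then prob (A k) * poisson_density (real n * (t (Suc k) - t k)) (L (Suc k) - L k) else 0)"
    unfolding A_def
    using t by (intro poisson_values_step[OF prob_space_axioms clock_increments clock_mono clock_start]) auto
  show ?thesis
  proof (cases "L k \<le> L (Suc k)")
    case False
    then have "prob (B (Suc k) \<inter> A (Suc k)) = 0"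
      using independence[OF B A, of "Suc k" "Suc k"] probA by simp
    then show ?thesis using False unfolding split by (simp add: level_transition_def L_def)
  next
    case True
    let ?G = "\<lambda>y. \<forall>i\<le>k. y (L i) = Some (J i)"
    have G: "?G y = ?G y'" if "\<And>m. m \<le> L k \<Longrightarrow> y m = y' m" for y y' :: "nat \<Rightarrow> 's option"
      using that L_le by auto
    have e: "{\<omega>\<in>space P. (\<forall>i\<le>k. Y (L i) \<omega> = Some (J i)) \<and> Y (L k) \<omega> = Some (J k) \<and> Y (L k + (L (Suc k) - L k)) \<omega> = Some (J (Suc k))} = B (Suc k)"
      "{\<omega>\<in>space P. (\<forall>i\<le>k. Y (L i) \<omega> = Some (J i)) \<and> Y (L k) \<omega> = Some (J k)} = B k"
      using True by (auto simp: B_def le_Suc_eq)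
    have "prob (B (Suc k)) = prob (B k) * transition_product (L k) (L (Suc k) - L k) (J k) (J (Suc k))"
      using multi_step[where G = ?G and l = "L k" and i = "J k" and j = "J (Suc k)" and d = "L (Suc k) - L k", OF G Js Js]
      unfolding e by simp
    then show ?thesis
      unfolding split using independence[OF B A, of "Suc k" "Suc k"] independence[OF B A, of k k] probA True
      by (simp add: level_transition_def L_def J_def)
  qed
qed

text \<open>
  Subtract the probabilities of all living states from the probability of the history.
\<close>

lemma killing_step:
  fixes t :: "nat \<Rightarrow> real"
  assumes t: "0 \<le> t 0" "\<forall>i\<le>k. t i < t (Suc i)"
    and z: "\<And>i. i \<le> k \<Longrightarrow> z i \<in> UNIV \<times> S"
    and pos: "0 < prob {\<omega>\<in>space P. \<forall>i\<le>k. level_process (t i) \<omega> = Some (z i)}"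
  shows "prob {\<omega>\<in>space P. (\<forall>i\<le>k. level_process (t i) \<omega> = Some (z i)) \<and> level_process (t (Suc k)) \<omega> = None} =
    prob {\<omega>\<in>space P. \<forall>i\<le>k. level_process (t i) \<omega> = Some (z i)} *
      (1 - (\<Sum>\<^sub>\<infinity>y\<in>UNIV \<times> S. level_transition (real n) (t (Suc k) - t k) (z k) y))"
proof -
  let ?E = "{\<omega>\<in>space P. \<forall>i\<le>k. level_process (t i) \<omega> = Some (z i)}"
  define D where "D y = ?E \<inter> {\<omega>\<in>space P. level_process (t (Suc k)) \<omega> = y}" for y
  have E: "?E \<in> events"
    by (rule history_measurable) (use times_nonneg(1)[OF t] in auto)
  have D: "D y \<in> events" for y
    unfolding D_def by (rule sets.Int[OF E level_event[OF times_nonneg(1)[OF t order_refl]]])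
  have disj: "D y \<inter> D y' = {}" if "y \<noteq> y'" for y y'
    using that by (auto simp: D_def)
  have living: "prob (D (Some y)) = prob ?E * level_transition (real n) (t (Suc k) - t k) (z k) y" if y: "y \<in> UNIV \<times> S" for y
  proof -
    let ?z = "z(Suc k := y)"
    have e: "{\<omega>\<in>space P. \<forall>i\<le>Suc k. level_process (t i) \<omega> = Some (?z i)} = D (Some y)"
      "{\<omega>\<in>space P. \<forall>i\<le>k. level_process (t i) \<omega> = Some (?z i)} = ?E"
      by (auto simp: D_def le_Suc_eq)
    have zS: "?z i \<in> UNIV \<times> S" if "i \<le> Suc k" for i
      using z[of i] y that by (cases "i = Suc k") simp_all
    from living_step[where z = ?z, OF t zS, unfolded e, OF _ pos] show ?thesis by simp
  qed
  let ?R = "\<Sum>\<^sub>\<infinity>y\<in>UNIV \<times> S. level_transition (real n) (t (Suc k) - t k) (z k) y"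
  obtain l i where zk: "z k = (l, i)" and i: "i \<in> S" using z[of k] by auto
  have "0 \<le> t (Suc k) - t k" using t by (simp add: less_imp_le)
  note row = level_transition_row[OF of_nat_0_le_iff this i, of n l]
  have "(level_transition (real n) (t (Suc k) - t k) (z k) has_sum ?R) (UNIV \<times> S)"
    unfolding zk by (rule has_sum_infsum[OF has_sum_imp_summable[OF row]])
  then have "((\<lambda>m. \<Sum>j\<in>S. level_transition (real n) (t (Suc k) - t k) (z k) (m, j)) has_sum ?R) UNIV"
    by (rule has_sum_SigmaD) (simp add: has_sum_finite_iff finite_states)
  then have sums1: "(\<lambda>m. \<Sum>j\<in>S. level_transition (real n) (t (Suc k) - t k) (z k) (m, j)) sums ?R"
    by (rule has_sum_imp_sums)
  have level: "prob (\<Union>j\<in>S. D (Some (m, j))) = prob ?E * (\<Sum>j\<in>S. level_transition (real n) (t (Suc k) - t k) (z k) (m, j))" for m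
  proof -
    have "prob (\<Union>j\<in>S. D (Some (m, j))) = (\<Sum>j\<in>S. prob (D (Some (m, j))))"
    proof (rule finite_measure_finite_Union[OF finite_states])
      show "(\<lambda>j. D (Some (m, j))) ` S \<subseteq> events" using D by (rule_tac image_subsetI)
      show "disjoint_family_on (\<lambda>j. D (Some (m, j))) S"
        unfolding disjoint_family_on_def by (intro ballI impI disj) simp
    qed
    also have "\<dots> = (\<Sum>j\<in>S. prob ?E * level_transition (real n) (t (Suc k) - t k) (z k) (m, j))"
      by (intro sum.cong refl living) simp
    finally show ?thesis by (simp only: sum_distrib_left)
  qed
  have "(\<lambda>m. prob (\<Union>j\<in>S. D (Some (m, j)))) sums prob (\<Union>m. \<Union>j\<in>S. D (Some (m, j)))"
  proof (rule finite_measure_UNION)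
    show "range (\<lambda>m. \<Union>j\<in>S. D (Some (m, j))) \<subseteq> events"
      using D finite_states by (intro image_subsetI sets.finite_UN)
    show "disjoint_family (\<lambda>m. \<Union>j\<in>S. D (Some (m, j)))"
      unfolding disjoint_family_on_def using disj by (intro ballI impI) (simp add: UN_extend_simps)
  qed
  then have eq: "prob (\<Union>m. \<Union>j\<in>S. D (Some (m, j))) = prob ?E * ?R"
    unfolding level using sums_mult[OF sums1, of "prob ?E"] sums_unique2 by blast
  have "?E = D None \<union> (\<Union>m. \<Union>j\<in>S. D (Some (m, j)))"
  proof (intro equalityI subsetI)
    fix \<omega> assume w: "\<omega> \<in> ?E"
    then have "level_process (t (Suc k)) \<omega> \<in> insert None (Some ` (UNIV \<times> S))"
      by (intro level_process_states) simp
    then show "\<omega> \<in> D None \<union> (\<Union>m. \<Union>j\<in>S. D (Some (m, j)))" using w by (auto simp: D_def)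
  qed (auto simp: D_def)
  then have "prob ?E = prob (D None \<union> (\<Union>m. \<Union>j\<in>S. D (Some (m, j))))" by (simp only:)
  also have "\<dots> = prob (D None) + prob (\<Union>m. \<Union>j\<in>S. D (Some (m, j)))"
  proof (rule finite_measure_Union)
    show "(\<Union>m. \<Union>j\<in>S. D (Some (m, j))) \<in> events"
      using D finite_states by (intro sets.countable_UN sets.finite_UN image_subsetI)
    show "D None \<inter> (\<Union>m. \<Union>j\<in>S. D (Some (m, j))) = {}"
      by (auto simp: D_def)
  qed (rule D)
  finally have "prob (D None) = prob ?E * (1 - ?R)" unfolding eq by (simp add: algebra_simps)
  moreover have "D None = {\<omega>\<in>space P. (\<forall>i\<le>k. level_process (t i) \<omega> = Some (z i)) \<and> level_process (t (Suc k)) \<omega> = None}"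
    by (auto simp: D_def)
  ultimately show ?thesis by simp
qed

text \<open>
  A history that ends in a living state has been living throughout, and then \<open>living_step\<close> and
  \<open>killing_step\<close> apply. A history that ends in the cemetery stays there.
\<close>

lemma markov_jump_process:
  "markov_jump_process P level_process (UNIV \<times> S) (\<lambda>x. if fst x = 0 then \<mu> (snd x) else 0) (level_intensity n)"
  unfolding markov_jump_process_def
proof (intro conjI allI impI ballI exI[where x = "\<lambda>t. with_cemetery 1 (UNIV \<times> S) (level_transition (real n) t)"])
  show "prob_space P" by (rule prob_space_axioms)
  show "level_process t \<in> P \<rightarrow>\<^sub>M count_space UNIV" if "0 \<le> t" for t
    using that by (rule level_process_measurable)
  show "jump_path (\<lambda>t. level_process t \<omega>)" if "\<omega> \<in> space P" for \<omega>
    unfolding level_process_def by (rule counting_path_jump_path[OF clock_path[OF that]])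
  show "AE \<omega> in P. level_process t \<omega> \<in> insert None (Some ` (UNIV \<times> S))" for t
    using level_process_states by (intro AE_I2) blast
  show "prob {\<omega>\<in>space P. level_process 0 \<omega> = Some x} = (if fst x = 0 then \<mu> (snd x) else 0)" if "x \<in> UNIV \<times> S" for x
  proof -
    have "{\<omega>\<in>space P. level_process 0 \<omega> = Some x} = (if fst x = 0 then {\<omega>\<in>space P. \<forall>k\<le>0. Y k \<omega> = Some (snd x)} else {})"
      using clock_start by (auto simp: living_history)
    then show ?thesis using path_law[of 0 "\<lambda>_. snd x"] that by auto
  qed
  show "intensity_matrix (UNIV \<times> S) (level_intensity n)" by (rule level_intensity_matrix)
  show "transition_semigroup (insert None (Some ` (UNIV \<times> S))) (\<lambda>t. with_cemetery 1 (UNIV \<times> S) (level_transition (real n) t))"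
    by (rule level_transition_semigroup) simp
  show "((\<lambda>h. (with_cemetery 1 (UNIV \<times> S) (level_transition (real n) h) x y - (if x = y then 1 else 0)) / h)
      \<longlongrightarrow> with_cemetery 0 (UNIV \<times> S) (level_intensity n) x y) (at_right 0)"
    if "x \<in> insert None (Some ` (UNIV \<times> S))" for x y
    by (rule cemetery_derivative[OF that])
  fix k and t :: "nat \<Rightarrow> real" and x :: "nat \<Rightarrow> (nat \<times> 's) option" and y :: "(nat \<times> 's) option"
  assume t: "0 \<le> t 0" "\<forall>i\<le>k. t i < t (Suc i)"
    and x: "\<forall>i\<le>k. x i \<in> insert None (Some ` (UNIV \<times> S))" and y: "y \<in> insert None (Some ` (UNIV \<times> S))"
    and pos: "0 < prob {\<omega>\<in>space P. \<forall>i\<le>k. level_process (t i) \<omega> = x i}"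
  let ?E = "{\<omega>\<in>space P. \<forall>i\<le>k. level_process (t i) \<omega> = x i}"
  let ?F = "{\<omega>\<in>space P. level_process (t (Suc k)) \<omega> = y \<and> (\<forall>i\<le>k. level_process (t i) \<omega> = x i)}"
  have absorb: "level_process (t j) \<omega> = None" if "\<omega> \<in> space P" "level_process (t i) \<omega> = None" "i \<le> j" "j \<le> Suc k" for i j \<omega>
    using level_process_absorbed[OF that(1) _ _ that(2)] times_nonneg(1)[OF t, of i] times_nonneg(2)[OF t, of i j] that(3,4) by simp
  have "prob ?F = prob ?E * with_cemetery 1 (UNIV \<times> S) (level_transition (real n) (t (Suc k) - t k)) (x k) y"
  proof (cases "x k")
    case None
    have F: "?F = (if y = None then ?E else {})"
      using absorb[of _ k "Suc k"] None by auto
    show ?thesis unfolding F None by (cases y) simp_all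
  next
    case (Some w)
    have "?E \<noteq> {}"
    proof
      assume "?E = {}"
      then show False using pos by (simp only: measure_empty less_irrefl)
    qed
    then obtain \<omega>0 where \<omega>0: "\<omega>0 \<in> ?E" by blast
    \<comment> \<open>The last state is living, hence so are all earlier ones.\<close>
    define z where "z = (\<lambda>i. the (x i))(Suc k := the y)"
    have xz: "x i = Some (z i)" if "i \<le> k" for i
      using absorb[of \<omega>0 i k] \<omega>0 that Some by (cases "x i") (auto simp: z_def)
    have zS: "z i \<in> UNIV \<times> S" if "i \<le> k" for i
      using x[rule_format, OF that] xz[OF that] by auto
    have E: "?E = {\<omega>\<in>space P. \<forall>i\<le>k. level_process (t i) \<omega> = Some (z i)}"
      using xz by auto
    have pos': "0 < prob {\<omega>\<in>space P. \<forall>i\<le>k. level_process (t i) \<omega> = Some (z i)}"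
      using pos unfolding E .
    show ?thesis
    proof (cases y)
      case None
      have "?F = {\<omega>\<in>space P. (\<forall>i\<le>k. level_process (t i) \<omega> = Some (z i)) \<and> level_process (t (Suc k)) \<omega> = None}"
        using xz None by auto
      then show ?thesis
        using killing_step[OF t zS pos'] unfolding E by (simp add: xz None)
    next
      case (Some v)
      have "?F = {\<omega>\<in>space P. \<forall>i\<le>Suc k. level_process (t i) \<omega> = Some (z i)}"
        using xz Some by (auto simp: le_Suc_eq z_def)
      moreover have "z i \<in> UNIV \<times> S" if "i \<le> Suc k" for i
        using that zS y Some by (cases "i = Suc k") (auto simp: z_def)
      moreover have "z (Suc k) = v" using Some by (simp add: z_def)
      ultimately show ?thesis
        using living_step[OF t _ pos'] unfolding E by (simp add: xz Some)
    qed
  qed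
  then show "\<P>(\<omega> in P. level_process (t (Suc k)) \<omega> = y \<bar> \<forall>i\<le>k. level_process (t i) \<omega> = x i) =
      with_cemetery 1 (UNIV \<times> S) (level_transition (real n) (t (Suc k) - t k)) (x k) y"
    unfolding cond_prob_def using pos by simp
qed

end

section \<open>The chain driven by thinned points\<close>

text \<open>
  The sampled chain as a function of the points \<open>t\<close> of the superposition, of the numbers \<open>c\<close> of points of the
  original process among them, and of the uniform variables. A point is one of the original process if
  \<open>c\<close> grows there, and \<open>u (c (Suc l))\<close> is then the variable that the original construction uses.
\<close>

primrec thinned_chain ::
  "nat \<Rightarrow> nat \<Rightarrow> (nat \<Rightarrow> real) \<Rightarrow> (nat \<Rightarrow> nat \<Rightarrow> real \<Rightarrow> real) \<Rightarrow>
   (nat \<Rightarrow> real) \<Rightarrow> (nat \<Rightarrow> nat) \<Rightarrow> (nat \<Rightarrow> real) \<Rightarrow> nat \<Rightarrow> nat option" where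
  "thinned_chain p lam0 \<alpha> \<Lambda> t c u 0 = select_state p \<alpha> (u 0)"
| "thinned_chain p lam0 \<alpha> \<Lambda> t c u (Suc l) =
     (case thinned_chain p lam0 \<alpha> \<Lambda> t c u l of
        None \<Rightarrow> None
      | Some i \<Rightarrow> if c (Suc l) = c l then Some i else select_state p
          (\<lambda>j. \<Lambda> i j (t (Suc l)) / real lam0 + (if i = j then 1 else 0)) (u (c (Suc l))))"

lemma thinned_chain_cong:
  "(\<And>k. k \<le> l \<Longrightarrow> c k = c' k) \<Longrightarrow> thinned_chain p lam0 \<alpha> \<Lambda> t c u l = thinned_chain p lam0 \<alpha> \<Lambda> t c' u l"
  by (induction l) (auto split: option.split)

lemma arrival_time_nonneg: "0 \<le> arrival_time X l \<omega>"
proof -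
  have "0 \<le> arrival X l \<omega>" unfolding arrival_def by (rule INF_greatest) simp
  then show ?thesis unfolding arrival_time_def by (rule real_of_ereal_pos)
qed

context
  fixes X Y :: "real \<Rightarrow> 'w \<Rightarrow> nat" and \<omega> :: 'w
  assumes paths: "counting_path (\<lambda>t. X t \<omega>)" "counting_path (\<lambda>t. Y t \<omega>)" "counting_path (\<lambda>t. X t \<omega> + Y t \<omega>)"
    and levels: "\<forall>l. \<exists>t\<in>\<rat> \<inter> {0..}. X t \<omega> + Y t \<omega> = l"
begin

private abbreviation "Z \<equiv> \<lambda>t \<omega>. X t \<omega> + Y t \<omega>"
private abbreviation "\<tau> \<equiv> \<lambda>l. arrival_time Z l \<omega>"

lemma arrival_total: "arrival Z l \<omega> = ereal (\<tau> l)"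
proof -
  obtain t where t: "0 \<le> t" "Z t \<omega> = l" using levels[rule_format, of l] by auto
  have "arrival Z l \<omega> \<le> ereal t"
    using arrival_le_iff[of Z \<omega> t l, OF paths(3) t(1)] t(2) by simp
  moreover have "0 \<le> arrival Z l \<omega>" unfolding arrival_def by (rule INF_greatest) simp
  ultimately show ?thesis
    unfolding arrival_time_def by (cases "arrival Z l \<omega>") auto
qed

lemma arrival_time_le_iff: "0 \<le> t \<Longrightarrow> \<tau> l \<le> t \<longleftrightarrow> l \<le> Z t \<omega>"
  using arrival_le_iff[of Z \<omega> t l, OF paths(3)] by (simp add: arrival_total)

text \<open>
  Here it matters that no level is skipped: with two simultaneous points the value would be larger.
\<close>

lemma total_at_arrival: "Z (\<tau> l) \<omega> = l"
proof (rule antisym)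
  obtain t where t: "0 \<le> t" "Z t \<omega> = l" using levels[rule_format, of l] by auto
  then have "\<tau> l \<le> t" using arrival_time_le_iff[of t l] by simp
  then have "Z (\<tau> l) \<omega> \<le> Z t \<omega>"
    using paths(3) arrival_time_nonneg[of Z l \<omega>] t(1) unfolding counting_path_def by (auto intro: mono_onD)
  then show "Z (\<tau> l) \<omega> \<le> l" using t(2) by simp
  show "l \<le> Z (\<tau> l) \<omega>" using arrival_time_le_iff[of "\<tau> l" l] arrival_time_nonneg[of Z l \<omega>] by simp
qed

lemma same_total:
  assumes "0 \<le> s" "s \<le> t" "Z s \<omega> = Z t \<omega>"
  shows "X s \<omega> = X t \<omega>"
proof -
  have "X s \<omega> \<le> X t \<omega>" "Y s \<omega> \<le> Y t \<omega>"
    using paths(1,2) assms unfolding counting_path_def by (auto intro: mono_onD)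
  then show ?thesis using assms(3) by simp
qed

lemma marked_count_eq: "marked_count X Y l \<omega> = X (\<tau> l) \<omega>"
  unfolding marked_count_def
proof (rule Least_equality)
  have eq: "X t \<omega> = X (\<tau> l) \<omega>" if "0 \<le> t" "Z t \<omega> = l" for t
    using same_total[of "\<tau> l" t] arrival_time_le_iff[of t l] total_at_arrival[of l] arrival_time_nonneg[of Z l \<omega>] that
    by simp
  obtain t where "t \<in> \<rat> \<inter> {0..}" "Z t \<omega> = l" using levels by blast
  then show "\<exists>t\<in>\<rat> \<inter> {0..}. X t \<omega> + Y t \<omega> = l \<and> X t \<omega> = X (\<tau> l) \<omega>" using eq by auto
  show "X (\<tau> l) \<omega> \<le> c" if "\<exists>t\<in>\<rat> \<inter> {0..}. X t \<omega> + Y t \<omega> = l \<and> X t \<omega> = c" for c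
    using that eq by auto
qed

lemma arrival_mono: "\<tau> l < \<tau> (Suc l)"
  using arrival_time_le_iff[of "\<tau> l" "Suc l"] total_at_arrival[of l] arrival_time_nonneg[of Z l \<omega>] by simp

lemma marked_count_0: "marked_count X Y 0 \<omega> = 0"
  using marked_count_eq[of 0] total_at_arrival[of 0] by simp

lemma marked_count_step:
  "marked_count X Y (Suc l) \<omega> = marked_count X Y l \<omega> \<or> marked_count X Y (Suc l) \<omega> = Suc (marked_count X Y l \<omega>)"
proof -
  have "X (\<tau> l) \<omega> \<le> X (\<tau> (Suc l)) \<omega>" "Y (\<tau> l) \<omega> \<le> Y (\<tau> (Suc l)) \<omega>"
    using paths(1,2) arrival_mono[of l] arrival_time_nonneg[of Z _ \<omega>] unfolding counting_path_def by (auto intro: mono_onD)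
  then show ?thesis
    using total_at_arrival[of l] total_at_arrival[of "Suc l"] unfolding marked_count_eq by linarith
qed

text \<open>
  A marked point of the total process is a point of \<open>X\<close>, with the index under which \<open>X\<close> itself counts it.
  Between two consecutive points of the total process, \<open>X\<close> cannot move.
\<close>

lemma marked_arrival:
  assumes jump: "X (\<tau> (Suc l)) \<omega> = Suc (X (\<tau> l) \<omega>)"
  shows "arrival_time X (Suc (X (\<tau> l) \<omega>)) \<omega> = \<tau> (Suc l)"
proof -
  have "arrival X (Suc (X (\<tau> l) \<omega>)) \<omega> = ereal (\<tau> (Suc l))"
  proof (rule antisym)
    show "arrival X (Suc (X (\<tau> l) \<omega>)) \<omega> \<le> ereal (\<tau> (Suc l))"
      using arrival_le_iff[of X \<omega> "\<tau> (Suc l)", OF paths(1) arrival_time_nonneg] jump by simp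
    show "ereal (\<tau> (Suc l)) \<le> arrival X (Suc (X (\<tau> l) \<omega>)) \<omega>"
      unfolding arrival_def
    proof (rule INF_greatest)
      fix s assume s: "s \<in> {t. 0 \<le> t \<and> Suc (X (\<tau> l) \<omega>) \<le> X t \<omega>}"
      have "\<not> s < \<tau> (Suc l)"
      proof
        assume less: "s < \<tau> (Suc l)"
        have gt: "\<tau> l < s"
        proof (rule ccontr)
          assume "\<not> \<tau> l < s"
          moreover have "mono_on {0..} (\<lambda>t. X t \<omega>)" using paths(1) by (simp add: counting_path_def)
          ultimately have "X s \<omega> \<le> X (\<tau> l) \<omega>"
            using mono_onD[of "{0..}" "\<lambda>t. X t \<omega>" s "\<tau> l"] s arrival_time_nonneg[of Z l \<omega>] by simp
          then show False using s by simp
        qed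
        then have "l \<le> Z s \<omega>" using arrival_time_le_iff[of s l] s by simp
        moreover have "\<not> Suc l \<le> Z s \<omega>" using arrival_time_le_iff[of s "Suc l"] s less by simp
        ultimately have "Z (\<tau> l) \<omega> = Z s \<omega>" using total_at_arrival[of l] by simp
        from same_total[OF arrival_time_nonneg _ this] gt show False using s by simp
      qed
      then show "ereal (\<tau> (Suc l)) \<le> ereal s" by simp
    qed
  qed
  then show ?thesis by (simp add: arrival_time_def)
qed

lemma embedded_chain_thinned:
  "embedded_chain p lam0 \<alpha> \<Lambda> (\<lambda>k. arrival_time X k \<omega>) u (X (\<tau> l) \<omega>) =
   thinned_chain p lam0 \<alpha> \<Lambda> \<tau> (\<lambda>k. marked_count X Y k \<omega>) u l"
proof (induction l)
  case 0
  then show ?case using marked_count_0 by (simp add: marked_count_eq)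
next
  case (Suc l)
  consider "X (\<tau> (Suc l)) \<omega> = X (\<tau> l) \<omega>" | "X (\<tau> (Suc l)) \<omega> = Suc (X (\<tau> l) \<omega>)"
    using marked_count_step[of l] unfolding marked_count_eq by blast
  then show ?case
  proof cases
    case 1
    then show ?thesis
      using Suc.IH by (simp add: marked_count_eq split: option.split)
  next
    case 2
    then show ?thesis
      using Suc.IH marked_arrival[OF 2] by (simp add: marked_count_eq split: option.split)
  qed
qed

end

lemma select_state_iff:
  assumes w: "\<And>j. j \<in> {1..p} \<Longrightarrow> 0 \<le> w j"
  shows "select_state p w u = Some k \<longleftrightarrow> k \<in> {1..p} \<and> (\<Sum>j\<in>{1..<k}. w j) \<le> u \<and> u < (\<Sum>j\<in>{1..k}. w j)"
proof -
  let ?R = "\<lambda>k. k \<in> {1..p} \<and> (\<Sum>j\<in>{1..<k}. w j) \<le> u \<and> u < (\<Sum>j\<in>{1..k}. w j)"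
  have less: False if "?R k" "?R m" "k < m" for k m
  proof -
    have "(\<Sum>j\<in>{1..k}. w j) \<le> (\<Sum>j\<in>{1..<m}. w j)"
      by (rule sum_mono2) (use that w in auto)
    then show False using that by linarith
  qed
  have unique: "k = m" if "?R k" "?R m" for k m
    using less[OF that] less[OF that(2,1)] by (rule_tac ccontr) (auto simp: neq_iff)
  have the: "(THE k. ?R k) = k" if "?R k" for k
    using that unique by (intro the_equality) blast+
  show ?thesis
    unfolding select_state_def using the by auto
qed

definition unit_uniform :: "real measure" where
  "unit_uniform = uniform_measure lborel {0<..<1}"

lemma select_state_probability:
  assumes w: "\<And>j. j \<in> {1..p} \<Longrightarrow> 0 \<le> w j" and total: "(\<Sum>j\<in>{1..p}. w j) \<le> 1" and k: "k \<in> {1..p}"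
  shows "{u. select_state p w u = Some k} \<in> sets borel"
    and "measure unit_uniform {u. select_state p w u = Some k} = w k"
proof -
  define a where "a = (\<Sum>j\<in>{1..<k}. w j)"
  have b: "(\<Sum>j\<in>{1..k}. w j) = a + w k"
  proof -
    have "{1..k} = insert k {1..<k}" using k by auto
    then show ?thesis by (simp add: a_def)
  qed
  have a: "0 \<le> a" unfolding a_def by (rule sum_nonneg) (use w k in auto)
  have "(\<Sum>j\<in>{1..k}. w j) \<le> (\<Sum>j\<in>{1..p}. w j)"
    by (rule sum_mono2) (use w k in auto)
  then have b1: "a + w k \<le> 1" using total b by simp
  have iff: "select_state p w u = Some k \<longleftrightarrow> a \<le> u \<and> u < a + w k" for u
  proof -
    have "select_state p w u = Some k \<longleftrightarrow> k \<in> {1..p} \<and> (\<Sum>j\<in>{1..<k}. w j) \<le> u \<and> u < (\<Sum>j\<in>{1..k}. w j)"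
      by (rule select_state_iff) (rule w)
    then show ?thesis unfolding b a_def[symmetric] using k by simp
  qed
  have eq: "{u. select_state p w u = Some k} = {a..<a + w k}"
    using iff by (simp add: set_eq_iff)
  then show "{u. select_state p w u = Some k} \<in> sets borel" by simp
  have wk: "0 \<le> w k" using w k by simp
  have "measure unit_uniform {a..<a + w k} = measure lborel ({0<..<1} \<inter> {a..<a + w k})"
    unfolding unit_uniform_def by (subst measure_uniform_measure) auto
  also have "{0<..<1} \<inter> {a..<a + w k} = (if a = 0 then {0<..<w k} else {a..<a + w k})"
    using a b1 by auto
  also have "measure lborel (if a = 0 then {0<..<w k} else {a..<a + w k}) = w k"
    using wk by simp
  finally show "measure unit_uniform {u. select_state p w u = Some k} = w k" unfolding eq .
qed

text \<open>
  What the rate of the uniformization has to satisfy: all matrices \<open>I + \<Lambda> / m\<close> with \<open>m \<ge> \<lambda>\<^sub>0\<close> are substochastic.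
\<close>

locale uniformizable =
  fixes p lam0 n :: nat and \<alpha> :: "nat \<Rightarrow> real" and \<Lambda> :: "nat \<Rightarrow> nat \<Rightarrow> real \<Rightarrow> real"
  assumes lam0: "0 < lam0" "lam0 \<le> n"
    and initial: "probability_vector p \<alpha>"
    and off_diagonal: "0 \<le> s \<Longrightarrow> i \<in> {1..p} \<Longrightarrow> j \<in> {1..p} \<Longrightarrow> i \<noteq> j \<Longrightarrow> 0 \<le> \<Lambda> i j s"
    and diagonal: "0 \<le> s \<Longrightarrow> i \<in> {1..p} \<Longrightarrow> - real lam0 \<le> \<Lambda> i i s"
    and row: "0 \<le> s \<Longrightarrow> i \<in> {1..p} \<Longrightarrow> (\<Sum>j\<in>{1..p}. \<Lambda> i j s) \<le> 0"
begin

definition jump_weight :: "real \<Rightarrow> nat \<Rightarrow> nat \<Rightarrow> real" where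
  "jump_weight s i j = \<Lambda> i j s / real lam0 + (if i = j then 1 else 0)"

lemma uniformized_stochastic:
  assumes "0 \<le> s" "i \<in> {1..p}" and m: "lam0 \<le> m"
  shows "j \<in> {1..p} \<Longrightarrow> 0 \<le> \<Lambda> i j s / real m + (if i = j then 1 else 0)"
    and "(\<Sum>j\<in>{1..p}. \<Lambda> i j s / real m + (if i = j then 1 else 0)) \<le> 1"
proof -
  have m0: "0 < real m" using lam0 m by simp
  show "0 \<le> \<Lambda> i j s / real m + (if i = j then 1 else 0)" if "j \<in> {1..p}" for j
  proof (cases "i = j")
    case True
    have "- real m \<le> \<Lambda> i i s" using diagonal[OF assms(1,2)] m by (simp add: order_trans[rotated])
    then show ?thesis using True m0 by (simp add: field_simps)
  next
    case False
    then show ?thesis using off_diagonal[OF assms(1,2) that] m0 by simp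
  qed
  have "(\<Sum>j\<in>{1..p}. \<Lambda> i j s / real m + (if i = j then 1 else 0)) = (\<Sum>j\<in>{1..p}. \<Lambda> i j s) / real m + 1"
    using assms(2) by (simp add: sum.distrib sum_divide_distrib)
  also have "\<dots> \<le> 1" using row[OF assms(1,2)] m0 by (simp add: divide_nonpos_pos)
  finally show "(\<Sum>j\<in>{1..p}. \<Lambda> i j s / real m + (if i = j then 1 else 0)) \<le> 1" .
qed

lemmas jump_weight_stochastic = uniformized_stochastic[OF _ _ order_refl, folded jump_weight_def]

lemma initial_stochastic: "j \<in> {1..p} \<Longrightarrow> 0 \<le> \<alpha> j" "(\<Sum>j\<in>{1..p}. \<alpha> j) \<le> 1"
  using initial by (auto simp: probability_vector_def)

abbreviation chain :: "(nat \<Rightarrow> real) \<Rightarrow> (nat \<Rightarrow> nat) \<Rightarrow> (nat \<Rightarrow> real) \<Rightarrow> nat \<Rightarrow> nat option" where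
  "chain \<equiv> thinned_chain p lam0 \<alpha> \<Lambda>"

lemma chain_states:
  assumes t: "\<And>l. 0 \<le> t l"
  shows "chain t c u l \<in> insert None (Some ` {1..p})"
proof (induction l)
  case 0
  have "select_state p \<alpha> (u 0) = Some k \<Longrightarrow> k \<in> {1..p}" for k
    using select_state_iff[where w = \<alpha> and p = p and u = "u 0" and k = k] initial_stochastic(1) by simp
  then show ?case by (cases "select_state p \<alpha> (u 0)") auto
next
  case (Suc l)
  show ?case
  proof (cases "chain t c u l")
    case (Some i)
    then have i: "i \<in> {1..p}" using Suc by auto
    let ?s = "select_state p (jump_weight (t (Suc l)) i) (u (c (Suc l)))"
    have "?s = Some k \<Longrightarrow> k \<in> {1..p}" for k
      using select_state_iff[where w = "jump_weight (t (Suc l)) i" and p = p and u = "u (c (Suc l))" and k = k]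
        jump_weight_stochastic(1)[OF t i] by simp
    then have "?s \<in> insert None (Some ` {1..p})" by (cases ?s) auto
    then show ?thesis using Some i by (auto simp: jump_weight_def[abs_def])
  qed simp
qed

text \<open>
  For a fixed sequence of marks each uniform variable is used at most once. Following a prescribed path
  therefore means that the variables lie in the sides \<open>D\<close> of a rectangle, with one factor in its
  probability for each variable that has been used.
\<close>

lemma walk_path_event:
  assumes t: "\<And>l. 0 \<le> t l" and y: "\<And>k. k \<le> l \<Longrightarrow> y k \<in> {1..p}"
    and c: "c 0 = 0" "\<And>k. k < l \<Longrightarrow> c (Suc k) = c k \<or> c (Suc k) = Suc (c k)"
  shows "\<exists>D. (\<forall>j. D j \<in> sets borel) \<and>
     (\<forall>u. (\<forall>k\<le>l. chain t c u k = Some (y k)) \<longleftrightarrow> (\<forall>j\<le>c l. u j \<in> D j)) \<and>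
     (\<Prod>j\<le>c l. measure unit_uniform (D j)) = \<alpha> (y 0) *
       (\<Prod>k<l. if c (Suc k) = c k then (if y k = y (Suc k) then 1 else 0) else jump_weight (t (Suc k)) (y k) (y (Suc k)))"
  using y c(2)
proof (induction l)
  case 0
  let ?D = "\<lambda>_. {u. select_state p \<alpha> u = Some (y 0)}"
  show ?case
    using select_state_probability[of p \<alpha> "y 0"] initial_stochastic 0 c(1)
    by (intro exI[of _ ?D]) simp
next
  case (Suc l)
  have "\<exists>D. (\<forall>j. D j \<in> sets borel) \<and>
     (\<forall>u. (\<forall>k\<le>l. chain t c u k = Some (y k)) \<longleftrightarrow> (\<forall>j\<le>c l. u j \<in> D j)) \<and>
     (\<Prod>j\<le>c l. measure unit_uniform (D j)) = \<alpha> (y 0) *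
       (\<Prod>k<l. if c (Suc k) = c k then (if y k = y (Suc k) then 1 else 0) else jump_weight (t (Suc k)) (y k) (y (Suc k)))"
    by (rule Suc.IH) (rule Suc.prems, simp)+
  then obtain D where D: "\<And>j. D j \<in> sets borel"
    and iff: "\<And>u. (\<forall>k\<le>l. chain t c u k = Some (y k)) \<longleftrightarrow> (\<forall>j\<le>c l. u j \<in> D j)"
    and prod: "(\<Prod>j\<le>c l. measure unit_uniform (D j)) = \<alpha> (y 0) *
       (\<Prod>k<l. if c (Suc k) = c k then (if y k = y (Suc k) then 1 else 0) else jump_weight (t (Suc k)) (y k) (y (Suc k)))"
    by blast
  have step: "(\<forall>k\<le>Suc l. chain t c u k = Some (y k)) \<longleftrightarrow> (\<forall>j\<le>c l. u j \<in> D j) \<and>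
      (if c (Suc l) = c l then y l = y (Suc l) else select_state p (jump_weight (t (Suc l)) (y l)) (u (c (Suc l))) = Some (y (Suc l)))" for u
  proof -
    have "(\<forall>k\<le>Suc l. chain t c u k = Some (y k)) \<longleftrightarrow> (\<forall>k\<le>l. chain t c u k = Some (y k)) \<and> chain t c u (Suc l) = Some (y (Suc l))"
      by (auto simp: le_Suc_eq simp del: thinned_chain.simps)
    moreover have "chain t c u (Suc l) = (if c (Suc l) = c l then Some (y l) else select_state p (jump_weight (t (Suc l)) (y l)) (u (c (Suc l))))"
      if "\<forall>k\<le>l. chain t c u k = Some (y k)"
      using that by (simp add: jump_weight_def[abs_def])
    ultimately show ?thesis using iff[of u] by auto
  qed
  consider (stay) "c (Suc l) = c l" "y l = y (Suc l)" | (blocked) "c (Suc l) = c l" "y l \<noteq> y (Suc l)" | (jump) "c (Suc l) = Suc (c l)"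
    using Suc.prems(2)[of l] by blast
  then show ?case
  proof cases
    case stay
    then show ?thesis using D step prod by (intro exI[of _ D]) simp
  next
    case blocked
    \<comment> \<open>The prescribed path moves at an unmarked point, so its event is empty: one empty side says so.\<close>
    have "(\<Prod>j\<le>c l. measure unit_uniform ((D(0 := {})) j)) = 0" by (intro prod_zero) auto
    then show ?thesis
      using D step blocked by (intro exI[of _ "D(0 := {})"]) auto
  next
    case jump
    let ?I = "{u. select_state p (jump_weight (t (Suc l)) (y l)) u = Some (y (Suc l))}"
    have yl: "y l \<in> {1..p}" "y (Suc l) \<in> {1..p}" using Suc.prems(1) by auto
    have sel: "?I \<in> sets borel" "measure unit_uniform ?I = jump_weight (t (Suc l)) (y l) (y (Suc l))"
      using select_state_probability[of p "jump_weight (t (Suc l)) (y l)" "y (Suc l)"]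
        jump_weight_stochastic[OF t yl(1)] yl(2) by blast+
    let ?D = "D(Suc (c l) := ?I)"
    have "(\<Prod>j\<le>Suc (c l). measure unit_uniform (?D j)) = (\<Prod>j\<le>c l. measure unit_uniform (D j)) * measure unit_uniform ?I"
      by (simp add: prod.atMost_Suc)
    moreover have "(\<forall>j\<le>Suc (c l). u j \<in> ?D j) \<longleftrightarrow> (\<forall>j\<le>c l. u j \<in> D j) \<and> u (Suc (c l)) \<in> ?I" for u
      by (auto simp: le_Suc_eq)
    ultimately show ?thesis
      using D step prod sel jump by (intro exI[of _ ?D]) simp
  qed
qed

end

context uniformizable
begin

text \<open>
  Avoids dealing with the cemetery separately.
\<close>

lemma measurable_into_option:
  assumes "\<And>x. x \<in> space M \<Longrightarrow> f x \<in> insert None (Some ` {1..p})"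
    and "\<And>k. k \<in> {1..p} \<Longrightarrow> {x\<in>space M. f x = Some k} \<in> sets M"
  shows "f \<in> M \<rightarrow>\<^sub>M count_space (insert None (Some ` {1..p}))"
proof -
  have "f -` {a} \<inter> space M \<in> sets M" if a: "a \<in> insert None (Some ` {1..p})" for a
  proof (cases a)
    case None
    have "f -` {a} \<inter> space M = space M - (\<Union>k\<in>{1..p}. {x\<in>space M. f x = Some k})"
      using assms(1) None by fastforce
    then show ?thesis using assms(2) by auto
  next
    case (Some k)
    then have "f -` {a} \<inter> space M = {x\<in>space M. f x = Some k}" by auto
    then show ?thesis using assms(2)[of k] a Some by auto
  qed
  then show ?thesis
    using assms(1) by (subst measurable_count_space_eq2) auto
qed

text \<open>
  Measurability in the points of the superposition and in the noise together. It is what allows to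
  freeze the points.
\<close>

lemma chain_measurable:
  assumes T: "\<And>l. (\<lambda>x. T x l) \<in> M \<rightarrow>\<^sub>M restrict_space borel {0..}"
    and C: "\<And>l. C l \<in> M \<rightarrow>\<^sub>M count_space UNIV" and U: "\<And>l. U l \<in> borel_measurable M"
    and \<Lambda>: "\<And>i j. i \<in> {1..p} \<Longrightarrow> j \<in> {1..p} \<Longrightarrow> \<Lambda> i j \<in> borel_measurable (restrict_space borel {0..})"
  shows "(\<lambda>x. chain (T x) (\<lambda>l. C l x) (\<lambda>l. U l x) l) \<in> M \<rightarrow>\<^sub>M count_space (insert None (Some ` {1..p}))"
proof -
  have T_nonneg: "0 \<le> T x l" if "x \<in> space M" for x l
    using measurable_space[OF T that] by (simp add: space_restrict_space)
  have states: "chain (T x) (\<lambda>l. C l x) (\<lambda>l. U l x) l \<in> insert None (Some ` {1..p})" if "x \<in> space M" for x l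
    using T_nonneg[OF that] by (rule chain_states)
  have UC: "(\<lambda>x. U (C l x) x) \<in> borel_measurable M" for l
    by (rule measurable_compose_countable[OF U C])
  show ?thesis
  proof (induction l)
    case 0
    show ?case
    proof (rule measurable_into_option[OF states])
      fix k assume k: "k \<in> {1..p}"
      have "{u. select_state p \<alpha> u = Some k} \<in> sets borel"
        using select_state_probability(1)[of p \<alpha> k] initial_stochastic k by blast
      from measurable_sets[OF U[of 0] this]
      show "{x\<in>space M. chain (T x) (\<lambda>l. C l x) (\<lambda>l. U l x) 0 = Some k} \<in> sets M"
        by (simp add: vimage_def Int_def conj_commute)
    qed
  next
    case (Suc l)
    let ?w = "\<lambda>i x. jump_weight (T x (Suc l)) i"
    have step: "(\<lambda>x. select_state p (?w i x) (U (C (Suc l) x) x)) \<in> M \<rightarrow>\<^sub>M count_space (insert None (Some ` {1..p}))"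
      if i: "i \<in> {1..p}" for i
    proof (rule measurable_into_option)
      have iff: "select_state p (?w i x) u = Some k \<longleftrightarrow> k \<in> {1..p} \<and> (\<Sum>j\<in>{1..<k}. ?w i x j) \<le> u \<and> u < (\<Sum>j\<in>{1..k}. ?w i x j)"
        if "x \<in> space M" for x u k
        using jump_weight_stochastic(1)[OF T_nonneg[OF that] i] by (rule select_state_iff)
      show "select_state p (?w i x) (U (C (Suc l) x) x) \<in> insert None (Some ` {1..p})" if "x \<in> space M" for x
        using iff[OF that] by (cases "select_state p (?w i x) (U (C (Suc l) x) x)") auto
      fix k assume k: "k \<in> {1..p}"
      have w: "(\<lambda>x. ?w i x j) \<in> borel_measurable M" if "j \<in> {1..p}" for j
        unfolding jump_weight_def using measurable_compose[OF T \<Lambda>[OF i that]] by simp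
      have [measurable]: "(\<lambda>x. \<Sum>j\<in>{1..<k}. ?w i x j) \<in> borel_measurable M" "(\<lambda>x. \<Sum>j\<in>{1..k}. ?w i x j) \<in> borel_measurable M"
        using w k by (auto intro!: borel_measurable_sum)
      note UC[measurable]
      have "{x\<in>space M. select_state p (?w i x) (U (C (Suc l) x) x) = Some k} =
         {x\<in>space M. (\<Sum>j\<in>{1..<k}. ?w i x j) \<le> U (C (Suc l) x) x \<and> U (C (Suc l) x) x < (\<Sum>j\<in>{1..k}. ?w i x j)}"
        using iff k by auto
      also have "\<dots> \<in> sets M" by measurable
      finally show "{x\<in>space M. select_state p (?w i x) (U (C (Suc l) x) x) = Some k} \<in> sets M" .
    qed
    let ?g = "\<lambda>v x. case v of None \<Rightarrow> None | Some i \<Rightarrow> if C (Suc l) x = C l x then Some i else select_state p (?w i x) (U (C (Suc l) x) x)"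
    have "?g v \<in> M \<rightarrow>\<^sub>M count_space (insert None (Some ` {1..p}))" if "v \<in> insert None (Some ` {1..p})" for v
    proof (cases v)
      case (Some i)
      then have i: "i \<in> {1..p}" using that by auto
      have "(\<lambda>x. C (Suc l) x = C l x) \<in> M \<rightarrow>\<^sub>M count_space UNIV"
        by (rule measurable_count_pair[where h = "(=)", OF C C]) simp
      then have "{x\<in>space M. C (Suc l) x = C l x} \<in> sets M" by (simp add: pred_def)
      then show ?thesis
        using step[OF i] i Some by (auto intro!: measurable_If)
    qed simp
    then have "(\<lambda>x. ?g (chain (T x) (\<lambda>l. C l x) (\<lambda>l. U l x) l) x) \<in> M \<rightarrow>\<^sub>M count_space (insert None (Some ` {1..p}))"
      by (rule measurable_compose_countable'[OF _ Suc.IH]) (auto intro: countable_finite)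
    also have "(\<lambda>x. ?g (chain (T x) (\<lambda>l. C l x) (\<lambda>l. U l x) l) x) = (\<lambda>x. chain (T x) (\<lambda>l. C l x) (\<lambda>l. U l x) (Suc l))"
      unfolding thinned_chain.simps jump_weight_def ..
    finally show ?case .
  qed
qed

end

text \<open>
  The law of the marks is expressed by prescribing the walk \<open>C\<close> that counts them. By \<open>walk_steps\<close> every walk is
  almost surely of the form \<open>heads b\<close>.
\<close>

locale driven_chain = uniformizable p lam0 n \<alpha> \<Lambda> + prob_space P
  for p lam0 n \<alpha> \<Lambda> and P :: "'w measure" +
  fixes C :: "nat \<Rightarrow> 'w \<Rightarrow> nat" and U :: "nat \<Rightarrow> 'w \<Rightarrow> real"
  assumes intensity_measurable: "i \<in> {1..p} \<Longrightarrow> j \<in> {1..p} \<Longrightarrow> \<Lambda> i j \<in> borel_measurable (restrict_space borel {0..})"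
    and walk_measurable: "C l \<in> P \<rightarrow>\<^sub>M count_space UNIV"
    and uniform_measurable: "U l \<in> borel_measurable P"
    and walk_steps: "AE \<omega> in P. C 0 \<omega> = 0 \<and> (\<forall>l. C (Suc l) \<omega> = C l \<omega> \<or> C (Suc l) \<omega> = Suc (C l \<omega>))"
    and walk_law: "prob {\<omega>\<in>space P. \<forall>k\<le>l. C k \<omega> = heads b k} = (\<Prod>k<l. pmf (bernoulli_pmf (real lam0 / real n)) (b k))"
    and walk_uniform: "(\<And>j. D j \<in> sets borel) \<Longrightarrow>
      prob ({\<omega>\<in>space P. \<forall>k\<le>l. C k \<omega> = heads b k} \<inter> {\<omega>\<in>space P. \<forall>j\<le>m. U j \<omega> \<in> D j}) =
      prob {\<omega>\<in>space P. \<forall>k\<le>l. C k \<omega> = heads b k} * (\<Prod>j\<le>m. measure unit_uniform (D j))"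
begin

abbreviation driven :: "(nat \<Rightarrow> real) \<Rightarrow> nat \<Rightarrow> 'w \<Rightarrow> nat option" where
  "driven t l \<omega> \<equiv> chain t (\<lambda>k. C k \<omega>) (\<lambda>k. U k \<omega>) l"

definition step :: "(nat \<Rightarrow> real) \<Rightarrow> nat \<Rightarrow> nat \<Rightarrow> nat \<Rightarrow> real" where
  "step t l i j = (if i = j then 1 else 0) + \<Lambda> i j (t l) / real n"

text \<open>
  Staying with probability \<open>1 - q\<close> and using \<open>I + \<Lambda> / \<lambda>\<^sub>0\<close> with probability \<open>q = \<lambda>\<^sub>0 / n\<close> averages to \<open>I + \<Lambda> / n\<close>.
\<close>

lemma step_mixture:
  "(\<Sum>v\<in>UNIV. pmf (bernoulli_pmf (real lam0 / real n)) v * (if v then jump_weight (t l) i j else if i = j then 1 else 0)) = step t l i j"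
proof -
  have q: "0 \<le> real lam0 / real n" "real lam0 / real n \<le> 1" using lam0 by (auto simp: field_simps)
  have "real lam0 / real n * jump_weight (t l) i j + (1 - real lam0 / real n) * (if i = j then 1 else 0) = step t l i j"
    using lam0 by (simp add: jump_weight_def step_def field_simps)
  then show ?thesis using q by (simp add: UNIV_bool add.commute)
qed

lemma driven_measurable:
  assumes "\<And>l. 0 \<le> t l"
  shows "driven t l \<in> P \<rightarrow>\<^sub>M count_space UNIV"
proof -
  have "driven t l \<in> P \<rightarrow>\<^sub>M count_space (insert None (Some ` {1..p}))"
  proof (rule chain_measurable[OF _ walk_measurable uniform_measurable intensity_measurable])
    show "(\<lambda>_. t l) \<in> P \<rightarrow>\<^sub>M restrict_space borel {0..}" for l
      using assms by (intro measurable_const) (simp add: space_restrict_space)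
  qed
  from measurable_compose[OF this, of "\<lambda>x. x"] show ?thesis by simp
qed

text \<open>
  Split according to the marks \<open>b\<close> of the first \<open>l\<close> points. Given the marks, the path has a product
  probability by \<open>walk_path_event\<close>, and the marks have one, too. A sum over all \<open>b\<close> of products over the
  steps is a product over the steps of sums over a single mark, which are computed by \<open>step_mixture\<close>.
\<close>

lemma driven_path_law:
  assumes t: "\<And>l. 0 \<le> t l" and y: "\<And>k. k \<le> l \<Longrightarrow> y k \<in> {1..p}"
  shows "prob {\<omega>\<in>space P. \<forall>k\<le>l. driven t k \<omega> = Some (y k)} = \<alpha> (y 0) * (\<Prod>k<l. step t (Suc k) (y k) (y (Suc k)))"
proof -
  let ?E = "{\<omega>\<in>space P. \<forall>k\<le>l. driven t k \<omega> = Some (y k)}"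
  let ?W = "\<lambda>b. {\<omega>\<in>space P. \<forall>k\<le>l. C k \<omega> = heads b k}"
  let ?I = "PiE {..<l} (\<lambda>_. UNIV :: bool set)"
  let ?w = "\<lambda>k v. if v then jump_weight (t (Suc k)) (y k) (y (Suc k)) else if y k = y (Suc k) then 1 else 0"
  have E: "?E \<in> events"
  proof -
    have "{\<omega>\<in>space P. driven t k \<omega> = Some (y k)} \<in> events" for k
      using measurable_sets[OF driven_measurable[of t k], of "{Some (y k)}"] t by (simp add: vimage_def Int_def conj_commute)
    then have "{\<omega>\<in>space P. \<forall>k\<in>{..l}. driven t k \<omega> = Some (y k)} \<in> events"
      by (intro sets.sets_Collect_finite_All) simp_all
    then show ?thesis by (simp only: Ball_def atMost_iff)
  qed
  have W: "?W b \<in> events" for b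
  proof -
    have "{\<omega>\<in>space P. C k \<omega> = heads b k} \<in> events" for k
      using measurable_sets[OF walk_measurable[of k], of "{heads b k}"] by (simp add: vimage_def Int_def conj_commute)
    then have "{\<omega>\<in>space P. \<forall>k\<in>{..l}. C k \<omega> = heads b k} \<in> events"
      by (intro sets.sets_Collect_finite_All) simp_all
    then show ?thesis by (simp only: Ball_def atMost_iff)
  qed
  have fin: "finite ?I" by (intro finite_PiE) auto
  have part: "prob (?E \<inter> ?W b) = \<alpha> (y 0) * (\<Prod>k<l. pmf (bernoulli_pmf (real lam0 / real n)) (b k) * ?w k (b k))" for b
  proof -
    have steps: "heads b 0 = 0" "heads b (Suc k) = heads b k \<or> heads b (Suc k) = Suc (heads b k)" for k
      by (auto simp: heads_Suc)
    obtain D where D: "\<And>j. D j \<in> sets borel"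
      and iff: "\<And>u. (\<forall>k\<le>l. chain t (heads b) u k = Some (y k)) \<longleftrightarrow> (\<forall>j\<le>heads b l. u j \<in> D j)"
      and prod: "(\<Prod>j\<le>heads b l. measure unit_uniform (D j)) = \<alpha> (y 0) *
         (\<Prod>k<l. if heads b (Suc k) = heads b k then (if y k = y (Suc k) then 1 else 0) else jump_weight (t (Suc k)) (y k) (y (Suc k)))"
      using walk_path_event[of t l y "heads b"] t y steps by blast
    have "?E \<inter> ?W b = ?W b \<inter> {\<omega>\<in>space P. \<forall>j\<le>heads b l. U j \<omega> \<in> D j}"
    proof (rule set_eqI)
      fix \<omega>
      have "driven t k \<omega> = chain t (heads b) (\<lambda>k. U k \<omega>) k" if "\<omega> \<in> ?W b" "k \<le> l" for k
        by (rule thinned_chain_cong) (use that in simp)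
      then show "\<omega> \<in> ?E \<inter> ?W b \<longleftrightarrow> \<omega> \<in> ?W b \<inter> {\<omega>\<in>space P. \<forall>j\<le>heads b l. U j \<omega> \<in> D j}"
        using iff[of "\<lambda>k. U k \<omega>"] by auto
    qed
    then have "prob (?E \<inter> ?W b) = prob (?W b) * (\<Prod>j\<le>heads b l. measure unit_uniform (D j))"
      using walk_uniform[OF D] by (simp only:)
    also have "(\<Prod>j\<le>heads b l. measure unit_uniform (D j)) = \<alpha> (y 0) * (\<Prod>k<l. ?w k (b k))"
      unfolding prod by (intro arg_cong2[where f = "(*)"] prod.cong refl) (simp add: heads_Suc)
    finally show ?thesis by (simp add: walk_law prod.distrib)
  qed
  have "prob ?E = prob (\<Union>b\<in>?I. ?E \<inter> ?W b)"
  proof (rule finite_measure_eq_AE)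
    show "AE \<omega> in P. \<omega> \<in> ?E \<longleftrightarrow> \<omega> \<in> (\<Union>b\<in>?I. ?E \<inter> ?W b)"
      using walk_steps
    proof (rule AE_mp, intro AE_I2 impI)
      fix \<omega> assume w: "\<omega> \<in> space P" and steps: "C 0 \<omega> = 0 \<and> (\<forall>l. C (Suc l) \<omega> = C l \<omega> \<or> C (Suc l) \<omega> = Suc (C l \<omega>))"
      \<comment> \<open>The marks are recovered from the walk.\<close>
      define b where "b = restrict (\<lambda>k. C (Suc k) \<omega> \<noteq> C k \<omega>) {..<l}"
      have "C k \<omega> = heads b k" if "k \<le> l" for k
        using that
      proof (induction k)
        case (Suc k)
        moreover have "b k \<longleftrightarrow> C (Suc k) \<omega> \<noteq> C k \<omega>" using Suc.prems by (simp add: b_def)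
        ultimately show ?case using steps[THEN conjunct2, rule_format, of k] by (auto simp: heads_Suc)
      qed (use steps in simp)
      then have "\<omega> \<in> ?W b" using w by simp
      moreover have "b \<in> ?I" by (simp add: b_def)
      ultimately show "\<omega> \<in> ?E \<longleftrightarrow> \<omega> \<in> (\<Union>b\<in>?I. ?E \<inter> ?W b)" by blast
    qed
    show "(\<Union>b\<in>?I. ?E \<inter> ?W b) \<in> events" using fin E W by (intro sets.finite_UN sets.Int)
  qed (rule E)
  also have "\<dots> = (\<Sum>b\<in>?I. prob (?E \<inter> ?W b))"
  proof (rule finite_measure_finite_Union[OF fin])
    show "(\<lambda>b. ?E \<inter> ?W b) ` ?I \<subseteq> events" using E W by (intro image_subsetI sets.Int)
    show "disjoint_family_on (\<lambda>b. ?E \<inter> ?W b) ?I"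
      unfolding disjoint_family_on_def
    proof (intro ballI impI)
      fix b b' assume b: "b \<in> ?I" "b' \<in> ?I" "b \<noteq> b'"
      then obtain k where k: "k < l" "b k \<noteq> b' k" using PiE_ext[OF b(1,2)] by auto
      have False if "\<forall>k\<le>l. C k \<omega> = heads b k" "\<forall>k\<le>l. C k \<omega> = heads b' k" for \<omega>
      proof -
        have "heads b (Suc k) = heads b' (Suc k)" "heads b k = heads b' k"
          using that k(1) by (metis Suc_leI less_imp_le)+
        then show False using k(2) by (auto simp: heads_Suc split: if_splits)
      qed
      then show "(?E \<inter> ?W b) \<inter> (?E \<inter> ?W b') = {}" by blast
    qed
  qed
  also have "\<dots> = \<alpha> (y 0) * (\<Sum>b\<in>?I. \<Prod>k<l. pmf (bernoulli_pmf (real lam0 / real n)) (b k) * ?w k (b k))"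
    unfolding part by (simp add: sum_distrib_left)
  also have "(\<Sum>b\<in>?I. \<Prod>k<l. pmf (bernoulli_pmf (real lam0 / real n)) (b k) * ?w k (b k)) =
      (\<Prod>k<l. \<Sum>v\<in>UNIV. pmf (bernoulli_pmf (real lam0 / real n)) v * ?w k v)"
    by (rule prod_sum_PiE[symmetric]) auto
  also have "\<dots> = (\<Prod>k<l. step t (Suc k) (y k) (y (Suc k)))"
    by (intro prod.cong refl step_mixture)
  finally show ?thesis .
qed

end

section \<open>Independent sources\<close>

definition generated_algebra :: "'w measure \<Rightarrow> ('i \<Rightarrow> 'w set set) \<Rightarrow> 'i set \<Rightarrow> 'w measure" where
  "generated_algebra P E I = sigma (space P) (\<Union>i\<in>I. E i)"

lemma space_generated_algebra [simp]: "space (generated_algebra P E I) = space P"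
  by (simp add: generated_algebra_def space_measure_of_conv)

lemma sets_generated_algebra:
  assumes "\<And>i. i \<in> I \<Longrightarrow> E i \<subseteq> sets P"
  shows "sets (generated_algebra P E I) = sigma_sets (space P) (\<Union>i\<in>I. E i)"
proof -
  have "(\<Union>i\<in>I. E i) \<subseteq> Pow (space P)" using assms sets.space_closed[of P] by blast
  then show ?thesis unfolding generated_algebra_def by (rule sets_measure_of)
qed

lemma subalgebra_generated:
  assumes "\<And>i. i \<in> I \<Longrightarrow> E i \<subseteq> sets P"
  shows "subalgebra P (generated_algebra P E I)"
proof -
  have "sets (generated_algebra P E I) = sigma_sets (space P) (\<Union>i\<in>I. E i)"
    by (rule sets_generated_algebra) (rule assms)
  moreover have "sigma_sets (space P) (\<Union>i\<in>I. E i) \<subseteq> sets P"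
    by (rule sets.sigma_sets_subset) (use assms in blast)
  ultimately show ?thesis by (simp add: subalgebra_def)
qed

lemma generated_algebra_mono:
  assumes "\<And>i. i \<in> I \<Longrightarrow> E i \<subseteq> sets P" and "I' \<subseteq> I"
  shows "subalgebra (generated_algebra P E I) (generated_algebra P E I')"
proof -
  have "sets (generated_algebra P E I) = sigma_sets (space P) (\<Union>i\<in>I. E i)"
    by (rule sets_generated_algebra) (rule assms(1))
  moreover have "sets (generated_algebra P E I') = sigma_sets (space P) (\<Union>i\<in>I'. E i)"
    by (rule sets_generated_algebra) (use assms in blast)
  moreover have "sigma_sets (space P) (\<Union>i\<in>I'. E i) \<subseteq> sigma_sets (space P) (\<Union>i\<in>I. E i)"
    by (rule sigma_sets_mono') (use assms(2) in blast)
  ultimately show ?thesis by (simp add: subalgebra_def)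
qed

lemma (in prob_space) independent_generated:
  assumes indep: "indep_sets E K" and stable: "\<And>i. i \<in> K \<Longrightarrow> Int_stable (E i)"
    and I: "I1 \<subseteq> K" "I2 \<subseteq> K" "I1 \<inter> I2 = {}"
    and A: "A \<in> sets (generated_algebra M E I1)" and B: "B \<in> sets (generated_algebra M E I2)"
  shows "prob (A \<inter> B) = prob A * prob B"
proof -
  have ev: "E i \<subseteq> events" if "i \<in> K" for i using indep that by (auto simp: indep_sets_def)
  let ?I = "\<lambda>b. if b then I1 else I2"
  have "indep_sets (\<lambda>j. sigma_sets (space M) (\<Union>i\<in>?I j. E i)) UNIV"
  proof (rule indep_sets_collect_sigma)
    show "indep_sets E (\<Union>j\<in>UNIV. ?I j)"
      by (rule indep_sets_mono_index[OF _ indep]) (use I in \<open>auto split: if_splits\<close>)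
    show "Int_stable (E i)" if "i \<in> ?I j" for i j using that I by (intro stable) (auto split: if_splits)
    show "disjoint_family_on ?I UNIV" using I(3) by (auto simp: disjoint_family_on_def)
  qed
  then have "prob (\<Inter>j\<in>UNIV. if j then A else B) = (\<Prod>j\<in>UNIV. prob (if j then A else B))"
  proof (rule indep_setsD)
    have "sets (generated_algebra M E I1) = sigma_sets (space M) (\<Union>i\<in>I1. E i)"
      "sets (generated_algebra M E I2) = sigma_sets (space M) (\<Union>i\<in>I2. E i)"
      by (rule sets_generated_algebra, use ev I in blast)+
    then show "\<forall>j\<in>UNIV. (if j then A else B) \<in> sigma_sets (space M) (\<Union>i\<in>?I j. E i)"
      using A B by simp
  qed auto
  then show ?thesis by (simp add: UNIV_bool Int_commute mult.commute)
qed

text \<open>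
  Refines an independent family: if two subfamilies of one member are independent of each other, they may
  take its place as separate members.
\<close>

lemma (in prob_space) indep_sets_split:
  assumes indep: "indep_sets E J" and a: "a \<in> J" and b: "b \<notin> J"
    and sub: "E1 \<subseteq> E a" "E2 \<subseteq> E a"
    and inter: "\<And>A B. A \<in> E1 \<Longrightarrow> B \<in> E2 \<Longrightarrow> A \<inter> B \<in> E a \<and> prob (A \<inter> B) = prob A * prob B"
  shows "indep_sets (E(a := E1, b := E2)) (insert b J)"
proof (rule indep_setsI)
  have ev: "E i \<subseteq> events" if "i \<in> J" for i using indep that by (auto simp: indep_sets_def)
  have ab: "a \<noteq> b" using a b by auto
  fix i assume "i \<in> insert b J"
  then show "(E(a := E1, b := E2)) i \<subseteq> events" using sub ev a by (auto split: if_splits)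
next
  have ab: "a \<noteq> b" using a b by auto
  fix A L assume L: "L \<noteq> {}" "L \<subseteq> insert b J" "finite L" and A: "\<forall>j\<in>L. A j \<in> (E(a := E1, b := E2)) j"
  show "prob (\<Inter>j\<in>L. A j) = (\<Prod>j\<in>L. prob (A j))"
  proof (cases "b \<in> L")
    case False
    have "A j \<in> E j" if "j \<in> L" for j
      using A[rule_format, OF that] sub False that by (cases "j = a"; cases "j = b") auto
    then have "\<forall>j\<in>L. A j \<in> E j" by blast
    then show ?thesis using indep_setsD[OF indep, of L A] L False by auto
  next
    case b: True
    have Ab: "A b \<in> E2" using A b by auto
    define K where "K = L - {a, b}"
    have K: "finite K" "K \<subseteq> J" "a \<notin> K" "b \<notin> K" using L by (auto simp: K_def)
    have AK: "\<forall>j\<in>K. A j \<in> E j"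
    proof
      fix j assume "j \<in> K"
      then have "j \<in> L" "j \<noteq> a" "j \<noteq> b" by (auto simp: K_def)
      then show "A j \<in> E j" using A[rule_format, of j] by simp
    qed
    have extend: "prob (B \<inter> (\<Inter>j\<in>K. A j)) = prob B * (\<Prod>j\<in>K. prob (A j))" if "B \<in> E a" for B
    proof -
      let ?A = "A(a := B)"
      have "prob (\<Inter>j\<in>insert a K. ?A j) = (\<Prod>j\<in>insert a K. prob (?A j))"
        by (rule indep_setsD[OF indep]) (use that K AK a in auto)
      moreover have "(\<Inter>j\<in>insert a K. ?A j) = B \<inter> (\<Inter>j\<in>K. A j)" using K(3) by auto
      moreover have "(\<Prod>j\<in>insert a K. prob (?A j)) = prob B * (\<Prod>j\<in>K. prob (A j))"
        using K(1,3) by (simp cong: prod.cong) (rule disjI2, rule prod.cong, auto)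
      ultimately show ?thesis by simp
    qed
    show ?thesis
    proof (cases "a \<in> L")
      case True
      then have Aa: "A a \<in> E1" using A ab by auto
      have "L = insert a (insert b K)" using True b by (auto simp: K_def)
      then have "(\<Inter>j\<in>L. A j) = (A a \<inter> A b) \<inter> (\<Inter>j\<in>K. A j)" "(\<Prod>j\<in>L. prob (A j)) = prob (A a) * prob (A b) * (\<Prod>j\<in>K. prob (A j))"
        using K ab by auto
      then show ?thesis using extend[of "A a \<inter> A b"] inter[OF Aa Ab] by simp
    next
      case False
      have "L = insert b K" using False b by (auto simp: K_def)
      then have "(\<Inter>j\<in>L. A j) = A b \<inter> (\<Inter>j\<in>K. A j)" "(\<Prod>j\<in>L. prob (A j)) = prob (A b) * (\<Prod>j\<in>K. prob (A j))"
        using K by auto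
      then show ?thesis using extend[of "A b"] Ab sub by auto
    qed
  qed
qed

lemma space_process_algebra [simp]: "space (process_algebra P X) = space P"
  by (simp add: process_algebra_def)

lemma process_algebra_measurable: "0 \<le> t \<Longrightarrow> X t \<in> process_algebra P X \<rightarrow>\<^sub>M count_space UNIV"
proof -
  assume t: "0 \<le> t"
  have "(\<lambda>\<omega>. \<lambda>t\<in>{0..}. X t \<omega>) \<in> process_algebra P X \<rightarrow>\<^sub>M PiM {0..} (\<lambda>_. count_space UNIV)"
    unfolding process_algebra_def by (rule measurable_vimage_algebra1) (auto simp: space_PiM)
  from measurable_compose[OF this measurable_component_singleton[of t]] t show ?thesis by simp
qed

lemma process_algebra_least:
  assumes "space G = space P" and "\<And>t. 0 \<le> t \<Longrightarrow> X t \<in> G \<rightarrow>\<^sub>M count_space UNIV"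
  shows "sets (process_algebra P X) \<subseteq> sets G"
proof
  fix A assume "A \<in> sets (process_algebra P X)"
  then obtain A' where "A' \<in> sets (PiM {0..} (\<lambda>_. count_space UNIV))" "A = (\<lambda>\<omega>. \<lambda>t\<in>{0..}. X t \<omega>) -` A' \<inter> space P"
    unfolding process_algebra_def by (subst (asm) sets_vimage_algebra2) (auto simp: space_PiM)
  moreover have "(\<lambda>\<omega>. \<lambda>t\<in>{0..}. X t \<omega>) \<in> G \<rightarrow>\<^sub>M PiM {0..} (\<lambda>_. count_space UNIV)"
    using assms(2) by (intro measurable_restrict) simp
  ultimately show "A \<in> sets G" using measurable_sets[of _ G _ A'] assms(1) by metis
qed

lemma Int_stable_sets: "Int_stable (sets M)"
  by (auto simp: Int_stable_def)

lemma counting_path_add: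
  assumes "counting_path f" "counting_path g"
  shows "counting_path (\<lambda>t. f t + g t)"
  unfolding counting_path_def
proof (intro conjI allI impI)
  show "f 0 + g 0 = 0" using assms by (simp add: counting_path_def)
  show "mono_on {0..} (\<lambda>t. f t + g t)" using assms by (auto simp: counting_path_def mono_on_def intro!: add_mono)
  show "continuous (at_right t) (\<lambda>t. f t + g t)" if "0 \<le> t" for t
    using assms that by (intro continuous_add) (auto simp: counting_path_def)
qed

text \<open>
  Induction on the number of superposed processes. At each step the processes that have been added so far
  and the next one are measurable with respect to disjoint groups of the independent family \<open>E\<close>.
\<close>

lemma (in prob_space) superposition_poisson:
  fixes X0 :: "real \<Rightarrow> 'a \<Rightarrow> nat" and E :: "'i \<Rightarrow> 'a set set"
  assumes indep: "indep_sets E K" and stable: "\<And>i. i \<in> K \<Longrightarrow> Int_stable (E i)"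
    and I0: "I0 \<subseteq> K" "I0 \<inter> h ` {lam0 + 1..} = {}" and h: "inj h" "h ` {lam0 + 1..} \<subseteq> K"
    and X0: "poisson_increments M r X0" "\<And>\<omega>. \<omega> \<in> space M \<Longrightarrow> counting_path (\<lambda>t. X0 t \<omega>)"
      "\<And>t. 0 \<le> t \<Longrightarrow> X0 t \<in> generated_algebra M E I0 \<rightarrow>\<^sub>M count_space UNIV"
    and Xh: "\<And>k. lam0 + 1 \<le> k \<Longrightarrow> poisson_increments M 1 (Xh k)"
      "\<And>k \<omega>. lam0 + 1 \<le> k \<Longrightarrow> \<omega> \<in> space M \<Longrightarrow> counting_path (\<lambda>t. Xh k t \<omega>)"
      "\<And>k t. lam0 + 1 \<le> k \<Longrightarrow> 0 \<le> t \<Longrightarrow> Xh k t \<in> generated_algebra M E {h k} \<rightarrow>\<^sub>M count_space UNIV"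
    and m: "lam0 \<le> m"
  shows "poisson_increments M (r + real (m - lam0)) (superposition lam0 m X0 Xh)"
    and "\<And>\<omega>. \<omega> \<in> space M \<Longrightarrow> counting_path (\<lambda>t. superposition lam0 m X0 Xh t \<omega>)"
    and "\<And>t. 0 \<le> t \<Longrightarrow> superposition lam0 m X0 Xh t \<in> generated_algebra M E (I0 \<union> h ` {lam0 + 1..m}) \<rightarrow>\<^sub>M count_space UNIV"
proof -
  have ev: "E i \<subseteq> events" if "i \<in> K" for i using indep that by (auto simp: indep_sets_def)
  let ?I = "\<lambda>m. I0 \<union> h ` {lam0 + 1..m}"
  have IK: "?I m \<subseteq> K" for m using I0 h by auto
  have evI: "E i \<subseteq> events" if "i \<in> ?I m" for i m using ev IK that by blast
  have "poisson_increments M (r + real (m - lam0)) (superposition lam0 m X0 Xh) \<and>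
    (\<forall>\<omega>\<in>space M. counting_path (\<lambda>t. superposition lam0 m X0 Xh t \<omega>)) \<and>
    (\<forall>t\<ge>0. superposition lam0 m X0 Xh t \<in> generated_algebra M E (?I m) \<rightarrow>\<^sub>M count_space UNIV)"
    using m
  proof (induction m rule: dec_induct)
    case base
    have "superposition lam0 lam0 X0 Xh = X0" by (simp add: superposition_def fun_eq_iff)
    then show ?case using X0 by simp
  next
    case (step m)
    let ?S = "superposition lam0 m X0 Xh"
    have S: "poisson_increments M (r + real (m - lam0)) ?S" "\<And>\<omega>. \<omega> \<in> space M \<Longrightarrow> counting_path (\<lambda>t. ?S t \<omega>)"
      "\<And>t. 0 \<le> t \<Longrightarrow> ?S t \<in> generated_algebra M E (?I m) \<rightarrow>\<^sub>M count_space UNIV" using step.IH by auto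
    have m1: "lam0 + 1 \<le> Suc m" using step.hyps by simp
    have Suc: "superposition lam0 (Suc m) X0 Xh = (\<lambda>t \<omega>. ?S t \<omega> + Xh (Suc m) t \<omega>)"
    proof -
      have "{lam0 + 1..Suc m} = insert (Suc m) {lam0 + 1..m}" using m1 by auto
      then show ?thesis by (simp add: superposition_def fun_eq_iff)
    qed
    have disjoint: "?I m \<inter> {h (Suc m)} = {}"
      using I0(2) h(1) m1 by (auto dest: injD)
    have hK: "{h (Suc m)} \<subseteq> K" using h(2) m1 by auto
    have "poisson_increments M (r + real (m - lam0) + 1) (\<lambda>t \<omega>. ?S t \<omega> + Xh (Suc m) t \<omega>)"
    proof (rule poisson_increments_add[OF prob_space_axioms S(1) Xh(1)[OF m1]])
      show "mono_on {0..} (\<lambda>t. ?S t \<omega>)" "mono_on {0..} (\<lambda>t. Xh (Suc m) t \<omega>)" if "\<omega> \<in> space M" for \<omega>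
        using S(2)[OF that] Xh(2)[OF m1 that] by (auto simp: counting_path_def)
      show "?S t \<in> generated_algebra M E (?I m) \<rightarrow>\<^sub>M count_space UNIV" if "0 \<le> t" for t by (rule S(3)[OF that])
      show "Xh (Suc m) t \<in> generated_algebra M E {h (Suc m)} \<rightarrow>\<^sub>M count_space UNIV" if "0 \<le> t" for t by (rule Xh(3)[OF m1 that])
      show "subalgebra M (generated_algebra M E (?I m))" by (rule subalgebra_generated) (rule evI)
      show "subalgebra M (generated_algebra M E {h (Suc m)})" by (rule subalgebra_generated) (use ev hK in blast)
      show "prob (A \<inter> B) = prob A * prob B" if "A \<in> sets (generated_algebra M E (?I m))" "B \<in> sets (generated_algebra M E {h (Suc m)})" for A B
        by (rule independent_generated[OF indep stable IK hK disjoint that])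
    qed
    then have "poisson_increments M (r + real (Suc m - lam0)) (\<lambda>t \<omega>. ?S t \<omega> + Xh (Suc m) t \<omega>)"
      using step.hyps by (simp add: Suc_diff_le add.assoc add.commute[of 1])
    moreover have "counting_path (\<lambda>t. ?S t \<omega> + Xh (Suc m) t \<omega>)" if "\<omega> \<in> space M" for \<omega>
      by (rule counting_path_add[OF S(2)[OF that] Xh(2)[OF m1 that]])
    moreover have "(\<lambda>\<omega>. ?S t \<omega> + Xh (Suc m) t \<omega>) \<in> generated_algebra M E (?I (Suc m)) \<rightarrow>\<^sub>M count_space UNIV" if t: "0 \<le> t" for t
    proof -
      have "subalgebra (generated_algebra M E (?I (Suc m))) (generated_algebra M E (?I m))"
        by (rule generated_algebra_mono) (use evI in auto)
      from measurable_from_subalg[OF this S(3)[OF t]]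
      have [measurable]: "?S t \<in> generated_algebra M E (?I (Suc m)) \<rightarrow>\<^sub>M count_space UNIV" .
      have "subalgebra (generated_algebra M E (?I (Suc m))) (generated_algebra M E {h (Suc m)})"
        by (rule generated_algebra_mono) (use evI m1 in auto)
      from measurable_from_subalg[OF this Xh(3)[OF m1 t]]
      have [measurable]: "Xh (Suc m) t \<in> generated_algebra M E (?I (Suc m)) \<rightarrow>\<^sub>M count_space UNIV" .
      show ?thesis by measurable
    qed
    ultimately show ?case unfolding Suc by blast
  qed
  then show "poisson_increments M (r + real (m - lam0)) (superposition lam0 m X0 Xh)"
    and "\<And>\<omega>. \<omega> \<in> space M \<Longrightarrow> counting_path (\<lambda>t. superposition lam0 m X0 Xh t \<omega>)"
    and "\<And>t. 0 \<le> t \<Longrightarrow> superposition lam0 m X0 Xh t \<in> generated_algebra M E (?I m) \<rightarrow>\<^sub>M count_space UNIV" by auto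
qed

section \<open>Laws on path spaces\<close>

lemma measure_distr_Collect:
  assumes "f \<in> P \<rightarrow>\<^sub>M E" "{y\<in>space E. \<phi> y} \<in> sets E"
  shows "\<P>(y in distr P E f. \<phi> y) = \<P>(\<omega> in P. \<phi> (f \<omega>))"
  using assms measurable_space[OF assms(1)]
  by (auto simp: measure_distr intro!: arg_cong[where f = "measure P"])

lemma cond_prob_distr:
  assumes "f \<in> P \<rightarrow>\<^sub>M E" "{y\<in>space E. \<phi> y} \<in> sets E" "{y\<in>space E. \<psi> y} \<in> sets E"
  shows "\<P>(y in distr P E f. \<phi> y \<bar> \<psi> y) = \<P>(\<omega> in P. \<phi> (f \<omega>) \<bar> \<psi> (f \<omega>))"
proof -
  have "{y\<in>space E. \<phi> y \<and> \<psi> y} \<in> sets E" by (intro sets.sets_Collect_conj assms)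
  then show ?thesis
    unfolding cond_prob_def using measure_distr_Collect[OF assms(1)] assms(3) by simp
qed

lemma space_sequence_space [simp]: "space sequence_space = UNIV"
  by (simp add: sequence_space_def space_PiM)

lemma sequence_space_component: "(\<lambda>y. y l) \<in> sequence_space \<rightarrow>\<^sub>M count_space UNIV"
  unfolding sequence_space_def by (rule measurable_component_singleton) simp

lemma sequence_space_event: "{y \<in> space sequence_space. R (y l)} \<in> sets sequence_space"
  using measurable_sets[OF sequence_space_component, of "Collect R" l] by (simp add: vimage_def)

lemma sequence_space_history: "{y \<in> space sequence_space. \<forall>k<l. y k = x k} \<in> sets sequence_space"
proof -
  have "{y \<in> space sequence_space. \<forall>k\<in>{..<l}. y k = x k} \<in> sets sequence_space"
    by (intro sets.sets_Collect_finite_All sequence_space_event) simp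
  then show ?thesis by (simp only: Ball_def lessThan_iff)
qed

lemma markov_chain_distr:
  assumes Y: "(\<lambda>\<omega> l. Y l \<omega>) \<in> P \<rightarrow>\<^sub>M sequence_space" and chain: "markov_chain P Y S \<mu> Q"
  shows "markov_chain (distr P sequence_space (\<lambda>\<omega> l. Y l \<omega>)) (\<lambda>l y. y l) S \<mu> Q"
proof -
  let ?R = "distr P sequence_space (\<lambda>\<omega> l. Y l \<omega>)"
  interpret prob_space P using chain by (simp add: markov_chain_def)
  show ?thesis
    unfolding markov_chain_def
  proof (intro conjI allI impI ballI)
    show "prob_space ?R" by (rule prob_space_distr[OF Y])
    show "(\<lambda>y. y l) \<in> ?R \<rightarrow>\<^sub>M count_space UNIV" for l
      using sequence_space_component by simp
    show "AE y in ?R. y l \<in> insert None (Some ` S)" for l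
      using chain unfolding AE_distr_iff[OF Y sequence_space_event[where R = "\<lambda>a. a \<in> insert None (Some ` S)"]]
      by (simp only: markov_chain_def)
    show "measure ?R {y\<in>space ?R. y 0 = Some x} = \<mu> x" if "x \<in> S" for x
      using measure_distr_Collect[OF Y sequence_space_event, of "\<lambda>a. a = Some x" 0] chain that
      by (simp add: markov_chain_def)
    show "substochastic_matrix S (Q l)" if "1 \<le> l" for l
      using chain that by (simp add: markov_chain_def)
    fix l x y
    assume l: "1 \<le> l" and x: "\<forall>k<l. x k \<in> insert None (Some ` S)" and y: "y \<in> insert None (Some ` S)"
      and pos: "0 < measure ?R {z\<in>space ?R. \<forall>k<l. z k = x k}"
    have "0 < prob {\<omega>\<in>space P. \<forall>k<l. Y k \<omega> = x k}"
      using pos unfolding measure_distr_Collect[OF Y sequence_space_history] .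
    moreover have "\<forall>l\<ge>1. \<forall>x y. (\<forall>k<l. x k \<in> insert None (Some ` S)) \<longrightarrow> y \<in> insert None (Some ` S) \<longrightarrow>
        \<P>(\<omega> in P. \<forall>k<l. Y k \<omega> = x k) > 0 \<longrightarrow>
        \<P>(\<omega> in P. Y l \<omega> = y \<bar> \<forall>k<l. Y k \<omega> = x k) = with_cemetery 1 S (Q l) (x (l - 1)) y"
      using chain unfolding markov_chain_def by (elim conjE) assumption
    ultimately have "\<P>(\<omega> in P. Y l \<omega> = y \<bar> \<forall>k<l. Y k \<omega> = x k) = with_cemetery 1 S (Q l) (x (l - 1)) y"
      using l x y by blast
    then show "\<P>(z in ?R. z l = y \<bar> \<forall>k<l. z k = x k) = with_cemetery 1 S (Q l) (x (l - 1)) y"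
      unfolding cond_prob_distr[OF Y sequence_space_event[where R = "\<lambda>a. a = y"] sequence_space_history] .
  qed
qed

text \<open>
  The transfer of the jump process to its canonical version. At nonnegative times the coordinates are
  measurable on the space of jump paths, and all conditions on a jump process concern such times.
\<close>

lemma jump_path_component: "0 \<le> t \<Longrightarrow> (\<lambda>f. f t) \<in> jump_path_space \<rightarrow>\<^sub>M count_space UNIV"
  unfolding jump_path_space_def by (rule measurable_restrict_space1, rule measurable_component_singleton) simp

lemma jump_path_event: "0 \<le> t \<Longrightarrow> {f \<in> space jump_path_space. R (f t)} \<in> sets jump_path_space"
  using measurable_sets[OF jump_path_component, of t "Collect R"] by (simp add: vimage_def Int_def conj_commute)

lemma jump_path_history:
  fixes t :: "nat \<Rightarrow> real"
  assumes "\<And>i. i \<le> k \<Longrightarrow> 0 \<le> t i"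
  shows "{f \<in> space jump_path_space. \<forall>i\<le>k. f (t i) = x i} \<in> sets jump_path_space"
proof -
  have "{f \<in> space jump_path_space. \<forall>i\<in>{..k}. f (t i) = x i} \<in> sets jump_path_space"
    by (intro sets.sets_Collect_finite_All jump_path_event assms) simp_all
  then show ?thesis by (simp only: Ball_def atMost_iff)
qed

lemma markov_jump_process_distr:
  assumes X: "(\<lambda>\<omega>. \<lambda>t\<in>{0..}. X t \<omega>) \<in> P \<rightarrow>\<^sub>M jump_path_space" and mjp: "markov_jump_process P X S \<mu> A"
  shows "markov_jump_process (distr P jump_path_space (\<lambda>\<omega>. \<lambda>t\<in>{0..}. X t \<omega>)) (\<lambda>t f. f t) S \<mu> A"
proof -
  let ?R = "distr P jump_path_space (\<lambda>\<omega>. \<lambda>t\<in>{0..}. X t \<omega>)" and ?S = "insert None (Some ` S)"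
  interpret prob_space P using mjp by (simp add: markov_jump_process_def)
  obtain p where p: "transition_semigroup ?S p"
      "\<forall>x\<in>?S. \<forall>y\<in>?S. ((\<lambda>h. (p h x y - (if x = y then 1 else 0)) / h) \<longlongrightarrow> with_cemetery 0 S A x y) (at_right 0)"
      and step: "\<forall>k (t :: nat \<Rightarrow> real) x y. 0 \<le> t 0 \<longrightarrow> (\<forall>i\<le>k. t i < t (Suc i)) \<longrightarrow> (\<forall>i\<le>k. x i \<in> ?S) \<longrightarrow> y \<in> ?S \<longrightarrow>
        \<P>(\<omega> in P. \<forall>i\<le>k. X (t i) \<omega> = x i) > 0 \<longrightarrow>
        \<P>(\<omega> in P. X (t (Suc k)) \<omega> = y \<bar> \<forall>i\<le>k. X (t i) \<omega> = x i) = p (t (Suc k) - t k) (x k) y"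
    using mjp unfolding markov_jump_process_def by (elim conjE exE) blast
  show ?thesis
    unfolding markov_jump_process_def
  proof (intro conjI allI impI ballI exI[of _ p])
    show "prob_space ?R" by (rule prob_space_distr[OF X])
    show "(\<lambda>f. f t) \<in> ?R \<rightarrow>\<^sub>M count_space UNIV" if "0 \<le> t" for t
      using jump_path_component[OF that] by simp
    show "jump_path (\<lambda>t. f t)" if "f \<in> space ?R" for f
      using that by (simp add: jump_path_space_def space_restrict_space)
    show "AE f in ?R. f t \<in> ?S" if t: "0 \<le> t" for t
    proof (subst AE_distr_iff[OF X jump_path_event[OF t]])
      have "AE \<omega> in P. X t \<omega> \<in> ?S" using mjp t unfolding markov_jump_process_def by blast
      then show "AE \<omega> in P. (\<lambda>t\<in>{0..}. X t \<omega>) t \<in> ?S" using t by simp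
    qed
    show "measure ?R {f\<in>space ?R. f 0 = Some x} = \<mu> x" if "x \<in> S" for x
    proof -
      have "prob {\<omega>\<in>space P. X 0 \<omega> = Some x} = \<mu> x" using mjp that unfolding markov_jump_process_def by blast
      then show ?thesis
        using measure_distr_Collect[OF X jump_path_event[of 0 "\<lambda>a. a = Some x"]] by simp
    qed
    show "intensity_matrix S A" using mjp unfolding markov_jump_process_def by blast
    show "transition_semigroup ?S p" by (rule p)
    show "((\<lambda>h. (p h x y - (if x = y then 1 else 0)) / h) \<longlongrightarrow> with_cemetery 0 S A x y) (at_right 0)"
      if "x \<in> ?S" "y \<in> ?S" for x y
      by (rule p(2)[rule_format, OF that])
    fix k and t :: "nat \<Rightarrow> real" and x y
    assume t: "0 \<le> t 0" "\<forall>i\<le>k. t i < t (Suc i)" and x: "\<forall>i\<le>k. x i \<in> ?S" and y: "y \<in> ?S"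
      and pos: "0 < measure ?R {f\<in>space ?R. \<forall>i\<le>k. f (t i) = x i}"
    have nonneg: "0 \<le> t i" if "i \<le> Suc k" for i
      using that
    proof (induction i)
      case (Suc i)
      then have "0 \<le> t i" "t i < t (Suc i)" using t(2) by simp_all
      then show ?case by simp
    qed (use t in simp)
    have hist: "{f\<in>space jump_path_space. \<forall>i\<le>k. f (t i) = x i} \<in> sets jump_path_space"
      by (rule jump_path_history) (use nonneg in simp)
    have eq: "(\<forall>i\<le>k. (\<lambda>t\<in>{0..}. X t \<omega>) (t i) = x i) \<longleftrightarrow> (\<forall>i\<le>k. X (t i) \<omega> = x i)"
      "(\<lambda>t\<in>{0..}. X t \<omega>) (t (Suc k)) = X (t (Suc k)) \<omega>" for \<omega>
      using nonneg by simp_all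
    have "0 < prob {\<omega>\<in>space P. \<forall>i\<le>k. X (t i) \<omega> = x i}"
      using pos unfolding measure_distr_Collect[OF X hist] eq .
    then have "\<P>(\<omega> in P. X (t (Suc k)) \<omega> = y \<bar> \<forall>i\<le>k. X (t i) \<omega> = x i) = p (t (Suc k) - t k) (x k) y"
      using step[rule_format, of t k x y] t x y by simp
    then show "\<P>(f in ?R. f (t (Suc k)) = y \<bar> \<forall>i\<le>k. f (t i) = x i) = p (t (Suc k) - t k) (x k) y"
      unfolding cond_prob_distr[OF X jump_path_event[where R = "\<lambda>a. a = y", OF nonneg[OF order_refl]] hist] eq .
  qed
qed

section \<open>Measurability along random times\<close>

lemma arrival_time_measurable:
  assumes path: "\<And>\<omega>. \<omega> \<in> space F \<Longrightarrow> counting_path (\<lambda>t. X t \<omega>)"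
    and X: "\<And>t. 0 \<le> t \<Longrightarrow> X t \<in> F \<rightarrow>\<^sub>M count_space UNIV"
  shows "arrival X l \<in> borel_measurable F" "arrival_time X l \<in> F \<rightarrow>\<^sub>M restrict_space borel {0..}"
proof -
  have nonneg: "0 \<le> arrival X l \<omega>" for \<omega> unfolding arrival_def by (rule INF_greatest) simp
  show A: "arrival X l \<in> borel_measurable F"
  proof (rule borel_measurableI_le)
    fix y :: ereal
    show "{\<omega>\<in>space F. arrival X l \<omega> \<le> y} \<in> sets F"
    proof (cases "0 \<le> y")
      case False
      then have "{\<omega>\<in>space F. arrival X l \<omega> \<le> y} = {}" using nonneg order_trans by blast
      then show ?thesis by (simp only: sets.empty_sets)
    next
      case True
      show ?thesis
      proof (cases y)
        case (real r)
        then have r: "0 \<le> r" using True by simp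
        have "{\<omega>\<in>space F. arrival X l \<omega> \<le> y} = X r -` {l..} \<inter> space F"
        proof -
          have "arrival X l \<omega> \<le> ereal r \<longleftrightarrow> l \<le> X r \<omega>" if "\<omega> \<in> space F" for \<omega>
            by (rule arrival_le_iff[where X = X and \<omega> = \<omega>, OF path[OF that] r])
          then show ?thesis using real by auto
        qed
        then show ?thesis using measurable_sets[OF X[OF r], of "{l..}"] by simp
      qed (use True in auto)
    qed
  qed
  have "arrival_time X l \<in> borel_measurable F"
    unfolding arrival_time_def using A by (rule borel_measurable_real_of_ereal)
  then show "arrival_time X l \<in> F \<rightarrow>\<^sub>M restrict_space borel {0..}"
    using arrival_time_nonneg[of X l] by (intro measurable_restrict_space2) auto
qed

text \<open>
  By right-continuity \<open>l \<le> X (T \<omega>) \<omega>\<close> is equivalent to \<open>arrival X l \<omega> \<le> T \<omega>\<close>, which involves two random variables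
  only and no uncountable family.
\<close>

lemma value_at_time_measurable:
  fixes X :: "real \<Rightarrow> 'w \<Rightarrow> nat"
  assumes path: "\<And>\<omega>. \<omega> \<in> space F \<Longrightarrow> counting_path (\<lambda>t. X t \<omega>)"
    and X: "\<And>t. 0 \<le> t \<Longrightarrow> X t \<in> F \<rightarrow>\<^sub>M count_space UNIV"
    and T: "T \<in> borel_measurable F" "\<And>\<omega>. \<omega> \<in> space F \<Longrightarrow> 0 \<le> T \<omega>"
  shows "(\<lambda>\<omega>. X (T \<omega>) \<omega>) \<in> F \<rightarrow>\<^sub>M count_space UNIV"
proof -
  have ge: "{\<omega>\<in>space F. l \<le> X (T \<omega>) \<omega>} \<in> sets F" for l
  proof -
    note arrival_time_measurable(1)[OF path X, measurable] and T(1)[measurable]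
    have "{\<omega>\<in>space F. l \<le> X (T \<omega>) \<omega>} = {\<omega>\<in>space F. arrival X l \<omega> \<le> ereal (T \<omega>)}"
    proof -
      have "arrival X l \<omega> \<le> ereal (T \<omega>) \<longleftrightarrow> l \<le> X (T \<omega>) \<omega>" if "\<omega> \<in> space F" for \<omega>
        by (rule arrival_le_iff[where X = X and \<omega> = \<omega>, OF path[OF that] T(2)[OF that]])
      then show ?thesis by auto
    qed
    also have "\<dots> \<in> sets F" by measurable
    finally show ?thesis .
  qed
  have "(\<lambda>\<omega>. X (T \<omega>) \<omega>) -` {l} \<inter> space F \<in> sets F" for l
  proof -
    have "(\<lambda>\<omega>. X (T \<omega>) \<omega>) -` {l} \<inter> space F = {\<omega>\<in>space F. l \<le> X (T \<omega>) \<omega>} - {\<omega>\<in>space F. Suc l \<le> X (T \<omega>) \<omega>}"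
      by auto
    then show ?thesis using ge by auto
  qed
  then show ?thesis by (subst measurable_count_space_eq2_countable) auto
qed

lemma level_path_measurable:
  assumes path: "\<And>x. x \<in> space K \<Longrightarrow> counting_path (\<lambda>t. m t x)"
    and m: "\<And>t. 0 \<le> t \<Longrightarrow> m t \<in> K \<rightarrow>\<^sub>M count_space UNIV"
    and y: "\<And>l :: nat. y l \<in> K \<rightarrow>\<^sub>M count_space UNIV"
  shows "(\<lambda>x. \<lambda>t\<in>{0..}. map_option (Pair (m t x)) (y (m t x) x)) \<in> K \<rightarrow>\<^sub>M jump_path_space"
  unfolding jump_path_space_def
proof (rule measurable_restrict_space2)
  show "(\<lambda>x. \<lambda>t\<in>{0..}. map_option (Pair (m t x)) (y (m t x) x)) \<in> space K \<rightarrow> {f. jump_path f}"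
  proof
    fix x assume x: "x \<in> space K"
    have "jump_path (\<lambda>t. map_option (Pair (m t x)) (y (m t x) x))"
      by (rule counting_path_jump_path[OF path[OF x]])
    then show "(\<lambda>t\<in>{0..}. map_option (Pair (m t x)) (y (m t x) x)) \<in> {f. jump_path f}"
      by (subst mem_Collect_eq, subst jump_path_cong[where g = "\<lambda>t. map_option (Pair (m t x)) (y (m t x) x)"]) simp_all
  qed
  show "(\<lambda>x. \<lambda>t\<in>{0..}. map_option (Pair (m t x)) (y (m t x) x)) \<in> K \<rightarrow>\<^sub>M PiM {0..} (\<lambda>_. count_space UNIV)"
  proof (rule measurable_restrict)
    fix t :: real assume "t \<in> {0..}"
    then have mt: "m t \<in> K \<rightarrow>\<^sub>M count_space UNIV" using m by simp
    have "(\<lambda>x. map_option (Pair l) (y l x)) \<in> K \<rightarrow>\<^sub>M count_space UNIV" for l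
      by (rule measurable_compose[OF y]) simp
    from measurable_compose_countable[OF this mt]
    show "(\<lambda>x. map_option (Pair (m t x)) (y (m t x) x)) \<in> K \<rightarrow>\<^sub>M count_space UNIV" .
  qed
qed

text \<open>
  If every point is marked, the thinned chain is the embedded chain. So \<open>chain_measurable\<close> covers both.
\<close>

lemma embedded_chain_thinned_id:
  "embedded_chain p lam0 \<alpha> \<Lambda> t u l = thinned_chain p lam0 \<alpha> \<Lambda> t (\<lambda>k. k) u l"
  by (induction l) (auto split: option.split)

context driven_chain
begin

lemma step_substochastic:
  assumes "\<And>l. 0 \<le> t l"
  shows "substochastic_matrix {1..p} (step t l)"
  unfolding substochastic_matrix_def
proof (intro ballI conjI)
  have step: "step t l = (\<lambda>i j. \<Lambda> i j (t l) / real n + (if i = j then 1 else 0))"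
    by (simp add: step_def fun_eq_iff add.commute)
  fix i assume i: "i \<in> {1..p}"
  show "0 \<le> step t l i j" if "j \<in> {1..p}" for j
    unfolding step by (rule uniformized_stochastic(1)[OF assms i lam0(2) that])
  show "step t l i summable_on {1..p}" by simp
  show "(\<Sum>\<^sub>\<infinity>j\<in>{1..p}. step t l i j) \<le> 1"
    using uniformized_stochastic(2)[OF assms i lam0(2), of l] unfolding step by simp
qed

lemma driven_killed_chain:
  assumes t: "\<And>l. 0 \<le> t l"
  shows "killed_chain P {1..p} (step t) (driven t) \<alpha>"
proof unfold_locales
  show "finite {1..p}" by simp
  show "substochastic_matrix {1..p} (step t (Suc l))" for l by (rule step_substochastic[OF t])
  show "driven t l \<in> P \<rightarrow>\<^sub>M count_space UNIV" for l by (rule driven_measurable[OF t])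
  show "driven t l \<omega> \<in> insert None (Some ` {1..p})" for l \<omega> by (rule chain_states[OF t])
  show "driven t (Suc l) \<omega> = None" if "driven t l \<omega> = None" for l \<omega> using that by simp
  show "prob {\<omega>\<in>space P. \<forall>k\<le>l. driven t k \<omega> = Some (y k)} = \<alpha> (y 0) * (\<Prod>k<l. step t (Suc k) (y k) (y (Suc k)))"
    if "\<And>k. k \<le> l \<Longrightarrow> y k \<in> {1..p}" for l y
    using t that by (rule driven_path_law)
qed

end

section \<open>The coupled construction\<close>

text \<open>
  The independent sources of randomness after the marks have been split off from the point process:
  the superposed points (on which one conditions), the counts of marked points, the clock that puts
  the sampled values back, and the uniform variables.
\<close>

datatype source = Times | Counts | Clock | Uniform nat

locale coupled_construction =
  fixes P :: "'w measure" and p n lam0 :: nat and \<Lambda> :: "nat \<Rightarrow> nat \<Rightarrow> real \<Rightarrow> real" and \<alpha> :: "nat \<Rightarrow> real"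
    and N M :: "real \<Rightarrow> 'w \<Rightarrow> nat" and Nh Mh :: "nat \<Rightarrow> real \<Rightarrow> 'w \<Rightarrow> nat" and U :: "nat \<Rightarrow> 'w \<Rightarrow> real"
  assumes intensities: "intensity_matrix_function p \<Lambda>"
    and bounded: "bdd_above (diagonal_sizes p \<Lambda>)"
    and initial_law: "probability_vector p \<alpha>"
    and lam0_def: "lam0 = uniformization_rate p \<Lambda>"
    and lam0_pos: "0 < lam0"
    and driving: "driving_components P lam0 N M Nh Mh U"
    and lam0_le: "lam0 \<le> n"
begin

sublocale prob_space P
  using driving by (simp add: driving_components_def)

abbreviation events_of :: "component \<Rightarrow> 'w set set" where
  "events_of \<equiv> component_events P N M Nh Mh U"

lemma components_independent: "indep_sets events_of (component_indices lam0)"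
  using driving by (simp add: driving_components_def)

lemma components_stable: "Int_stable (events_of i)"
  by (cases i) (simp_all add: Int_stable_sets)

lemma component_processes:
  "poisson_process P (real lam0) N" "poisson_process P (real lam0) M"
  "lam0 + 1 \<le> k \<Longrightarrow> poisson_process P 1 (Nh k)" "lam0 + 1 \<le> k \<Longrightarrow> poisson_process P 1 (Mh k)"
  using driving by (simp_all add: driving_components_def)

lemma component_measurable:
  assumes "events_of i = sets (process_algebra P X)" "0 \<le> t" "i \<in> component_indices lam0"
  shows "X t \<in> generated_algebra P events_of {i} \<rightarrow>\<^sub>M count_space UNIV"
proof (rule measurable_from_subalg[OF _ process_algebra_measurable[OF assms(2)]])
  have "events_of i \<subseteq> events" using components_independent assms(3) by (auto simp: indep_sets_def)
  then have "sets (generated_algebra P events_of {i}) = sigma_sets (space P) (events_of i)"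
    by (subst sets_generated_algebra) auto
  then show "subalgebra (generated_algebra P events_of {i}) (process_algebra P X)"
    using assms(1) by (auto simp: subalgebra_def)
qed

lemma poisson_process_path: "poisson_process P r X \<Longrightarrow> \<omega> \<in> space P \<Longrightarrow> counting_path (\<lambda>t. X t \<omega>)"
  by (simp add: poisson_process_def)

abbreviation "Nn \<equiv> superposition lam0 n N Nh"
abbreviation "Mn \<equiv> superposition lam0 n M Mh"
abbreviation "extra \<equiv> superposition lam0 n (\<lambda>_ _. 0) Nh"
abbreviation "J \<equiv> process_J p lam0 \<alpha> \<Lambda> U N"

lemma indices:
  "CN \<in> component_indices lam0" "CM \<in> component_indices lam0" "CU l \<in> component_indices lam0"
  "CN_hat ` {lam0 + 1..} \<subseteq> component_indices lam0" "CM_hat ` {lam0 + 1..} \<subseteq> component_indices lam0"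
  by (auto simp: component_indices_def)

lemma hat_measurable:
  assumes "lam0 + 1 \<le> k" "0 \<le> t"
  shows "Nh k t \<in> generated_algebra P events_of {CN_hat k} \<rightarrow>\<^sub>M count_space UNIV"
    and "Mh k t \<in> generated_algebra P events_of {CM_hat k} \<rightarrow>\<^sub>M count_space UNIV"
  using assms by (auto intro!: component_measurable simp: component_indices_def)

text \<open>
  All points of the superposition that are not points of \<open>N\<close>. For \<open>n = \<lambda>\<^sub>0\<close> there are none.
\<close>

lemma extra_poisson:
  "poisson_increments P (real (n - lam0)) extra"
  "\<omega> \<in> space P \<Longrightarrow> counting_path (\<lambda>t. extra t \<omega>)"
  "0 \<le> t \<Longrightarrow> extra t \<in> generated_algebra P events_of (CN_hat ` {lam0 + 1..n}) \<rightarrow>\<^sub>M count_space UNIV"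
proof -
  have zero: "poisson_increments P 0 (\<lambda>_ _. 0)"
    unfolding poisson_increments_def
  proof (intro allI impI)
    fix k and t :: "nat \<Rightarrow> real" and a :: "nat \<Rightarrow> nat"
    show "\<P>(\<omega> in P. \<forall>i<k. 0 - 0 = a i) = (\<Prod>i<k. poisson_density (0 * (t (Suc i) - t i)) (a i))"
    proof (cases "\<forall>i<k. a i = 0")
      case True
      then show ?thesis by (simp add: poisson_density_0 prob_space)
    next
      case False
      then have "(\<Prod>i<k. poisson_density (0 * (t (Suc i) - t i)) (a i)) = 0"
        by (intro prod_zero) (auto simp: poisson_density_0)
      moreover have "{\<omega>\<in>space P. \<forall>i<k. 0 - 0 = a i} = {}" using False by auto
      ultimately show ?thesis by (simp only: measure_empty)
    qed
  qed
  have zero_path: "counting_path (\<lambda>_. 0)" by (simp add: counting_path_def mono_on_def)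
  note sup = superposition_poisson[OF components_independent components_stable _ _ _ indices(4) zero zero_path,
      where ?I0.0 = "{}" and Xh = Nh and m = n]
  have "inj CN_hat" by (simp add: inj_def)
  then show "poisson_increments P (real (n - lam0)) extra"
    "\<omega> \<in> space P \<Longrightarrow> counting_path (\<lambda>t. extra t \<omega>)"
    "0 \<le> t \<Longrightarrow> extra t \<in> generated_algebra P events_of (CN_hat ` {lam0 + 1..n}) \<rightarrow>\<^sub>M count_space UNIV"
    using sup component_processes(3) lam0_le hat_measurable(1)
      poisson_process_increments[OF prob_space_axioms component_processes(3)] poisson_process_path[OF component_processes(3)]
    by simp_all
qed

lemma Mn_poisson:
  "poisson_increments P (real n) Mn"
  "\<omega> \<in> space P \<Longrightarrow> counting_path (\<lambda>t. Mn t \<omega>)"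
  "0 \<le> t \<Longrightarrow> Mn t \<in> generated_algebra P events_of ({CM} \<union> CM_hat ` {lam0 + 1..n}) \<rightarrow>\<^sub>M count_space UNIV"
proof -
  have lam0r: "0 < real lam0" using lam0_pos by simp
  have M: "M t \<in> generated_algebra P events_of {CM} \<rightarrow>\<^sub>M count_space UNIV" if "0 \<le> t" for t
    using that by (intro component_measurable indices) simp_all
  have inj: "inj CM_hat" by (simp add: inj_def)
  have sub: "{CM} \<subseteq> component_indices lam0" "{CM} \<inter> CM_hat ` {lam0 + 1..} = {}" using indices by auto
  note sup = superposition_poisson[OF components_independent components_stable sub inj indices(5)
      poisson_process_increments[OF prob_space_axioms component_processes(2) lam0r] poisson_process_path[OF component_processes(2)] M,
      where Xh = Mh and m = n]
  have "real lam0 + real (n - lam0) = real n" using lam0_le by simp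
  then show "poisson_increments P (real n) Mn"
    "\<omega> \<in> space P \<Longrightarrow> counting_path (\<lambda>t. Mn t \<omega>)"
    "0 \<le> t \<Longrightarrow> Mn t \<in> generated_algebra P events_of ({CM} \<union> CM_hat ` {lam0 + 1..n}) \<rightarrow>\<^sub>M count_space UNIV"
    using sup component_processes(4) lam0_le hat_measurable(2)
      poisson_process_increments[OF prob_space_axioms component_processes(4)] poisson_process_path[OF component_processes(4)]
    by simp_all
qed

lemma component_events_sub: "i \<in> component_indices lam0 \<Longrightarrow> events_of i \<subseteq> events"
  using components_independent by (auto simp: indep_sets_def)

sublocale points: independent_poisson_pair P N extra "real lam0" "real (n - lam0)"
  "generated_algebra P events_of {CN}" "generated_algebra P events_of (CN_hat ` {lam0 + 1..n})"
proof unfold_locales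
  have lam0r: "0 < real lam0" using lam0_pos by simp
  then show "0 < real lam0" "0 \<le> real (n - lam0)" by simp_all
  show "poisson_increments P (real lam0) N"
    by (rule poisson_process_increments[OF prob_space_axioms component_processes(1) lam0r])
  show "poisson_increments P (real (n - lam0)) extra" by (rule extra_poisson)
  show "counting_path (\<lambda>t. N t \<omega>)" if "\<omega> \<in> space P" for \<omega> by (rule poisson_process_path[OF component_processes(1) that])
  show "counting_path (\<lambda>t. extra t \<omega>)" if "\<omega> \<in> space P" for \<omega> by (rule extra_poisson(2)[OF that])
  show "subalgebra P (generated_algebra P events_of {CN})"
    by (rule subalgebra_generated, rule component_events_sub) (use indices in auto)
  show "subalgebra P (generated_algebra P events_of (CN_hat ` {lam0 + 1..n}))"
    by (rule subalgebra_generated, rule component_events_sub) (use indices(4) in auto)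
  show "N t \<in> generated_algebra P events_of {CN} \<rightarrow>\<^sub>M count_space UNIV" if "0 \<le> t" for t
    using that by (intro component_measurable indices) simp_all
  show "extra t \<in> generated_algebra P events_of (CN_hat ` {lam0 + 1..n}) \<rightarrow>\<^sub>M count_space UNIV" if "0 \<le> t" for t
    by (rule extra_poisson(3)[OF that])
  show "prob (A \<inter> B) = prob A * prob B"
    if "A \<in> sets (generated_algebra P events_of {CN})" "B \<in> sets (generated_algebra P events_of (CN_hat ` {lam0 + 1..n}))" for A B
    by (rule independent_generated[OF components_independent components_stable _ _ _ that]) (use indices in auto)
qed

lemma Nn_eq: "Nn = (\<lambda>t \<omega>. N t \<omega> + extra t \<omega>)"
  by (simp add: superposition_def fun_eq_iff)

definition C :: "nat \<Rightarrow> 'w \<Rightarrow> nat" where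
  "C = marked_count N extra"

lemma Nn_path: "\<omega> \<in> space P \<Longrightarrow> counting_path (\<lambda>t. Nn t \<omega>)"
  unfolding Nn_eq by (rule counting_path_add[OF points.paths])

text \<open>
  The counts are split off from the group of \<open>Times\<close> and have no components of their own.
\<close>

primrec source_components :: "source \<Rightarrow> component set" where
  "source_components Times = {CN} \<union> CN_hat ` {lam0 + 1..n}"
| "source_components Counts = {}"
| "source_components Clock = {CM} \<union> CM_hat ` {lam0 + 1..n}"
| "source_components (Uniform l) = {CU l}"

definition walk_algebra :: "'w measure" where
  "walk_algebra = vimage_algebra (space P) (\<lambda>\<omega> l. C l \<omega>) (PiM UNIV (\<lambda>_. count_space UNIV))"

primrec source_events :: "source \<Rightarrow> 'w set set" where
  "source_events Times = sets (process_algebra P Nn)"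
| "source_events Counts = sets walk_algebra"
| "source_events Clock = sets (generated_algebra P events_of (source_components Clock))"
| "source_events (Uniform l) = sets (vimage_algebra (space P) (U l) borel)"

lemma source_components_sub: "source_components s \<subseteq> component_indices lam0"
  by (cases s) (auto simp: component_indices_def)

lemma sets_source_components:
  "sets (generated_algebra P events_of (source_components s)) = sigma_sets (space P) (\<Union>i\<in>source_components s. events_of i)"
  by (rule sets_generated_algebra) (use component_events_sub source_components_sub in blast)

lemma Times_measurable:
  assumes "0 \<le> t"
  shows "N t \<in> generated_algebra P events_of (source_components Times) \<rightarrow>\<^sub>M count_space UNIV"
    and "extra t \<in> generated_algebra P events_of (source_components Times) \<rightarrow>\<^sub>M count_space UNIV"
proof -
  have sub: "subalgebra (generated_algebra P events_of (source_components Times)) (generated_algebra P events_of I)"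
    if "I \<subseteq> source_components Times" for I
    by (rule generated_algebra_mono[OF _ that]) (use component_events_sub source_components_sub in blast)
  show "N t \<in> generated_algebra P events_of (source_components Times) \<rightarrow>\<^sub>M count_space UNIV"
    by (rule measurable_from_subalg[OF sub points.measurable_paths(1)[OF assms]]) simp
  show "extra t \<in> generated_algebra P events_of (source_components Times) \<rightarrow>\<^sub>M count_space UNIV"
    by (rule measurable_from_subalg[OF sub points.measurable_paths(2)[OF assms]]) auto
qed

lemma C_measurable_Times: "C l \<in> generated_algebra P events_of (source_components Times) \<rightarrow>\<^sub>M count_space UNIV"
  unfolding C_def by (rule measurable_marked_count) (rule Times_measurable, assumption)+

text \<open>
  The proportion of marked points is \<open>\<lambda>\<^sub>0 / (\<lambda>\<^sub>0 + (n - \<lambda>\<^sub>0)) = \<lambda>\<^sub>0 / n\<close>.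
\<close>

lemma walk_thinning:
  assumes A: "A \<in> sets (process_algebra P Nn)" and D: "D \<in> sets (PiM UNIV (\<lambda>_. count_space UNIV))"
  shows "prob (A \<inter> {\<omega>\<in>space P. (\<lambda>l. C l \<omega>) \<in> D}) = prob A * measure (coin_tosses (real lam0 / real n)) {c. heads c \<in> D}"
proof -
  have "real lam0 / (real lam0 + real (n - lam0)) = real lam0 / real n" using lam0_le by simp
  with points.thinning[OF A[unfolded Nn_eq] D] show ?thesis by (simp only: C_def)
qed

lemma walk_distribution:
  assumes D: "D \<in> sets (PiM UNIV (\<lambda>_. count_space UNIV))"
  shows "prob {\<omega>\<in>space P. (\<lambda>l. C l \<omega>) \<in> D} = measure (coin_tosses (real lam0 / real n)) {c. heads c \<in> D}"
proof -
  have "space P \<in> sets (process_algebra P Nn)"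
    using sets.top[of "process_algebra P Nn"] by simp
  from walk_thinning[OF this D] show ?thesis
    by (simp add: prob_space Int_absorb1 Collect_restrict)
qed

lemma walk_algebra_sets:
  "sets walk_algebra = {{\<omega>\<in>space P. (\<lambda>l. C l \<omega>) \<in> D} | D. D \<in> sets (PiM UNIV (\<lambda>_. count_space UNIV))}"
  unfolding walk_algebra_def
  by (subst sets_vimage_algebra2) (auto simp: space_PiM vimage_def Int_def conj_commute)

text \<open>
  The groups of components that make up the point process, the clock and the uniform variables are
  disjoint, hence independent. Thinning splits the first group into points and marks.
\<close>

lemma sources_independent: "indep_sets source_events UNIV"
proof -
  let ?J = "{Times, Clock} \<union> range Uniform"
  let ?E = "\<lambda>s. sigma_sets (space P) (\<Union>i\<in>source_components s. events_of i)"
  let ?T = "generated_algebra P events_of (source_components Times)"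
  have base: "indep_sets ?E ?J"
  proof (rule indep_sets_collect_sigma)
    show "indep_sets events_of (\<Union>s\<in>?J. source_components s)"
      by (rule indep_sets_mono_index[OF _ components_independent]) (use source_components_sub in blast)
    show "disjoint_family_on source_components ?J"
      unfolding disjoint_family_on_def by auto
  qed (rule components_stable)
  have T: "?E Times = sets ?T" by (rule sets_source_components[symmetric])
  have spT: "space ?T = space P" by simp
  have F_sub: "sets (process_algebra P Nn) \<subseteq> ?E Times"
    unfolding T
  proof (rule process_algebra_least[OF spT])
    fix t :: real assume t: "0 \<le> t"
    show "Nn t \<in> ?T \<rightarrow>\<^sub>M count_space UNIV"
      unfolding Nn_eq by (rule measurable_count_pair[OF Times_measurable[OF t]]) simp
  qed
  have C_sub: "sets walk_algebra \<subseteq> ?E Times"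
    unfolding T
  proof
    fix A assume "A \<in> sets walk_algebra"
    then obtain D where D: "D \<in> sets (PiM UNIV (\<lambda>_. count_space UNIV))" and A: "A = {\<omega>\<in>space P. (\<lambda>l. C l \<omega>) \<in> D}"
      unfolding walk_algebra_sets by blast
    have "(\<lambda>\<omega> l. C l \<omega>) \<in> ?T \<rightarrow>\<^sub>M PiM UNIV (\<lambda>_. count_space UNIV)"
      by (rule measurable_PiM_single') (simp_all add: C_measurable_Times del: source_components.simps)
    from measurable_sets[OF this D] show "A \<in> sets ?T"
      unfolding A spT by (simp add: vimage_def Int_def conj_commute del: source_components.simps)
  qed
  have "indep_sets (?E(Times := sets (process_algebra P Nn), Counts := sets walk_algebra)) (insert Counts ?J)"
  proof (rule indep_sets_split[OF base _ _ F_sub C_sub])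
    fix A B assume A: "A \<in> sets (process_algebra P Nn)" and B: "B \<in> sets walk_algebra"
    obtain D where D: "D \<in> sets (PiM UNIV (\<lambda>_. count_space UNIV))" and B_eq: "B = {\<omega>\<in>space P. (\<lambda>l. C l \<omega>) \<in> D}"
      using B unfolding walk_algebra_sets by blast
    have "prob (A \<inter> B) = prob A * prob B"
      unfolding B_eq using walk_thinning[OF A D] walk_distribution[OF D] by simp
    moreover have "A \<inter> B \<in> sets ?T" using A B F_sub C_sub unfolding T by blast
    ultimately show "A \<inter> B \<in> ?E Times \<and> prob (A \<inter> B) = prob A * prob B" unfolding T by blast
  qed auto
  then show ?thesis
  proof (rule indep_sets_mono)
    show "UNIV \<subseteq> insert Counts ?J"
    proof
      fix s show "s \<in> insert Counts ?J" by (cases s) auto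
    qed
    fix s
    show "source_events s \<subseteq> (?E(Times := sets (process_algebra P Nn), Counts := sets walk_algebra)) s"
    proof (cases s)
      case Clock
      then show ?thesis using sets_source_components[of Clock] by simp
    next
      case (Uniform l)
      then show ?thesis by auto
    qed simp_all
  qed
qed

lemma sources_stable: "Int_stable (source_events s)"
  by (cases s) (simp_all add: Int_stable_sets)

lemma sources_sub: "source_events s \<subseteq> events"
  using sources_independent by (auto simp: indep_sets_def)

abbreviation from_sources :: "source set \<Rightarrow> 'w measure" where
  "from_sources I \<equiv> generated_algebra P source_events I"

lemma from_sources_subalgebra: "subalgebra P (from_sources I)"
  by (rule subalgebra_generated) (rule sources_sub)

lemma sets_from_sources: "s \<in> I \<Longrightarrow> source_events s \<subseteq> sets (from_sources I)"
  by (subst sets_generated_algebra) (auto intro: sources_sub[THEN subsetD])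

lemma source_subalgebra: "s \<in> I \<Longrightarrow> space F = space P \<Longrightarrow> sets F = source_events s \<Longrightarrow> subalgebra (from_sources I) F"
  using sets_from_sources[of s I] by (simp add: subalgebra_def)

lemma sources_measurable:
  "Counts \<in> I \<Longrightarrow> C l \<in> from_sources I \<rightarrow>\<^sub>M count_space UNIV"
  "Uniform l \<in> I \<Longrightarrow> U l \<in> borel_measurable (from_sources I)"
  "Clock \<in> I \<Longrightarrow> 0 \<le> t \<Longrightarrow> Mn t \<in> from_sources I \<rightarrow>\<^sub>M count_space UNIV"
proof -
  show "C l \<in> from_sources I \<rightarrow>\<^sub>M count_space UNIV" if "Counts \<in> I"
  proof (rule measurable_from_subalg[OF source_subalgebra[OF that]])
    have "(\<lambda>\<omega> l. C l \<omega>) \<in> walk_algebra \<rightarrow>\<^sub>M PiM UNIV (\<lambda>_. count_space UNIV)"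
      unfolding walk_algebra_def by (rule measurable_vimage_algebra1) (simp add: space_PiM)
    from measurable_compose[OF this measurable_component_singleton[of l]]
    show "C l \<in> walk_algebra \<rightarrow>\<^sub>M count_space UNIV" by simp
  qed (simp_all add: walk_algebra_def)
  show "U l \<in> borel_measurable (from_sources I)" if "Uniform l \<in> I"
    by (rule measurable_from_subalg[OF source_subalgebra[OF that] measurable_vimage_algebra1]) simp_all
  show "Mn t \<in> from_sources I \<rightarrow>\<^sub>M count_space UNIV" if "Clock \<in> I" "0 \<le> t"
    by (rule measurable_from_subalg[OF source_subalgebra[OF that(1)] Mn_poisson(3)[OF that(2)]]) simp_all
qed

end

context coupled_construction
begin

lemma intensity_facts:
  "i \<in> {1..p} \<Longrightarrow> j \<in> {1..p} \<Longrightarrow> \<Lambda> i j \<in> borel_measurable (restrict_space borel {0..})"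
  "0 \<le> s \<Longrightarrow> i \<in> {1..p} \<Longrightarrow> j \<in> {1..p} \<Longrightarrow> i \<noteq> j \<Longrightarrow> 0 \<le> \<Lambda> i j s"
  "0 \<le> s \<Longrightarrow> i \<in> {1..p} \<Longrightarrow> (\<Sum>j\<in>{1..p}. \<Lambda> i j s) \<le> 0"
  using intensities unfolding intensity_matrix_function_def by auto

lemma diagonal_bound:
  assumes "0 \<le> s" "i \<in> {1..p}"
  shows "- real lam0 \<le> \<Lambda> i i s"
proof -
  have "\<bar>\<Lambda> i i s\<bar> \<in> diagonal_sizes p \<Lambda>" using assms by (auto simp: diagonal_sizes_def)
  then have "\<bar>\<Lambda> i i s\<bar> \<le> Sup (diagonal_sizes p \<Lambda>)" by (rule cSup_upper[OF _ bounded])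
  also have "\<dots> \<le> real lam0"
    unfolding lam0_def uniformization_rate_def by linarith
  finally show ?thesis by linarith
qed

lemma uniform_law: "D \<in> sets borel \<Longrightarrow> prob {\<omega>\<in>space P. U l \<omega> \<in> D} = measure unit_uniform D"
proof -
  assume D: "D \<in> sets borel"
  have U: "U l \<in> borel_measurable P" and law: "distr P borel (U l) = unit_uniform"
    using driving by (auto simp: driving_components_def unit_uniform_def)
  show ?thesis
    unfolding law[symmetric] using D by (subst measure_distr[OF U]) (auto intro!: arg_cong[where f = prob])
qed

lemma AE_walk: "AE \<omega> in P. \<forall>l. \<exists>t\<in>\<rat> \<inter> {0..}. N t \<omega> + extra t \<omega> = l"
  by (rule points.total_levels)

lemma walk_history_sets: "{c. \<forall>k\<le>l. c k = heads b k} \<in> sets (PiM UNIV (\<lambda>_. count_space UNIV))"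
proof -
  let ?S = "PiM UNIV (\<lambda>_. count_space UNIV) :: (nat \<Rightarrow> nat) measure"
  have "(\<lambda>c. c k) -` {heads b k} \<inter> space ?S \<in> sets ?S" for k
    by (rule measurable_sets[OF measurable_component_singleton]) simp_all
  then have "{c \<in> space ?S. \<forall>k\<in>{..l}. c k = heads b k} \<in> sets ?S"
    by (intro sets.sets_Collect_finite_All) (simp_all add: vimage_def Int_def conj_commute)
  then show ?thesis by (simp add: space_PiM Ball_def)
qed

sublocale driven: driven_chain p lam0 n \<alpha> \<Lambda> P C U
proof unfold_locales
  show "0 < lam0" "lam0 \<le> n" "probability_vector p \<alpha>" by (rule lam0_pos lam0_le initial_law)+
  show "0 \<le> \<Lambda> i j s" if "0 \<le> s" "i \<in> {1..p}" "j \<in> {1..p}" "i \<noteq> j" for i j s by (rule intensity_facts(2)[OF that])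
  show "- real lam0 \<le> \<Lambda> i i s" if "0 \<le> s" "i \<in> {1..p}" for i s by (rule diagonal_bound[OF that])
  show "(\<Sum>j\<in>{1..p}. \<Lambda> i j s) \<le> 0" if "0 \<le> s" "i \<in> {1..p}" for i s by (rule intensity_facts(3)[OF that])
  show "\<Lambda> i j \<in> borel_measurable (restrict_space borel {0..})" if "i \<in> {1..p}" "j \<in> {1..p}" for i j
    by (rule intensity_facts(1)[OF that])
  show "C l \<in> P \<rightarrow>\<^sub>M count_space UNIV" for l
    by (rule measurable_from_subalg[OF from_sources_subalgebra sources_measurable(1)[of UNIV]]) simp
  show "U l \<in> borel_measurable P" for l
    by (rule measurable_from_subalg[OF from_sources_subalgebra sources_measurable(2)[of _ UNIV]]) simp
  show "AE \<omega> in P. C 0 \<omega> = 0 \<and> (\<forall>l. C (Suc l) \<omega> = C l \<omega> \<or> C (Suc l) \<omega> = Suc (C l \<omega>))"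
    using AE_walk
  proof (rule AE_mp, intro AE_I2 impI)
    fix \<omega> assume w: "\<omega> \<in> space P" and levels: "\<forall>l. \<exists>t\<in>\<rat> \<inter> {0..}. N t \<omega> + extra t \<omega> = l"
    note facts = points.paths(1)[OF w] points.paths(2)[OF w] counting_path_add[OF points.paths[OF w]] levels
    show "C 0 \<omega> = 0 \<and> (\<forall>l. C (Suc l) \<omega> = C l \<omega> \<or> C (Suc l) \<omega> = Suc (C l \<omega>))"
      unfolding C_def using marked_count_0[where X = N and Y = extra and \<omega> = \<omega>, OF facts]
        marked_count_step[where X = N and Y = extra and \<omega> = \<omega>, OF facts] by blast
  qed
  have law: "prob {\<omega>\<in>space P. \<forall>k\<le>l. C k \<omega> = heads b k} = (\<Prod>k<l. pmf (bernoulli_pmf (real lam0 / real n)) (b k))" for l b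
  proof -
    have iff: "(\<forall>k\<le>l. heads c k = heads b k) \<longleftrightarrow> (\<forall>k<l. c k = b k)" for c
    proof
      assume h: "\<forall>k\<le>l. heads c k = heads b k"
      show "\<forall>k<l. c k = b k"
      proof (intro allI impI)
        fix k assume "k < l"
        then have "heads c (Suc k) = heads b (Suc k)" "heads c k = heads b k" using h by simp_all
        then show "c k = b k" by (auto simp: heads_Suc split: if_splits)
      qed
    next
      assume "\<forall>k<l. c k = b k"
      then show "\<forall>k\<le>l. heads c k = heads b k" by (auto intro!: heads_cong)
    qed
    have "prob {\<omega>\<in>space P. (\<lambda>l. C l \<omega>) \<in> {c. \<forall>k\<le>l. c k = heads b k}} =
        measure (coin_tosses (real lam0 / real n)) {c. heads c \<in> {c. \<forall>k\<le>l. c k = heads b k}}"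
      by (rule walk_distribution[OF walk_history_sets])
    then show ?thesis unfolding mem_Collect_eq iff measure_cylinder .
  qed
  then show "prob {\<omega>\<in>space P. \<forall>k\<le>l. C k \<omega> = heads b k} = (\<Prod>k<l. pmf (bernoulli_pmf (real lam0 / real n)) (b k))" for l b .
  show "prob ({\<omega>\<in>space P. \<forall>k\<le>l. C k \<omega> = heads b k} \<inter> {\<omega>\<in>space P. \<forall>j\<le>m. U j \<omega> \<in> D j}) =
      prob {\<omega>\<in>space P. \<forall>k\<le>l. C k \<omega> = heads b k} * (\<Prod>j\<le>m. measure unit_uniform (D j))"
    if D: "\<And>j. D j \<in> sets borel" for D l m b
  proof -
    let ?W = "{\<omega>\<in>space P. \<forall>k\<le>l. C k \<omega> = heads b k}" and ?L = "insert Counts (Uniform ` {..m})"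
    \<comment> \<open>Among the sources in \<open>?L\<close> only \<open>Counts\<close> falls under the default.\<close>
    define A where "A s = (case s of Uniform j \<Rightarrow> {\<omega>\<in>space P. U j \<omega> \<in> D j} | _ \<Rightarrow> ?W)" for s
    have AC: "A Counts = ?W" and AU: "A (Uniform j) = {\<omega>\<in>space P. U j \<omega> \<in> D j}" for j
      by (simp_all add: A_def)
    have "prob (\<Inter>s\<in>?L. A s) = (\<Prod>s\<in>?L. prob (A s))"
    proof (rule indep_setsD[OF sources_independent])
      have "?W \<in> sets walk_algebra"
        unfolding walk_algebra_sets mem_Collect_eq
        by (intro exI[of _ "{c. \<forall>k\<le>l. c k = heads b k}"] conjI walk_history_sets) simp
      moreover have "{\<omega>\<in>space P. U j \<omega> \<in> D j} \<in> sets (vimage_algebra (space P) (U j) borel)" for j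
        using in_vimage_algebra[OF D[of j], of "U j" "space P"] by (simp add: vimage_def Int_def conj_commute)
      ultimately show "\<forall>s\<in>?L. A s \<in> source_events s"
        by (auto simp only: AC AU source_events.simps)
    qed auto
    moreover have "(\<Inter>s\<in>?L. A s) = ?W \<inter> {\<omega>\<in>space P. \<forall>j\<le>m. U j \<omega> \<in> D j}"
      by (simp only: image_insert image_image Inter_insert AC AU) auto
    moreover have "(\<Prod>s\<in>?L. prob (A s)) = prob ?W * (\<Prod>j\<le>m. measure unit_uniform (D j))"
    proof -
      have "(\<Prod>s\<in>?L. prob (A s)) = prob (A Counts) * (\<Prod>s\<in>Uniform ` {..m}. prob (A s))"
        by (rule prod.insert) auto
      also have "(\<Prod>s\<in>Uniform ` {..m}. prob (A s)) = (\<Prod>j\<le>m. prob (A (Uniform j)))"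
        by (rule prod.reindex_cong[of Uniform]) (auto simp: inj_on_def)
      also have "\<dots> = (\<Prod>j\<le>m. measure unit_uniform (D j))"
        by (intro prod.cong refl) (simp only: AU uniform_law[OF D])
      finally show ?thesis by (simp only: AC)
    qed
    ultimately show ?thesis by (simp only:)
  qed
qed

abbreviation observed :: "'w measure" where
  "observed \<equiv> process_algebra P Nn"

abbreviation noise :: "'w measure" where
  "noise \<equiv> from_sources ({Counts, Clock} \<union> range Uniform)"

definition \<tau> :: "'w \<Rightarrow> nat \<Rightarrow> real" where
  "\<tau> \<omega> l = arrival_time Nn l \<omega>"

lemma \<tau>_nonneg: "0 \<le> \<tau> \<omega> l"
  unfolding \<tau>_def by (rule arrival_time_nonneg)

abbreviation time_space :: "(nat \<Rightarrow> real) measure" where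
  "time_space \<equiv> PiM UNIV (\<lambda>_. restrict_space borel {0..})"

lemma \<tau>_measurable: "\<tau> \<in> observed \<rightarrow>\<^sub>M time_space"
proof (rule measurable_PiM_single')
  show "(\<lambda>\<omega>. \<tau> \<omega> l) \<in> observed \<rightarrow>\<^sub>M restrict_space borel {0..}" for l
    unfolding \<tau>_def
    by (rule arrival_time_measurable(2)) (simp add: Nn_path, rule process_algebra_measurable)
qed (use \<tau>_nonneg in \<open>auto simp: PiE_iff space_restrict_space\<close>)

lemma observed_subalgebra: "subalgebra P observed"
  using sources_sub[of Times] by (simp add: subalgebra_def)

lemma observed_independent: "A \<in> sets observed \<Longrightarrow> B \<in> sets noise \<Longrightarrow> prob (A \<inter> B) = prob A * prob B"
proof (rule independent_generated[OF sources_independent sources_stable, of "{Times}"])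
  show "A \<in> sets (from_sources {Times})" if "A \<in> sets observed"
    using that sets_from_sources[of Times "{Times}"] by auto
qed auto

lemma sampled_chain_eq:
  assumes w: "\<omega> \<in> space P"
  shows "sampled_chain J Nn l \<omega> =
    embedded_chain p lam0 \<alpha> \<Lambda> (\<lambda>k. arrival_time N k \<omega>) (\<lambda>k. U k \<omega>) (N (\<tau> \<omega> l) \<omega>)"
  unfolding sampled_chain_def process_J_def \<tau>_def
  using arrival_index_eq[where X = N and \<omega> = \<omega>, OF points.paths(1)[OF w] arrival_time_nonneg[of Nn l \<omega>]] by simp

text \<open>
  Holds where no level of the superposition is skipped. There the sampled chain depends on the
  observed points through their positions only, and otherwise on the noise.
\<close>

lemma sampled_chain_driven: "AE \<omega> in P. \<forall>l. sampled_chain J Nn l \<omega> = driven.driven (\<tau> \<omega>) l \<omega>"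
  using AE_walk
proof (rule AE_mp, intro AE_I2 impI allI)
  fix \<omega> l assume w: "\<omega> \<in> space P" and levels: "\<forall>l. \<exists>t\<in>\<rat> \<inter> {0..}. N t \<omega> + extra t \<omega> = l"
  note facts = points.paths(1)[OF w] points.paths(2)[OF w] counting_path_add[OF points.paths[OF w]] levels
  have "\<tau> \<omega> = (\<lambda>l. arrival_time (\<lambda>t \<omega>. N t \<omega> + extra t \<omega>) l \<omega>)"
    unfolding \<tau>_def Nn_eq ..
  with embedded_chain_thinned[where X = N and Y = extra and \<omega> = \<omega>, OF facts] show "sampled_chain J Nn l \<omega> = driven.driven (\<tau> \<omega>) l \<omega>"
    unfolding sampled_chain_eq[OF w] C_def by simp
qed

lemma sampled_chain_measurable: "sampled_chain J Nn l \<in> P \<rightarrow>\<^sub>M count_space UNIV"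
proof -
  have N: "N t \<in> P \<rightarrow>\<^sub>M count_space UNIV" if "0 \<le> t" for t by (rule points.measurable_P(1)[OF that])
  have "(\<lambda>\<omega>. \<tau> \<omega> l) \<in> P \<rightarrow>\<^sub>M restrict_space borel {0..}"
    using measurable_compose[OF measurable_from_subalg[OF observed_subalgebra \<tau>_measurable] measurable_component_singleton[of l]] by simp
  then have \<tau>l: "(\<lambda>\<omega>. \<tau> \<omega> l) \<in> borel_measurable P"
    by (simp add: measurable_restrict_space2_iff)
  have index: "(\<lambda>\<omega>. N (\<tau> \<omega> l) \<omega>) \<in> P \<rightarrow>\<^sub>M count_space UNIV"
    by (rule value_at_time_measurable[OF points.paths(1) N \<tau>l \<tau>_nonneg])
  have "(\<lambda>\<omega>. driven.chain (\<lambda>k. arrival_time N k \<omega>) (\<lambda>k. k) (\<lambda>k. U k \<omega>) m) \<in> P \<rightarrow>\<^sub>M count_space (insert None (Some ` {1..p}))" for m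
    using driven.chain_measurable[where T = "\<lambda>\<omega> k. arrival_time N k \<omega>" and C = "\<lambda>l _. l" and U = U and M = P and l = m]
      arrival_time_measurable(2)[OF points.paths(1) N] driven.uniform_measurable intensity_facts(1) by simp
  then have "(\<lambda>\<omega>. embedded_chain p lam0 \<alpha> \<Lambda> (\<lambda>k. arrival_time N k \<omega>) (\<lambda>k. U k \<omega>) m) \<in> P \<rightarrow>\<^sub>M count_space UNIV" for m
    unfolding embedded_chain_thinned_id by (rule measurable_compose) simp
  from measurable_compose_countable[OF this index] show ?thesis
    by (subst measurable_cong[OF sampled_chain_eq])
qed

lemma driven_joint_measurable:
  "(\<lambda>x. driven.driven (fst x) l (snd x)) \<in> time_space \<Otimes>\<^sub>M noise \<rightarrow>\<^sub>M count_space UNIV"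
proof -
  have "(\<lambda>x. driven.driven (fst x) l (snd x)) \<in> time_space \<Otimes>\<^sub>M noise \<rightarrow>\<^sub>M count_space (insert None (Some ` {1..p}))"
  proof (rule driven.chain_measurable[where C = "\<lambda>k x. C k (snd x)" and U = "\<lambda>k x. U k (snd x)"])
    show "(\<lambda>x. fst x l) \<in> time_space \<Otimes>\<^sub>M noise \<rightarrow>\<^sub>M restrict_space borel {0..}" for l
      by (rule measurable_compose[OF measurable_fst measurable_component_singleton]) simp
    show "(\<lambda>x. C l (snd x)) \<in> time_space \<Otimes>\<^sub>M noise \<rightarrow>\<^sub>M count_space UNIV" for l
      by (rule measurable_compose[OF measurable_snd sources_measurable(1)]) simp
    show "(\<lambda>x. U l (snd x)) \<in> borel_measurable (time_space \<Otimes>\<^sub>M noise)" for l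
      by (rule measurable_compose[OF measurable_snd sources_measurable(2)]) simp
  qed (rule intensity_facts(1))
  from measurable_compose[OF this, of "\<lambda>x. x"] show ?thesis by simp
qed

lemma step_matrix_eq: "step_matrix n \<Lambda> Nn \<omega> = driven.step (\<tau> \<omega>)"
  by (simp add: step_matrix_def driven.step_def \<tau>_def fun_eq_iff)

lemma sampled_chain_conditionally_markov:
  "conditionally_markov_chain P observed (sampled_chain J Nn) {1..p} \<alpha> (step_matrix n \<Lambda> Nn)"
proof -
  let ?H = "\<lambda>t \<omega> l. driven.driven t l \<omega>"
  have into: "(\<lambda>x l. y l x) \<in> K \<rightarrow>\<^sub>M sequence_space" if "\<And>l. y l \<in> K \<rightarrow>\<^sub>M count_space UNIV"
    for y :: "nat \<Rightarrow> 'b \<Rightarrow> nat option" and K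
    unfolding sequence_space_def by (rule measurable_PiM_single') (simp_all add: that)
  have "conditional_distribution P observed (\<lambda>\<omega> l. sampled_chain J Nn l \<omega>) sequence_space
      (\<lambda>\<omega>. distr P sequence_space (?H (\<tau> \<omega>)))"
  proof (rule conditional_distribution_freeze[OF prob_space_axioms observed_subalgebra from_sources_subalgebra observed_independent \<tau>_measurable])
    show "(\<lambda>(t, \<omega>). ?H t \<omega>) \<in> time_space \<Otimes>\<^sub>M noise \<rightarrow>\<^sub>M sequence_space"
      using into[OF driven_joint_measurable] by (simp add: case_prod_beta')
    show "(\<lambda>\<omega> l. sampled_chain J Nn l \<omega>) \<in> P \<rightarrow>\<^sub>M sequence_space"
      by (rule into[OF sampled_chain_measurable])
    show "AE \<omega> in P. (\<lambda>l. sampled_chain J Nn l \<omega>) = ?H (\<tau> \<omega>) \<omega>"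
      using sampled_chain_driven by (simp add: fun_eq_iff)
  qed
  moreover have "markov_chain (distr P sequence_space (?H (\<tau> \<omega>))) (\<lambda>l y. y l) {1..p} \<alpha> (step_matrix n \<Lambda> Nn \<omega>)" for \<omega>
    unfolding step_matrix_eq
  proof (rule markov_chain_distr)
    interpret killed_chain P "{1..p}" "driven.step (\<tau> \<omega>)" "driven.driven (\<tau> \<omega>)" \<alpha>
      by (rule driven.driven_killed_chain[OF \<tau>_nonneg])
    show "?H (\<tau> \<omega>) \<in> P \<rightarrow>\<^sub>M sequence_space" by (rule into[OF measurable_chain])
    show "markov_chain P (driven.driven (\<tau> \<omega>)) {1..p} \<alpha> (driven.step (\<tau> \<omega>))" by (rule markov_chain)
  qed
  ultimately show ?thesis
    unfolding conditionally_markov_chain_def conditionally_def by blast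
qed

lemma frozen_clocked_chain:
  assumes t: "\<And>l. 0 \<le> t l"
  shows "clocked_chain P {1..p} (driven.step t) (driven.driven t) \<alpha> n Mn (from_sources ({Counts} \<union> range Uniform)) (from_sources {Clock})"
proof -
  interpret killed_chain P "{1..p}" "driven.step t" "driven.driven t" \<alpha>
    by (rule driven.driven_killed_chain[OF t])
  let ?G = "from_sources ({Counts} \<union> range Uniform)"
  show ?thesis
  proof unfold_locales
    show "counting_path (\<lambda>s. Mn s \<omega>)" if "\<omega> \<in> space P" for \<omega> by (rule Mn_poisson(2)[OF that])
    show "poisson_increments P (real n) Mn" by (rule Mn_poisson)
    show "driven.driven t l \<in> ?G \<rightarrow>\<^sub>M count_space UNIV" for l
    proof -
      have "driven.driven t l \<in> ?G \<rightarrow>\<^sub>M count_space (insert None (Some ` {1..p}))"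
      proof (rule driven.chain_measurable[where T = "\<lambda>_. t"])
        show "(\<lambda>_. t l) \<in> ?G \<rightarrow>\<^sub>M restrict_space borel {0..}" for l
          using t by (intro measurable_const) (simp add: space_restrict_space)
      qed (auto intro: sources_measurable intensity_facts(1))
      from measurable_compose[OF this, of "\<lambda>x. x"] show ?thesis by simp
    qed
    show "Mn s \<in> from_sources {Clock} \<rightarrow>\<^sub>M count_space UNIV" if "0 \<le> s" for s
      by (rule sources_measurable(3)[OF _ that]) simp
    show "prob (A \<inter> B) = prob A * prob B" if "A \<in> sets ?G" "B \<in> sets (from_sources {Clock})" for A B
      by (rule independent_generated[OF sources_independent sources_stable _ _ _ that]) auto
  qed (rule from_sources_subalgebra)+
qed

lemma level_process_conditionally_markov:
  "conditionally_markov_jump_process P observed (process_LJn J Nn Mn) (UNIV \<times> {1..p}) (block_initial \<alpha>)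
     (\<lambda>\<omega>. block_intensity n (step_matrix n \<Lambda> Nn \<omega>))"
proof -
  let ?X = "\<lambda>t s \<omega>. map_option (Pair (Mn s \<omega>)) (driven.driven t (Mn s \<omega>) \<omega>)"
  let ?H = "\<lambda>t \<omega>. \<lambda>s\<in>{0..}. ?X t s \<omega>"
  let ?L = "\<lambda>\<omega>. \<lambda>s\<in>{0..}. process_LJn J Nn Mn s \<omega>"
  have L: "?L \<omega> = (\<lambda>s\<in>{0..}. map_option (Pair (Mn s \<omega>)) (sampled_chain J Nn (Mn s \<omega>) \<omega>))" if "\<omega> \<in> space P" for \<omega>
  proof (rule restrict_ext)
    fix s :: real assume "s \<in> {0..}"
    then have "arrival_index Mn s \<omega> = Mn s \<omega>"
      using arrival_index_eq[where X = Mn and \<omega> = \<omega>, OF Mn_poisson(2)[OF that]] by simp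
    then show "process_LJn J Nn Mn s \<omega> = map_option (Pair (Mn s \<omega>)) (sampled_chain J Nn (Mn s \<omega>) \<omega>)"
      by (simp add: process_LJn_def process_Jn_def)
  qed
  have MnP: "Mn s \<in> P \<rightarrow>\<^sub>M count_space UNIV" if "0 \<le> s" for s
    by (rule measurable_from_subalg[OF from_sources_subalgebra sources_measurable(3)[of UNIV, OF _ that]]) simp
  have "conditional_distribution P observed ?L jump_path_space (\<lambda>\<omega>. distr P jump_path_space (?H (\<tau> \<omega>)))"
  proof (rule conditional_distribution_freeze[OF prob_space_axioms observed_subalgebra from_sources_subalgebra observed_independent \<tau>_measurable])
    have "(\<lambda>x. \<lambda>s\<in>{0..}. ?X (fst x) s (snd x)) \<in> time_space \<Otimes>\<^sub>M noise \<rightarrow>\<^sub>M jump_path_space"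
    proof (rule level_path_measurable[where m = "\<lambda>s x. Mn s (snd x)" and y = "\<lambda>l x. driven.driven (fst x) l (snd x)"])
      show "counting_path (\<lambda>s. Mn s (snd x))" if "x \<in> space (time_space \<Otimes>\<^sub>M noise)" for x
        using that by (intro Mn_poisson(2)) (auto simp: space_pair_measure)
      show "(\<lambda>x. Mn s (snd x)) \<in> time_space \<Otimes>\<^sub>M noise \<rightarrow>\<^sub>M count_space UNIV" if "0 \<le> s" for s
        by (rule measurable_compose[OF measurable_snd sources_measurable(3)[OF _ that]]) simp
    qed (rule driven_joint_measurable)
    then show "(\<lambda>(t, \<omega>). ?H t \<omega>) \<in> time_space \<Otimes>\<^sub>M noise \<rightarrow>\<^sub>M jump_path_space"
      by (simp add: case_prod_beta')
    have "(\<lambda>\<omega>. \<lambda>s\<in>{0..}. map_option (Pair (Mn s \<omega>)) (sampled_chain J Nn (Mn s \<omega>) \<omega>)) \<in> P \<rightarrow>\<^sub>M jump_path_space"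
      by (rule level_path_measurable[OF Mn_poisson(2) MnP sampled_chain_measurable])
    then show "?L \<in> P \<rightarrow>\<^sub>M jump_path_space"
      by (subst measurable_cong[OF L])
    show "AE \<omega> in P. ?L \<omega> = ?H (\<tau> \<omega>) \<omega>"
      using sampled_chain_driven
    proof (rule AE_mp, intro AE_I2 impI)
      fix \<omega> assume "\<omega> \<in> space P" "\<forall>l. sampled_chain J Nn l \<omega> = driven.driven (\<tau> \<omega>) l \<omega>"
      then show "?L \<omega> = ?H (\<tau> \<omega>) \<omega>" by (simp only: L)
    qed
  qed
  moreover have "markov_jump_process (distr P jump_path_space (?H (\<tau> \<omega>))) (\<lambda>t f. f t) (UNIV \<times> {1..p}) (block_initial \<alpha>)
      (block_intensity n (step_matrix n \<Lambda> Nn \<omega>))" for \<omega>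
  proof (rule markov_jump_process_distr)
    interpret clocked_chain P "{1..p}" "driven.step (\<tau> \<omega>)" "driven.driven (\<tau> \<omega>)" \<alpha> n Mn
      "from_sources ({Counts} \<union> range Uniform)" "from_sources {Clock}"
      by (rule frozen_clocked_chain[OF \<tau>_nonneg])
    have X: "level_process = ?X (\<tau> \<omega>)" by (simp add: level_process_def fun_eq_iff)
    show "?H (\<tau> \<omega>) \<in> P \<rightarrow>\<^sub>M jump_path_space"
      by (rule level_path_measurable[OF Mn_poisson(2) MnP measurable_chain])
    have "block_intensity n (step_matrix n \<Lambda> Nn \<omega>) = level_intensity n"
      unfolding step_matrix_eq by (simp add: block_intensity_def level_intensity_def fun_eq_iff)
    moreover have "block_initial \<alpha> = (\<lambda>x. if fst x = 0 then \<alpha> (snd x) else 0)"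
      by (simp add: block_initial_def fun_eq_iff)
    ultimately show "markov_jump_process P (?X (\<tau> \<omega>)) (UNIV \<times> {1..p}) (block_initial \<alpha>) (block_intensity n (step_matrix n \<Lambda> Nn \<omega>))"
      using markov_jump_process unfolding X by simp
  qed
  ultimately show ?thesis
    unfolding conditionally_markov_jump_process_def conditionally_def by blast
qed

end

theorem theorem1:
  fixes P :: "'w measure"
    and p n lam0 :: nat
    and \<Lambda> :: "nat \<Rightarrow> nat \<Rightarrow> real \<Rightarrow> real"
    and \<alpha> :: "nat \<Rightarrow> real"
    and N M :: "real \<Rightarrow> 'w \<Rightarrow> nat"
    and Nh Mh :: "nat \<Rightarrow> real \<Rightarrow> 'w \<Rightarrow> nat"
    and U :: "nat \<Rightarrow> 'w \<Rightarrow> real"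
    and Nn Mn :: "real \<Rightarrow> 'w \<Rightarrow> nat"
    and J :: "real \<Rightarrow> 'w \<Rightarrow> nat option"
  assumes "p \<ge> 1"
    and "intensity_matrix_function p \<Lambda>"
    and "bdd_above (diagonal_sizes p \<Lambda>)"
    and "probability_vector p \<alpha>"
    and "lam0 = uniformization_rate p \<Lambda>"
    and "lam0 > 0"
    and "driving_components P lam0 N M Nh Mh U"
    and "n \<ge> lam0"
    and "Nn = superposition lam0 n N Nh"
    and "Mn = superposition lam0 n M Mh"
    and "J = process_J p lam0 \<alpha> \<Lambda> U N"
  shows "conditionally_markov_chain P (process_algebra P Nn) (sampled_chain J Nn) {1..p} \<alpha>
           (step_matrix n \<Lambda> Nn)
       \<and> conditionally_markov_jump_process P (process_algebra P Nn) (process_LJn J Nn Mn)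
           (UNIV \<times> {1..p}) (block_initial \<alpha>)
           (\<lambda>\<omega>. block_intensity n (step_matrix n \<Lambda> Nn \<omega>))"
proof -
  interpret coupled_construction P p n lam0 \<Lambda> \<alpha> N M Nh Mh U
    by unfold_locales (rule assms)+
  show ?thesis
    unfolding assms(9-11)
    using sampled_chain_conditionally_markov level_process_conditionally_markov by (rule conjI)
qed

end
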